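(* Let $m\ge 1$ and let $H$ be a homogeneous subharmonic real-valued polynomial on $\mathbb C$ of degree $2m$ which contains no harmonic terms. Let $\Omega$ be a domain in $\mathbb C^2$ and let $p\in\partial\Omega$. Suppose that $\Omega$ satisfies Condition $(M_H)$ at $p$ and that there exist a sequence $\{f_n\}\subset \mathrm{Aut}(\Omega)$ and a point $q\in\Omega$ such that $\{f_n(q)\}$ converges tangentially to order $\le 2m$ $(=\deg(H))$ to $p$. Then $\Omega$ is biholomorphically equivalent to the model $M_H$.
   Context: $\mathrm{Aut}(\Omega)$ is the group of biholomorphic self-maps of $\Omega$. The model $M_H$ is $M_H=\{(z_1,z_2)\in\mathbb C^2:\mathrm{Re}\,z_2+H(z_1)<0\}$. "Contains no harmonic terms" means that, writing $H$ as a polynomial in $z_1,\bar z_1$, no pure terms $z_1^k$ or $\bar z_1^k$ occur. Condition $(M_H)$ at $p$: there exist neighborhoods $U$ of $p$ and $V$ of $(0,0)$ and a biholomorphism $\Phi$ from $U\cap\Omega$ onto $V\cap M_H$ which extends homeomorphically to $U\cap\partial\Omega$ with $\Phi(p)=(0,0)$. In this circumstance, a sequence $\{\eta_n\}\subset U\cap\Omega$ converging to $p$ is said to converge tangentially to order $s$ $(s>0)$ to $p$ if $\mathrm{dist}(\Phi(\eta_n),\partial M_H)\approx|\Phi(\eta_n)_1|^s$, where $\mathrm{dist}(z,\partial M_H)$ is the Euclidean distance from $z$ to $\partial M_H$, $\Phi(\eta_n)_1$ is the first coordinate of $\Phi(\eta_n)$, and $A_n\approx B_n$ means that there is a constant $C\ge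 1$ with $C^{-1}B_n\le A_n\le CB_n$ for all $n$. "To order $\le 2m$" means to order $s$ for some $s$ with $0<s\le 2m$. *)

theory Defs
  imports "HOL-Analysis.Analysis" "HOL-Computational_Algebra.Polynomial"
begin

section \<open>Holomorphic maps in several variables\<close>

text \<open>
  Complex differentiability of a map at every point of \<open>S\<close>: the real Frechet derivative exists
  and is complex linear. This is used on open sets only; on \<^typ>\<open>complex ^ 'n\<close> the norm
  is the Euclidean one.
\<close>

definition holomorphic_map_on ::
    "(complex ^ 'n \<Rightarrow> complex ^ 'm) \<Rightarrow> (complex ^ 'n) set \<Rightarrow> bool" where
  "holomorphic_map_on f S \<longleftrightarrow>
     (\<forall>x\<in>S. \<exists>D. (f has_derivative D) (at x) \<and> (\<forall>c v. D (c *s v) = c *s D v))"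

definition biholomorphic_map ::
    "(complex ^ 'n) set \<Rightarrow> (complex ^ 'm) set \<Rightarrow> (complex ^ 'n \<Rightarrow> complex ^ 'm) \<Rightarrow> bool" where
  "biholomorphic_map S T f \<longleftrightarrow>
     bij_betw f S T \<and> holomorphic_map_on f S \<and>
     (\<exists>g. (\<forall>x\<in>S. g (f x) = x) \<and> holomorphic_map_on g T)"

definition biholomorphically_equivalent ::
    "(complex ^ 'n) set \<Rightarrow> (complex ^ 'm) set \<Rightarrow> bool" where
  "biholomorphically_equivalent S T \<longleftrightarrow> (\<exists>f. biholomorphic_map S T f)"

text \<open>Automorphisms are represented by total functions; their values off \<open>\<Omega>\<close> are irrelevant.\<close>

definition Aut :: "(complex ^ 'n) set \<Rightarrow> (complex ^ 'n \<Rightarrow> complex ^ 'n) set" where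
  "Aut \<Omega> = {f. biholomorphic_map \<Omega> \<Omega> f}"

section \<open>Polynomials in a complex variable and its conjugate\<close>

text \<open>
  A bivariate polynomial \<open>P\<close> stands for the function whose coefficient at
  \<open>z ^ j * cnj z ^ k\<close> is \<open>coeff (coeff P k) j\<close>. These coefficients are uniquely
  determined by the function.
\<close>

definition eval_zzbar :: "complex poly poly \<Rightarrow> complex \<Rightarrow> complex" where
  "eval_zzbar P z = poly (poly P [:cnj z:]) z"

text \<open>The zero polynomial is excluded, so that the degree is exactly \<open>d\<close>.\<close>

definition homogeneous_zzbar :: "nat \<Rightarrow> complex poly poly \<Rightarrow> bool" where
  "homogeneous_zzbar d P \<longleftrightarrow> P \<noteq> 0 \<and> (\<forall>j k. coeff (coeff P k) j \<noteq> 0 \<longrightarrow> j + k = d)"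

definition no_harmonic_terms :: "complex poly poly \<Rightarrow> bool" where
  "no_harmonic_terms P \<longleftrightarrow> (\<forall>k. coeff (coeff P 0) k = 0 \<and> coeff (coeff P k) 0 = 0)"

text \<open>
  Subharmonicity on the whole plane by the sub-mean value inequality over circles, for
  continuous functions (so that upper semicontinuity is automatic and the integral exists).
\<close>

definition continuous_subharmonic :: "(complex \<Rightarrow> real) \<Rightarrow> bool" where
  "continuous_subharmonic u \<longleftrightarrow>
     continuous_on UNIV u \<and>
     (\<forall>z. \<forall>r>0. u z \<le> integral {0..2*pi} (\<lambda>t. u (z + of_real r * cis t)) / (2*pi))"

section \<open>The model and tangential convergence\<close>

definition model :: "(complex \<Rightarrow> real) \<Rightarrow> (complex ^ 2) set" where
  "model H = {z. Re (z $ 2) + H (z $ 1) < 0}"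

text \<open>
  The map \<open>\<Phi>\<close> and its extension to the boundary are one and the same total function.
  The extension is required to be a homeomorphism onto its image.
\<close>

definition condition_M ::
    "(complex \<Rightarrow> real) \<Rightarrow> (complex ^ 2) set \<Rightarrow> complex ^ 2 \<Rightarrow> (complex ^ 2) set \<Rightarrow>
     (complex ^ 2) set \<Rightarrow> (complex ^ 2 \<Rightarrow> complex ^ 2) \<Rightarrow> bool" where
  "condition_M H \<Omega> p U V \<Phi> \<longleftrightarrow>
     open U \<and> p \<in> U \<and> open V \<and> 0 \<in> V \<and>
     biholomorphic_map (U \<inter> \<Omega>) (V \<inter> model H) \<Phi> \<and>
     (\<exists>\<Psi>. homeomorphism (U \<inter> closure \<Omega>) (\<Phi> ` (U \<inter> closure \<Omega>)) \<Phi> \<Psi>) \<and>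
     \<Phi> p = 0"

definition comparable :: "(nat \<Rightarrow> real) \<Rightarrow> (nat \<Rightarrow> real) \<Rightarrow> bool" where
  "comparable A B \<longleftrightarrow> (\<exists>C\<ge>1. \<forall>n. inverse C * B n \<le> A n \<and> A n \<le> C * B n)"

definition converges_tangentially ::
    "(complex \<Rightarrow> real) \<Rightarrow> (complex ^ 2) set \<Rightarrow> (complex ^ 2) set \<Rightarrow> (complex ^ 2 \<Rightarrow> complex ^ 2) \<Rightarrow>
     real \<Rightarrow> (nat \<Rightarrow> complex ^ 2) \<Rightarrow> complex ^ 2 \<Rightarrow> bool" where
  "converges_tangentially H \<Omega> U \<Phi> s \<eta> p \<longleftrightarrow>
     range \<eta> \<subseteq> U \<inter> \<Omega> \<and> \<eta> \<longlonglongrightarrow> p \<and>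
     comparable (\<lambda>n. infdist (\<Phi> (\<eta> n)) (frontier (model H))) (\<lambda>n. cmod (\<Phi> (\<eta> n) $ 1) powr s)"

end

theory Submission
  imports Defs "HOL-Complex_Analysis.Complex_Analysis"
begin

text \<open>
  Write \<open>\<eta>\<^sub>n = f\<^sub>n(q)\<close>, \<open>(a\<^sub>n, b\<^sub>n) = \<Phi>(\<eta>\<^sub>n)\<close> and \<open>\<rho>(z) = Re z\<^sub>2 + H(z\<^sub>1)\<close>, so that
  \<open>\<epsilon>\<^sub>n = -\<rho>(a\<^sub>n, b\<^sub>n) > 0\<close>. The model is invariant under the translations
  \<open>z\<^sub>2 \<mapsto> z\<^sub>2 + i t\<close> and the dilations \<open>(\<lambda> z\<^sub>1, \<lambda>\<^bsup>2m\<^esup> z\<^sub>2)\<close>. The boundary point vertically above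
  \<open>(a\<^sub>n, b\<^sub>n)\<close> shows that the distance to the boundary is at most \<open>\<epsilon>\<^sub>n\<close>; hence tangency to
  order at most \<open>2m\<close> says that \<open>|a\<^sub>n|\<^bsup>2m\<^esup>\<close> is at most a constant times \<open>\<epsilon>\<^sub>n\<close>. This is exactly
  what keeps the rescaled points \<open>T\<^sub>n(a\<^sub>n, b\<^sub>n)\<close> in a compact part of the model, where \<open>T\<^sub>n\<close>
  removes \<open>Im b\<^sub>n\<close> and dilates with \<open>\<lambda>\<^bsup>2m\<^esup> = 1/\<epsilon>\<^sub>n\<close>. A biholomorphism from \<open>\<Omega>\<close> to the model is
  then found as a limit of \<open>G\<^sub>n = T\<^sub>n \<circ> \<Phi> \<circ> f\<^sub>n\<close>, its inverse as a limit of the inverse maps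
  \<open>F\<^sub>n\<close>. No hyperbolicity of \<open>\<Omega>\<close> is known in advance, so both normality statements must be
  derived from the geometry at \<open>p\<close>.

  The tool is attraction of discs (\<open>condition_M_attracts_discs\<close>): an analytic disc in \<open>\<Omega>\<close>
  whose centre is close to \<open>p\<close> has a fixed smaller disc close to \<open>p\<close>. It yields that
  \<open>f\<^sub>n\<close> converges to \<open>p\<close> locally uniformly, so that \<open>G\<^sub>n\<close> is eventually defined on every
  compact set; applied to the model itself and its dilations it bounds \<open>G\<^sub>n\<close> locally
  (\<open>G_locally_bounded\<close>); applied to \<open>f\<^sub>N \<circ> F\<^sub>n\<close> with a large fixed \<open>N\<close> it turns \<open>F\<^sub>n\<close> into
  bounded maps, and the strong maximum principle for \<open>\<rho>\<close> keeps the values of \<open>F\<^sub>n\<close> in compact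
  subsets of \<open>\<Omega>\<close> (\<open>F_compactly_valued\<close>). Passing to the limit in \<open>F\<^sub>n \<circ> G\<^sub>n = id\<close> and
  \<open>G\<^sub>n \<circ> F\<^sub>n = id\<close> finishes the proof.

  Attraction rests on two facts. First, the model has a plurisubharmonic peak function at
  the origin: \<open>H\<close> can be lowered, away from the origin, to a subharmonic function
  \<open>Ht \<le> H - \<delta> |z|\<^bsup>2m\<^esup>\<close> (\<open>bumped_subharmonic\<close>), because subharmonicity and the absence of
  harmonic terms make \<open>H\<close> lie strictly above its tangent functions \<open>Re (c z\<^bsup>2m\<^esup>)\<close> next to
  the ray of tangency.
  Composed with \<open>\<Phi>\<close> and cut off from below, the peak function lives on all of \<open>\<Omega>\<close>. Second,
  an estimate of Milloux type (\<open>milloux\<close>): if a disc leaves a small polydisc around \<open>p\<close>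
  close to its centre, it stays outside along a continuum that reaches the boundary of the
  disc, and a negative subharmonic function that is minimal on such a continuum is
  definitely negative at the centre.
\<close>

section \<open>Continuous functions with the local sub-mean value property\<close>

text \<open>
  Subharmonicity is used in the weak local form below, whose only requirement is the
  inequality for circles of sufficiently small radius around each point. It is preserved by
  gluing along a minimum; global inequalities are recovered from the maximum principle.
\<close>

definition circle_mean :: "(complex \<Rightarrow> real) \<Rightarrow> complex \<Rightarrow> real \<Rightarrow> real" where
  "circle_mean u z r = integral {0..2*pi} (\<lambda>t. u (z + of_real r * cis t)) / (2*pi)"

definition submean_at :: "(complex \<Rightarrow> real) \<Rightarrow> complex \<Rightarrow> bool" where
  "submean_at u z \<longleftrightarrow> (\<exists>r0>0. \<forall>r. 0 < r \<and> r < r0 \<longrightarrow> u z \<le> circle_mean u z r)"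

text \<open>
  A touching real part of a holomorphic function from below is a certificate of
  subharmonicity that survives composition with holomorphic maps, for which the sub-mean
  value inequality alone gives no direct argument.
\<close>

definition supported_at :: "(complex \<Rightarrow> real) \<Rightarrow> complex \<Rightarrow> bool" where
  "supported_at u z \<longleftrightarrow>
     (\<exists>g e. e > 0 \<and> g holomorphic_on ball z e \<and> Re (g z) = u z \<and> (\<forall>w\<in>ball z e. Re (g w) \<le> u w))"

lemma continuous_on_circle:
  assumes "continuous_on S u" "sphere z r \<subseteq> S" "0 \<le> r"
  shows "continuous_on A (\<lambda>t. u (z + of_real r * cis t))"
proof -
  have "continuous_on A (\<lambda>t. z + of_real r * cis t)"
    by (intro continuous_intros)
  moreover have "(\<lambda>t. z + of_real r * cis t) ` A \<subseteq> S"
    using assms(2,3) by (auto simp: dist_norm norm_mult subset_iff)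
  ultimately show ?thesis
    using continuous_on_compose2[OF assms(1)] by blast
qed

lemma circle_integrable:
  assumes "continuous_on S u" "sphere z r \<subseteq> S" "0 \<le> r"
  shows "(\<lambda>t. u (z + of_real r * cis t) :: real) integrable_on {a..b}"
  by (intro integrable_continuous_interval continuous_on_circle[OF assms])

lemma circle_mean_mono:
  assumes "continuous_on (sphere z r) u" "continuous_on (sphere z r) v" "0 \<le> r"
    and "\<And>w. w \<in> sphere z r \<Longrightarrow> u w \<le> v w"
  shows "circle_mean u z r \<le> circle_mean v z r"
  unfolding circle_mean_def
  by (intro divide_right_mono integral_le circle_integrable[of "sphere z r"])
     (use assms in \<open>auto simp: dist_norm norm_mult\<close>)

lemma circle_mean_add:
  assumes "continuous_on (sphere z r) u" "continuous_on (sphere z r) v" "0 \<le> r"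
  shows "circle_mean (\<lambda>w. u w + v w) z r = circle_mean u z r + circle_mean v z r"
  unfolding circle_mean_def add_divide_distrib[symmetric]
  by (subst integral_add) (use assms in \<open>auto intro: circle_integrable[of "sphere z r"]\<close>)

lemma circle_mean_const [simp]: "circle_mean (\<lambda>w. c) z r = c"
  by (simp add: circle_mean_def)

lemma circle_mean_cong:
  assumes "\<And>w. w \<in> sphere z r \<Longrightarrow> u w = v w" "0 \<le> r"
  shows "circle_mean u z r = circle_mean v z r"
proof -
  have "(\<lambda>t. u (z + of_real r * cis t)) = (\<lambda>t. v (z + of_real r * cis t))"
    by (rule ext, rule assms) (use assms(2) in \<open>auto simp: dist_norm norm_mult\<close>)
  then show ?thesis by (simp add: circle_mean_def)
qed

lemma circle_mean_Re_holomorphic: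
  assumes "f holomorphic_on cball z r" "0 < r"
  shows "circle_mean (\<lambda>w. Re (f w)) z r = Re (f z)"
proof -
  have hc: "((\<lambda>u. f u / (u - z)) has_contour_integral (2 * of_real pi * \<i> * f z)) (part_circlepath z r 0 (2*pi))"
    using Cauchy_integral_circlepath_simple[OF assms(1), of z] assms(2)
    by (simp add: circlepath_def)
  have "2 * of_real pi * \<i> * f z
      = integral {0..2*pi} (\<lambda>t. f (z + r * cis t) / (z + r * cis t - z) * r * \<i> * cis t)"
    using contour_integral_unique[OF hc] contour_integral_part_circlepath_eq[of 0 "2*pi" z r "\<lambda>u. f u / (u - z)"]
    by simp
  also have "\<dots> = integral {0..2*pi} (\<lambda>t. \<i> * f (z + r * cis t))"
    using assms(2) by (simp add: field_simps)
  also have "\<dots> = \<i> * integral {0..2*pi} (\<lambda>t. f (z + r * cis t))"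
    by simp
  finally have eq: "integral {0..2*pi} (\<lambda>t. f (z + r * cis t)) = 2 * of_real pi * f z"
    by (simp add: field_simps)
  have cf: "continuous_on (cball z r) f"
    using assms(1) holomorphic_on_imp_continuous_on by blast
  have "continuous_on {0..2*pi} (\<lambda>t. f (z + r * cis t))"
    by (rule continuous_on_circle[OF cf]) (use assms in auto)
  then have "(\<lambda>t. f (z + r * cis t)) integrable_on {0..2*pi}"
    by (rule integrable_continuous_interval)
  from integral_linear[OF this bounded_linear_Re]
  have "integral {0..2*pi} (\<lambda>t. Re (f (z + r * cis t))) = Re (2 * of_real pi * f z)"
    by (simp add: o_def eq)
  then show ?thesis by (simp add: circle_mean_def)
qed

text \<open>
  A continuous function below \<open>M\<close> whose mean is \<open>M\<close> is constant on the circle. The restriction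
  of \<open>t\<close> is that of the interval over which the mean is taken.
\<close>

lemma circle_mean_attains_bound:
  assumes "continuous_on (sphere z r) u" "0 \<le> r" "\<And>w. w \<in> sphere z r \<Longrightarrow> u w \<le> M"
    and "M \<le> circle_mean u z r" "t \<in> {0..2*pi}"
  shows "u (z + of_real r * cis t) = M"
proof -
  let ?f = "\<lambda>t. M - u (z + of_real r * cis t)"
  have cont: "continuous_on {0..2*pi} ?f"
    using continuous_on_circle[OF assms(1) order_refl assms(2)] by (intro continuous_intros) auto
  have nn: "?f t \<ge> 0" for t using assms(2,3) by (simp add: dist_norm norm_mult)
  have "integral {0..2*pi} ?f = 2*pi*M - integral {0..2*pi} (\<lambda>t. u (z + of_real r * cis t))"
    by (subst integral_diff) (use circle_integrable[OF assms(1) order_refl assms(2)] in auto)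
  also have "\<dots> = 2*pi*(M - circle_mean u z r)"
    by (simp add: circle_mean_def field_simps)
  also have "\<dots> \<le> 0" using assms(4) by (simp add: mult_le_0_iff)
  finally have "integral {0..2*pi} ?f \<le> 0" .
  moreover have "integral {0..2*pi} ?f \<ge> 0"
    by (rule integral_nonneg) (use nn cont integrable_continuous_interval in auto)
  ultimately have "integral {0..2*pi} ?f = 0" by simp
  then have "\<forall>t\<in>{0..2*pi}. ?f t = 0"
    by (subst (asm) integral_eq_0_iff) (use cont nn in auto)
  then show ?thesis using assms(5) by force
qed

lemma submean_at_cong:
  assumes "submean_at u z" "e > 0" "\<And>w. w \<in> ball z e \<Longrightarrow> u w = v w"
  shows "submean_at v z"
proof -
  obtain r0 where r0: "r0 > 0" "\<And>r. 0 < r \<Longrightarrow> r < r0 \<Longrightarrow> u z \<le> circle_mean u z r"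
    using assms(1) by (auto simp: submean_at_def)
  have "v z \<le> circle_mean v z r" if "0 < r" "r < min r0 e" for r
  proof -
    have "circle_mean u z r = circle_mean v z r"
      by (rule circle_mean_cong) (use that assms in auto)
    then show ?thesis using r0(2)[of r] that assms(2) assms(3)[of z] by auto
  qed
  then show ?thesis unfolding submean_at_def
    using r0(1) assms(2) by (intro exI[of _ "min r0 e"]) auto
qed

lemma submean_at_minimum:
  assumes "e > 0" "continuous_on (ball z e) u" "\<And>w. w \<in> ball z e \<Longrightarrow> u z \<le> u w"
  shows "submean_at u z"
  unfolding submean_at_def
proof (intro exI conjI allI impI)
  fix r assume r: "0 < r \<and> r < e"
  have "circle_mean (\<lambda>w. u z) z r \<le> circle_mean u z r"
    by (rule circle_mean_mono)
       (use r assms in \<open>auto intro!: continuous_on_subset[OF assms(2)] simp: subset_iff\<close>)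
  then show "u z \<le> circle_mean u z r" by simp
qed (fact assms(1))

lemma submean_at_add_Re_holomorphic:
  assumes "submean_at u z" "e > 0" "continuous_on (ball z e) u" "g holomorphic_on ball z e"
  shows "submean_at (\<lambda>w. u w + Re (g w)) z"
proof -
  obtain r0 where r0: "r0 > 0" "\<And>r. 0 < r \<Longrightarrow> r < r0 \<Longrightarrow> u z \<le> circle_mean u z r"
    using assms(1) by (auto simp: submean_at_def)
  have "u z + Re (g z) \<le> circle_mean (\<lambda>w. u w + Re (g w)) z r" if r: "0 < r" "r < min r0 e" for r
  proof -
    have sub: "cball z r \<subseteq> ball z e" using r by auto
    have g: "g holomorphic_on cball z r"
      using assms(4) sub holomorphic_on_subset by blast
    have "continuous_on (sphere z r) (\<lambda>w. Re (g w))" "continuous_on (sphere z r) u"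
      using holomorphic_on_imp_continuous_on[OF assms(4)] assms(3) sub
      by (auto intro!: continuous_intros continuous_on_subset[of "ball z e"])
    then show ?thesis
      using r r0(2)[of r] circle_mean_Re_holomorphic[OF g] by (subst circle_mean_add) auto
  qed
  then show ?thesis unfolding submean_at_def
    using r0(1) assms(2) by (intro exI[of _ "min r0 e"]) auto
qed

lemma submean_at_Re_holomorphic:
  assumes "open S" "z \<in> S" "g holomorphic_on S"
  shows "submean_at (\<lambda>w. Re (g w)) z"
proof -
  obtain e where e: "e > 0" "ball z e \<subseteq> S" using assms open_contains_ball by blast
  have "submean_at (\<lambda>w. 0) z" by (rule submean_at_minimum[of 1]) auto
  from submean_at_add_Re_holomorphic[OF this e(1), of g] show ?thesis
    using holomorphic_on_subset[OF assms(3) e(2)] by auto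
qed

lemma supported_at_imp_submean_at:
  assumes "supported_at u z" "e > 0" "continuous_on (ball z e) u"
  shows "submean_at u z"
proof -
  obtain g d where g: "d > 0" "g holomorphic_on ball z d" "Re (g z) = u z"
      "\<And>w. w \<in> ball z d \<Longrightarrow> Re (g w) \<le> u w"
    using assms(1) by (auto simp: supported_at_def)
  let ?e = "min d e"
  have cg: "continuous_on (ball z ?e) (\<lambda>w. Re (g w))"
    using holomorphic_on_imp_continuous_on[OF g(2)]
    by (auto intro!: continuous_intros intro: continuous_on_subset)
  have cu: "continuous_on (ball z ?e) u"
    using assms(3) by (rule continuous_on_subset) auto
  have hg: "g holomorphic_on ball z ?e"
    by (rule holomorphic_on_subset[OF g(2)]) auto
  have "submean_at (\<lambda>w. u w - Re (g w)) z"
    by (rule submean_at_minimum[of ?e]) (use g assms(2) cg cu in \<open>auto intro!: continuous_on_diff\<close>)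
  then have "submean_at (\<lambda>w. (u w - Re (g w)) + Re (g w)) z"
    by (rule submean_at_add_Re_holomorphic[of _ _ ?e])
       (use g(1) assms(2) cg cu hg in \<open>auto intro!: continuous_on_diff\<close>)
  then show ?thesis by simp
qed

text \<open>
  Among all points where the maximum is attained take one with the largest real part. If it
  were interior, the function would equal the maximum on a whole small circle around it, in
  particular further to the right.
\<close>

lemma submean_maximum_principle:
  assumes "compact K" "continuous_on K u"
    and sub: "\<And>z. z \<in> interior K \<Longrightarrow> submean_at u z"
    and bd: "\<And>z. z \<in> K - interior K \<Longrightarrow> u z \<le> c"
    and "z \<in> K"
  shows "u z \<le> c"
proof (rule ccontr)
  assume "\<not> u z \<le> c"
  obtain x where x: "x \<in> K" "\<And>y. y \<in> K \<Longrightarrow> u y \<le> u x"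
    using continuous_attains_sup[OF assms(1) _ assms(2)] assms(5) by blast
  define M where "M = u x"
  have M: "M > c" using x(2)[OF assms(5)] \<open>\<not> u z \<le> c\<close> by (simp add: M_def)
  let ?T = "K \<inter> u -` {M}"
  have "closedin (top_of_set K) ?T"
    by (rule continuous_closedin_preimage[OF assms(2)]) auto
  then have "compact ?T" using assms(1) closedin_compact by blast
  moreover have "x \<in> ?T" using x by (simp add: M_def)
  \<comment> \<open>the rightmost maximum point\<close>
  ultimately obtain y where y: "y \<in> ?T" "\<And>w. w \<in> ?T \<Longrightarrow> Re w \<le> Re y"
    using continuous_attains_sup[OF _ _ continuous_on_Re[OF continuous_on_id], of ?T] by blast
  have yi: "y \<in> interior K" using y(1) bd[of y] M by auto
  obtain r0 where r0: "r0 > 0" "\<And>r. 0 < r \<Longrightarrow> r < r0 \<Longrightarrow> u y \<le> circle_mean u y r"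
    using sub[OF yi] by (auto simp: submean_at_def)
  obtain e where e: "e > 0" "ball y e \<subseteq> K" using yi mem_interior by blast
  define r where "r = min r0 e / 2"
  have r: "0 < r" "r < r0" "r < e" using r0(1) e(1) by (auto simp: r_def)
  have sp: "sphere y r \<subseteq> K" using r e(2) by (auto simp: subset_iff)
  have cs: "continuous_on (sphere y r) u" using assms(2) sp by (rule continuous_on_subset)
  have "u (y + of_real r * cis 0) = M"
    by (rule circle_mean_attains_bound[OF cs]) (use r r0(2)[of r] y(1) x(2) sp in \<open>auto simp: M_def\<close>)
  then have "u (y + of_real r) = M" by simp
  moreover have "y + of_real r \<in> K" using sp r by (auto simp: subset_iff dist_norm)
  ultimately have "y + of_real r \<in> ?T" by simp
  from y(2)[OF this] r(1) show False by simp
qed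

text \<open>
  On the unit circle \<open>cnj w = 1 / w\<close>, so a negative power of \<open>w\<close> has the same real part as a
  positive power with conjugated coefficient. Hence real parts of polynomials form an algebra
  on the circle, to which the theorem of Stone and Weierstrass applies.
\<close>

lemma Re_poly_mult_cnj_on_circle:
  fixes p q :: "complex poly"
  shows "\<exists>r. \<forall>w\<in>sphere 0 1. Re (poly p w * cnj (poly q w)) = Re (poly r w)"
proof (induction p arbitrary: q)
  case 0
  show ?case by (intro exI[of _ 0]) auto
next
  case (pCons a p)
  obtain b q' where q: "q = pCons b q'" by (cases q)
  obtain r where r: "\<And>w. w \<in> sphere 0 1 \<Longrightarrow> Re (poly p w * cnj (poly q' w)) = Re (poly r w)"
    using pCons.IH by blast
  have "Re (poly (pCons a p) w * cnj (poly q w))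
      = Re (poly (smult (cnj a) q + smult (cnj b) (pCons 0 p) + r) w)" if "w \<in> sphere 0 1" for w
  proof -
    have ww: "w * cnj w = 1" using that by (simp add: complex_norm_square[symmetric])
    have "poly (pCons a p) w * cnj (poly q w)
        = a * cnj (poly q w) + cnj b * (w * poly p w) + (w * cnj w) * (poly p w * cnj (poly q' w))"
      by (simp add: q algebra_simps)
    also have "\<dots> = cnj (cnj a * poly q w) + cnj b * (w * poly p w) + poly p w * cnj (poly q' w)"
      by (simp add: ww)
    finally have "Re (poly (pCons a p) w * cnj (poly q w))
        = Re (cnj a * poly q w) + Re (cnj b * (w * poly p w)) + Re (poly r w)"
      using r[OF that] by (simp only: plus_complex.sel cnj.sel)
    then show ?thesis by (simp add: algebra_simps)
  qed
  then show ?case by blast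
qed

text \<open>
  This replaces the solution of the Dirichlet problem: continuous boundary values are
  uniformly close to those of a harmonic polynomial.
\<close>

lemma Re_poly_dense_on_circle:
  assumes "continuous_on (sphere z r) (u :: complex \<Rightarrow> real)" "0 < r" "e > 0"
  shows "\<exists>p. \<forall>w\<in>sphere z r. \<bar>u w - Re (poly p ((w - z) / of_real r))\<bar> < e"
proof -
  let ?R = "{f. \<exists>p. \<forall>w\<in>sphere 0 1. f w = Re (poly p w)}"
  interpret function_ring_on ?R "sphere 0 1 :: complex set"
  proof
    show "compact (sphere 0 1 :: complex set)" by simp
    fix f assume "f \<in> ?R"
    then obtain p where p: "\<And>w. w \<in> sphere 0 1 \<Longrightarrow> f w = Re (poly p w)" by auto
    have "continuous_on (sphere 0 1) (\<lambda>w. Re (poly p w))" by (intro continuous_intros)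
    then show "continuous_on (sphere 0 1) f" using p continuous_on_cong by metis
    fix g assume "g \<in> ?R"
    then obtain q where q: "\<And>w. w \<in> sphere 0 1 \<Longrightarrow> g w = Re (poly q w)" by auto
    show "(\<lambda>x. f x + g x) \<in> ?R"
      using p q by (auto intro!: exI[of _ "p + q"])
    obtain s where s: "\<And>w. w \<in> sphere 0 1 \<Longrightarrow> Re (poly p w * cnj (poly q w)) = Re (poly s w)"
      using Re_poly_mult_cnj_on_circle by blast
    have "f w * g w = Re (poly (smult (1/2) (p * q + s)) w)" if w: "w \<in> sphere 0 1" for w
    proof -
      have "Re (poly (smult (1/2) (p * q + s)) w)
          = (Re (poly p w * poly q w) + Re (poly p w * cnj (poly q w))) / 2"
        using s[OF w] by simp
      also have "\<dots> = f w * g w" using p[OF w] q[OF w] by simp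
      finally show ?thesis ..
    qed
    then show "(\<lambda>x. f x * g x) \<in> ?R" by blast
  next
    fix c :: real
    show "(\<lambda>_. c) \<in> ?R" by (auto intro!: exI[of _ "[:of_real c:]"])
  next
    fix x y :: complex assume "x \<noteq> y"
    then consider "Re x \<noteq> Re y" | "Im x \<noteq> Im y" using complex_eq_iff by blast
    then show "\<exists>f\<in>?R. f x \<noteq> f y"
    proof cases
      case 1
      have "Re \<in> ?R" by (auto intro!: exI[of _ "[:0,1:]"])
      then show ?thesis using 1 by blast
    next
      case 2
      have "Im \<in> ?R" by (auto intro!: exI[of _ "[:0,-\<i>:]"])
      then show ?thesis using 2 by blast
    qed
  qed
  have "continuous_on (sphere 0 1) (\<lambda>w. u (z + of_real r * w))"
    by (rule continuous_on_compose2[OF assms(1)])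
       (use assms(2) in \<open>auto intro!: continuous_intros simp: dist_norm norm_mult\<close>)
  from Stone_Weierstrass_basic[OF this assms(3)]
  obtain f where fR: "f \<in> ?R" and f: "\<forall>w\<in>sphere 0 1. \<bar>u (z + of_real r * w) - f w\<bar> < e" by blast
  from fR obtain p where p: "\<And>w. w \<in> sphere 0 1 \<Longrightarrow> f w = Re (poly p w)" by auto
  have "\<bar>u w - Re (poly p ((w - z) / of_real r))\<bar> < e" if w: "w \<in> sphere z r" for w
  proof -
    have "(w - z) / of_real r \<in> sphere 0 1"
      using w assms(2) by (simp add: norm_divide dist_norm norm_minus_commute)
    from bspec[OF f this] p[OF this] assms(2) show ?thesis by simp
  qed
  then show ?thesis by blast
qed

lemma submean_at_ln_norm:
  assumes "w \<noteq> z"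
  shows "submean_at (\<lambda>x. c * ln (norm (x - z))) w"
proof -
  let ?d = "norm (w - z)"
  have d: "?d > 0" using assms by simp
  have nz: "x \<noteq> z" "(x - z) / (w - z) \<notin> \<real>\<^sub>\<le>\<^sub>0" if "x \<in> ball w ?d" for x
  proof -
    have "norm ((x - w) / (w - z)) < 1"
      using that d by (simp add: norm_divide dist_norm norm_minus_commute)
    moreover have "(x - z) / (w - z) = 1 + (x - w) / (w - z)"
      using assms by (simp add: field_simps)
    ultimately have "Re ((x - z) / (w - z)) > 0"
      using abs_Re_le_cmod[of "(x - w) / (w - z)"] by simp
    then show "(x - z) / (w - z) \<notin> \<real>\<^sub>\<le>\<^sub>0" using complex_nonpos_Reals_iff by fastforce
    show "x \<noteq> z" using \<open>Re ((x - z) / (w - z)) > 0\<close> by auto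
  qed
  have hol: "(\<lambda>x. of_real c * (Ln ((x - z) / (w - z)) + of_real (ln ?d))) holomorphic_on ball w ?d"
    using nz by (auto intro!: holomorphic_intros simp: assms)
  have "submean_at (\<lambda>x. Re (of_real c * (Ln ((x - z) / (w - z)) + of_real (ln ?d)))) w"
    by (rule submean_at_Re_holomorphic[OF _ _ hol]) (use d in auto)
  then show ?thesis
  proof (rule submean_at_cong[OF _ d])
    fix x assume x: "x \<in> ball w ?d"
    have "(x - z) / (w - z) \<noteq> 0" using nz(1)[OF x] assms by simp
    then have "Re (Ln ((x - z) / (w - z))) = ln (norm (x - z) / ?d)"
      by (metis Re_Ln norm_divide)
    also have "\<dots> = ln (norm (x - z)) - ln ?d"
      using nz(1)[OF x] d by (simp add: ln_div)
    finally show "Re (of_real c * (Ln ((x - z) / (w - z)) + of_real (ln ?d))) = c * ln (norm (x - z))"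
      by simp
  qed
qed

lemma submean_at_add:
  assumes "submean_at u z" "submean_at v z" "e > 0"
    "continuous_on (ball z e) u" "continuous_on (ball z e) v"
  shows "submean_at (\<lambda>w. u w + v w) z"
proof -
  obtain r0 where r0: "r0 > 0" "\<And>r. 0 < r \<Longrightarrow> r < r0 \<Longrightarrow> u z \<le> circle_mean u z r"
    using assms(1) by (auto simp: submean_at_def)
  obtain r1 where r1: "r1 > 0" "\<And>r. 0 < r \<Longrightarrow> r < r1 \<Longrightarrow> v z \<le> circle_mean v z r"
    using assms(2) by (auto simp: submean_at_def)
  have "u z + v z \<le> circle_mean (\<lambda>w. u w + v w) z r" if r: "0 < r" "r < min e (min r0 r1)" for r
  proof -
    have "sphere z r \<subseteq> ball z e" using r by auto
    then have "continuous_on (sphere z r) v" "continuous_on (sphere z r) u"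
      using assms(4,5) by (auto intro: continuous_on_subset)
    then show ?thesis
      using r r0(2)[of r] r1(2)[of r] by (subst circle_mean_add) auto
  qed
  then show ?thesis unfolding submean_at_def
    using r0(1) r1(1) assms(3) by (intro exI[of _ "min e (min r0 r1)"]) auto
qed

text \<open>
  A harmonic majorant on the boundary of a disc is one inside, even if nothing is known about
  the sub-mean value property at the centre: adding \<open>e ln |w - z|\<close> makes the function tend to
  minus infinity there, and \<open>e\<close> may tend to zero afterwards.
\<close>

lemma submean_disc_punctured:
  assumes cont: "continuous_on (cball z r) u" and r: "0 < r"
    and sub: "\<And>w. w \<in> ball z r - {z} \<Longrightarrow> submean_at u w"
    and p: "\<And>w. w \<in> sphere z r \<Longrightarrow> u w \<le> Re (poly p ((w - z) / of_real r))"
    and w: "w \<in> cball z r"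
  shows "u w \<le> Re (poly p ((w - z) / of_real r))"
proof -
  let ?v = "\<lambda>w. u w - Re (poly p ((w - z) / of_real r))"
  have cv: "continuous_on (cball z r) ?v"
    by (intro continuous_intros cont) (use r in auto)
  have "compact (?v ` cball z r)" by (rule compact_continuous_image[OF cv]) auto
  then obtain M where M: "\<And>w. w \<in> cball z r \<Longrightarrow> \<bar>?v w\<bar> \<le> M"
    using compact_imp_bounded bounded_iff by (metis (no_types, lifting) imageI real_norm_def)
  have key: "?v w + e * ln (norm (w - z) / r) \<le> 0" if w: "w \<in> cball z r" "w \<noteq> z" and e: "e > 0" for w e
  proof -
    \<comment> \<open>the radius of the hole: on its boundary \<open>e * ln (\<rho> / r) \<le> - M\<close>\<close>
    define \<rho> where "\<rho> = min (norm (w - z)) (r * exp (- M / e))"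
    have \<rho>: "\<rho> > 0" "\<rho> \<le> norm (w - z)" "\<rho> \<le> r * exp (- M / e)" "\<rho> \<le> r"
      using w r by (auto simp: \<rho>_def dist_norm norm_minus_commute)
    let ?K = "cball z r - ball z \<rho>"
    let ?f = "\<lambda>x. ?v x + (e * ln (norm (x - z)) + (- e * ln r))"
    have K: "compact ?K" by (simp add: compact_diff)
    have ne: "x \<noteq> z" if "x \<in> ?K" for x using that \<rho>(1) by auto
    have cl: "continuous_on X (\<lambda>x. e * ln (norm (x - z)))" if "z \<notin> X" for X
      using that by (auto intro!: continuous_intros)
    have cK: "continuous_on ?K ?f"
      by (intro continuous_on_add cl continuous_on_const continuous_on_subset[OF cv]) (use \<rho>(1) in auto)
    have intK: "interior ?K \<subseteq> ball z r - {z}"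
    proof -
      have "interior ?K \<subseteq> interior (cball z r)" by (rule interior_mono) auto
      then have "interior ?K \<subseteq> ball z r" by simp
      then show ?thesis using ne interior_subset by blast
    qed
    have subK: "submean_at ?f x" if x: "x \<in> interior ?K" for x
    proof -
      obtain d where d: "d > 0" "ball x d \<subseteq> ?K" using x mem_interior by blast
      have "z \<notin> ?K" using \<rho>(1) by simp
      then have bd: "ball x d \<subseteq> cball z r" "z \<notin> ball x d" using d(2) by blast+
      have cu: "continuous_on (ball x d) u" using cont bd(1) continuous_on_subset by blast
      have h: "(\<lambda>w. - poly p ((w - z) / of_real r) + of_real (- e * ln r)) holomorphic_on ball x d"
        by (intro holomorphic_intros) (use r in auto)
      have s1: "submean_at (\<lambda>w. u w + e * ln (norm (w - z))) x"
        by (rule submean_at_add[OF sub submean_at_ln_norm d(1) cu cl]) (use x intK bd in auto)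
      have "submean_at (\<lambda>w. (u w + e * ln (norm (w - z))) + Re (- poly p ((w - z) / of_real r) + of_real (- e * ln r))) x"
        by (rule submean_at_add_Re_holomorphic[OF s1 d(1) _ h]) (intro continuous_on_add cu cl bd)
      then show ?thesis by (rule submean_at_cong[OF _ d(1)]) simp
    qed
    have bdK: "?f x \<le> 0" if x: "x \<in> ?K - interior ?K" for x
    proof -
      have "open (ball z r - cball z \<rho>)" by (simp add: open_Diff)
      moreover have "ball z r - cball z \<rho> \<subseteq> ?K" by auto
      ultimately have "ball z r - cball z \<rho> \<subseteq> interior ?K" using interior_maximal by blast
      then have "x \<notin> ball z r - cball z \<rho>" "x \<in> cball z r" "x \<notin> ball z \<rho>" using x by auto
      then consider "x \<in> sphere z r" | "dist z x = \<rho>" by force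
      then show ?thesis
      proof cases
        case 1
        then show ?thesis using p[OF 1] by (simp add: dist_norm norm_minus_commute)
      next
        case 2
        have "?v x \<le> M" using M[of x] x by auto
        moreover have "ln \<rho> \<le> ln (r * exp (- M / e))" using \<rho> r by simp
        then have "ln \<rho> \<le> ln r - M / e" using r by (simp add: ln_mult)
        then have "e * ln \<rho> \<le> e * ln r - M" using e by (simp add: field_simps)
        ultimately show ?thesis using 2 by (simp add: dist_norm norm_minus_commute)
      qed
    qed
    have "?f w \<le> 0"
      by (rule submean_maximum_principle[OF K cK subK bdK]) (use w \<rho> in \<open>auto simp: dist_norm norm_minus_commute\<close>)
    then show ?thesis using w r by (simp add: ln_div algebra_simps)
  qed
  have neq: "?v w \<le> 0" if w: "w \<in> cball z r" "w \<noteq> z" for w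
  proof -
    let ?L = "ln (norm (w - z) / r)"
    have L: "?L \<le> 0" using w r by (simp add: dist_norm norm_minus_commute)
    show ?thesis
    proof (rule field_le_epsilon)
      fix e :: real assume e: "e > 0"
      \<comment> \<open>the weight is chosen so that the logarithmic term costs at most \<open>e\<close>\<close>
      have "?v w + e / (1 - ?L) * ?L \<le> 0" using key[OF w, of "e / (1 - ?L)"] e L by simp
      moreover have "- (e / (1 - ?L) * ?L) \<le> e" 
        using e L by (simp add: field_simps)
      ultimately show "?v w \<le> 0 + e" by linarith
    qed
  qed
  have "?v w \<le> 0"
  proof (cases "w = z")
    case True
    have "(?v \<longlongrightarrow> ?v z) (at z within cball z r)"
      using bspec[OF cv[unfolded continuous_on_def], of z] r by simp
    then have "(?v \<longlongrightarrow> ?v z) (at z)"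
      using at_within_interior[of z "cball z r"] r by simp
    moreover have "eventually (\<lambda>w. ?v w \<le> 0) (at z)"
      unfolding eventually_at by (rule exI[of _ r]) (use neq r in \<open>auto simp: dist_commute\<close>)
    ultimately show ?thesis using True tendsto_upperbound[of ?v "?v z" "at z" 0] by simp
  qed (use neq w in auto)
  then show ?thesis by simp
qed

text \<open>
  The passage from small circles to all circles. The centre may be left out, which makes
  isolated points removable below.
\<close>

lemma submean_disc:
  assumes cont: "continuous_on (cball z r) u" and r: "0 < r"
    and sub: "\<And>w. w \<in> ball z r - {z} \<Longrightarrow> submean_at u w"
  shows "u z \<le> circle_mean u z r"
proof (rule field_le_epsilon)
  fix e :: real assume e: "e > 0"
  have cs: "continuous_on (sphere z r) u" using cont by (rule continuous_on_subset) auto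
  obtain p where p: "\<forall>w\<in>sphere z r. \<bar>u w - Re (poly p ((w - z) / of_real r))\<bar> < e/2"
    using Re_poly_dense_on_circle[OF cs r half_gt_zero[OF e]] by blast
  let ?q = "p + [:of_real (e/2):]"
  have "u z \<le> Re (poly ?q ((z - z) / of_real r))"
  proof (rule submean_disc_punctured[OF cont r sub])
    fix w assume "w \<in> sphere z r"
    from bspec[OF p this] show "u w \<le> Re (poly ?q ((w - z) / of_real r))" unfolding poly_add by (simp add: field_simps abs_if split: if_splits)
  qed (use r in auto)
  also have "\<dots> = circle_mean (\<lambda>w. Re (poly ?q ((w - z) / of_real r))) z r"
    by (rule circle_mean_Re_holomorphic[symmetric]) (use r in \<open>auto intro!: holomorphic_intros\<close>)
  also have "\<dots> \<le> circle_mean (\<lambda>w. u w + e) z r"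
  proof (rule circle_mean_mono)
    fix w assume "w \<in> sphere z r"
    from bspec[OF p this] show "Re (poly ?q ((w - z) / of_real r)) \<le> u w + e"
      unfolding poly_add by (simp add: field_simps abs_if split: if_splits)
  qed (use r cs in \<open>auto intro!: continuous_intros\<close>)
  also have "\<dots> = circle_mean u z r + e"
    using circle_mean_add[OF cs, of "\<lambda>_. e"] r by auto
  finally show "u z \<le> circle_mean u z r + e" .
qed

lemma submean_at_removable:
  assumes "r > 0" "continuous_on (ball z r) u" "\<And>w. w \<in> ball z r - {z} \<Longrightarrow> submean_at u w"
  shows "submean_at u z"
  unfolding submean_at_def
proof (intro exI conjI allI impI)
  fix s assume s: "0 < s \<and> s < r"
  show "u z \<le> circle_mean u z s"
    by (rule submean_disc) (use s assms in \<open>auto intro: continuous_on_subset[OF assms(2)]\<close>)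
qed (fact assms(1))

lemma supported_at_compose:
  assumes "supported_at u (k z)" "k holomorphic_on S" "open S" "z \<in> S"
  shows "supported_at (\<lambda>w. u (k w)) z"
proof -
  obtain g d where g: "d > 0" "g holomorphic_on ball (k z) d" "Re (g (k z)) = u (k z)"
      "\<And>w. w \<in> ball (k z) d \<Longrightarrow> Re (g w) \<le> u w"
    using assms(1) by (auto simp: supported_at_def)
  have ck: "continuous_on S k" using assms(2) holomorphic_on_imp_continuous_on by blast
  have "open (S \<inter> k -` ball (k z) d)"
    using continuous_open_preimage[OF ck assms(3)] by blast
  then obtain e where e: "e > 0" "ball z e \<subseteq> S \<inter> k -` ball (k z) d"
    using assms(4) g(1) open_contains_ball by (metis IntI centre_in_ball vimageI)
  have "(g \<circ> k) holomorphic_on ball z e"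
    by (rule holomorphic_on_compose_gen[OF holomorphic_on_subset[OF assms(2)] g(2)]) (use e in auto)
  then show ?thesis unfolding supported_at_def
    using e g by (intro exI[of _ "g \<circ> k"] exI[of _ e]) auto
qed

text \<open>
  The zeros of a holomorphic \<open>k\<close> are isolated unless \<open>k\<close> vanishes identically, so a function
  supported away from the origin composes with holomorphic functions to a function with the
  sub-mean value property everywhere: the zeros are removable.
\<close>

lemma submean_at_compose_supported:
  assumes u: "continuous_on UNIV u" "\<And>w. w \<noteq> 0 \<Longrightarrow> supported_at u w"
    and k: "k holomorphic_on S" "g holomorphic_on S" "open S" "z \<in> S"
  shows "submean_at (\<lambda>w. u (k w) + Re (g w)) z"
proof -
  obtain e where e: "e > 0" "ball z e \<subseteq> S" using k open_contains_ball by blast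
  have hk: "k holomorphic_on ball z e" and hg: "g holomorphic_on ball z e"
    using k e holomorphic_on_subset by blast+
  have c: "continuous_on (ball z e) (\<lambda>w. u (k w))"
    by (rule continuous_on_compose2[OF u(1) holomorphic_on_imp_continuous_on[OF hk]]) auto
  have nz: "submean_at (\<lambda>w. u (k w)) w" if w: "w \<in> ball z e" "k w \<noteq> 0" for w
  proof -
    obtain d where d: "d > 0" "ball w d \<subseteq> ball z e" using w(1) open_contains_ball open_ball by blast
    show ?thesis
      by (rule supported_at_imp_submean_at[OF supported_at_compose[OF u(2) hk] d(1)])
         (use w continuous_on_subset[OF c d(2)] in auto)
  qed
  have "submean_at (\<lambda>w. u (k w)) z"
  proof (cases "\<forall>w\<in>ball z e. k w = 0")
    case True
    then show ?thesis
      by (intro submean_at_minimum[OF e(1) c]) (use e in auto)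
  next
    case False
    then obtain b where b: "b \<in> ball z e" "k b \<noteq> 0" by blast
    show ?thesis
    proof (cases "k z = 0")
      case True
      obtain r where r: "0 < r" "ball z r \<subseteq> ball z e" "\<And>w. w \<in> ball z r - {z} \<Longrightarrow> k w \<noteq> 0"
        using isolated_zeros[OF hk open_ball connected_ball _ True b] e(1) by auto
      show ?thesis
        by (rule submean_at_removable[OF r(1)]) (use r c nz in \<open>auto intro: continuous_on_subset\<close>)
    qed (use nz e in auto)
  qed
  from submean_at_add_Re_holomorphic[OF this e(1) c hg] show ?thesis .
qed

section \<open>An estimate of Milloux type for analytic discs\<close>

text \<open>
  The Harnack inequality for the negative harmonic function \<open>Re f\<close>: the Cayley transform
  centred at \<open>f 0\<close> reduces it to the Schwarz lemma.
\<close>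

lemma harnack_left_half_plane:
  assumes f: "f holomorphic_on ball 0 1" and neg: "\<And>z. z \<in> ball 0 1 \<Longrightarrow> Re (f z) < 0"
    and w: "norm w \<le> t" "t < 1"
  shows "Re (f w) * (1 + t) \<le> Re (f 0) * (1 - t)"
proof -
  define A where "A = - Re (f 0)"
  define F where "F = (\<lambda>z. f z - \<i> * of_real (Im (f 0)))"
  define g where "g = (\<lambda>z. (F z + of_real A) / (F z - of_real A))"
  have A: "A > 0" using neg[of 0] by (simp add: A_def)
  have ReF: "Re (F z) = Re (f z)" for z by (simp add: F_def)
  have lt: "norm (F z + of_real A) < norm (F z - of_real A)" if "z \<in> ball 0 1" for z
  proof -
    have "Re (F z) * A < 0" using neg[OF that] A by (simp add: ReF mult_neg_pos)
    then have "(norm (F z + of_real A))\<^sup>2 < (norm (F z - of_real A))\<^sup>2"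
      unfolding cmod_power2 by (simp add: power2_eq_square algebra_simps)
    then show ?thesis by (rule power_less_imp_less_base) simp
  qed
  have nz: "F z - of_real A \<noteq> 0" if "z \<in> ball 0 1" for z
    using lt[OF that] by auto
  have gh: "g holomorphic_on ball 0 1"
    unfolding g_def F_def by (intro holomorphic_intros f) (use nz in \<open>auto simp: F_def\<close>)
  have F0: "F 0 = - of_real A" by (simp add: F_def A_def complex_eq_iff)
  have w1: "w \<in> ball 0 1" using w by simp
  have "norm (g w) \<le> norm w"
  proof (rule Schwarz_Lemma(1)[OF gh])
    show "g 0 = 0" by (simp add: g_def F0)
    show "norm (g z) < 1" if "norm z < 1" for z
      using lt[of z] nz[of z] that by (simp add: g_def norm_divide)
    show "norm w < 1" using w by simp
  qed
  then have "norm (F w + of_real A) \<le> t * norm (F w - of_real A)"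
    using nz[OF w1] w by (simp add: g_def norm_divide field_simps)
      (meson mult_right_mono norm_ge_zero order_trans)
  then have "(norm (F w + of_real A))\<^sup>2 \<le> (t * norm (F w - of_real A))\<^sup>2"
    by (rule power_mono) simp
  then have le: "(Re (F w) + A)\<^sup>2 + (Im (F w))\<^sup>2 \<le> t\<^sup>2 * ((Re (F w) - A)\<^sup>2 + (Im (F w))\<^sup>2)"
    by (simp add: cmod_power2 power_mult_distrib)
  have t0: "0 \<le> t" using w norm_ge_zero order_trans by blast
  have "t\<^sup>2 * (Im (F w))\<^sup>2 \<le> (Im (F w))\<^sup>2"
    using w t0 by (intro mult_left_le_one_le) (auto simp: power_le_one)
  with le have "(Re (F w) + A)\<^sup>2 \<le> (t * (A - Re (F w)))\<^sup>2"
    unfolding power_mult_distrib distrib_left power2_commute[of A] by linarith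
  then have "\<bar>Re (F w) + A\<bar> \<le> \<bar>t * (A - Re (F w))\<bar>" by (simp add: abs_le_square_iff)
  also have "\<dots> = t * (A - Re (F w))" using t0 A neg[OF w1] by (simp add: ReF)
  finally have "Re (F w) + A \<le> t * (A - Re (F w))" by linarith
  then show ?thesis by (simp add: ReF A_def algebra_simps)
qed

text \<open>
  By the maximum modulus principle a region enclosed by a loop in \<open>S\<close> belongs to \<open>S\<close>. Working
  with a polydisc instead of a ball lets this be applied to each component of \<open>k\<close> separately.
\<close>

lemma sublevel_component_simply_connected:
  fixes k :: "complex \<Rightarrow> complex ^ 'n"
  assumes k: "\<And>i. (\<lambda>z. k z $ i) holomorphic_on D" and D: "open D" "convex D"
    and S: "S = {z\<in>D. \<forall>i. cmod (k z $ i - p $ i) < r}"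
  shows "open S" "simply_connected (connected_component_set S a)"
proof -
  have kc: "continuous_on D (\<lambda>z. k z $ i)" for i using k holomorphic_on_imp_continuous_on by blast
  have "S = (\<Inter>i. {z\<in>D. cmod (k z $ i - p $ i) < r})" using S by auto
  moreover have "open {z\<in>D. cmod (k z $ i - p $ i) < r}" for i
  proof -
    have "open (D \<inter> (\<lambda>z. cmod (k z $ i - p $ i)) -` {..<r})"
      by (rule continuous_open_preimage) (auto intro!: continuous_intros kc D)
    moreover have "D \<inter> (\<lambda>z. cmod (k z $ i - p $ i)) -` {..<r} = {z\<in>D. cmod (k z $ i - p $ i) < r}" by auto
    ultimately show ?thesis by simp
  qed
  ultimately show oS: "open S" by (simp add: open_INT)
  let ?O = "connected_component_set S a"
  have oO: "open ?O" using oS open_connected_component by blast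
  have SD: "S \<subseteq> D" using S by auto
  have OS: "?O \<subseteq> S" by (rule connected_component_subset)
  show "simply_connected ?O"
    unfolding simply_connected_eq_winding_number_zero[OF oO]
  proof (intro conjI allI impI connected_connected_component, elim conjE)
    fix g z assume g: "path g" "path_image g \<subseteq> ?O" "pathfinish g = pathstart g" and z: "z \<notin> ?O"
    show "winding_number g z = 0"
    proof (rule ccontr)
      assume wn: "winding_number g z \<noteq> 0"
      \<comment> \<open>the bounded region around \<open>z\<close> enclosed by the loop\<close>
      let ?C = "connected_component_set (- path_image g) z"
      have zp: "z \<notin> path_image g" using g z by blast
      have "z \<notin> outside (path_image g)" using winding_number_zero_in_outside[of g z] wn g by blast
      then have bC: "bounded ?C" using zp by (auto simp: outside_def)
      have zC: "z \<in> ?C" using zp by simp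
      have oC: "open ?C" by (intro open_connected_component open_Compl closed_path_image g)
      have "frontier ?C \<subseteq> frontier (- path_image g)" by (rule frontier_of_connected_component_subset)
      also have "\<dots> \<subseteq> path_image g"
        using closed_path_image[OF g(1)] by (simp add: frontier_subset_closed)
      finally have fC: "frontier ?C \<subseteq> path_image g" .
      have CD: "?C \<subseteq> D"
      proof
        fix w assume w: "w \<in> ?C"
        show "w \<in> D"
        proof (rule ccontr)
          assume "w \<notin> D"
          then have "w \<in> outside D" using D convex_in_outside by blast
          then have "w \<in> outside (path_image g)" using outside_mono[of "path_image g" D] g(2) OS SD by blast
          then have "\<not> bounded (connected_component_set (- path_image g) w)" by (simp add: outside_def)
          then show False using w bC connected_component_eq[OF w] by simp
        qed
      qed
      have clC: "closure ?C \<subseteq> ?C \<union> path_image g" using fC by (auto simp: frontier_def interior_open[OF oC])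
      have clD: "closure ?C \<subseteq> D" using clC CD g(2) OS SD by blast
      have "cmod (k w $ i - p $ i) < r" if w: "w \<in> ?C" for w i
      proof -
        let ?f = "\<lambda>z. k z $ i - p $ i"
        have "continuous_on (path_image g) (\<lambda>z. cmod (?f z))"
          by (intro continuous_on_norm continuous_on_diff continuous_on_const continuous_on_subset[OF kc])
             (use g(2) OS SD in blast)
        then obtain y where y: "y \<in> path_image g" "\<And>x. x \<in> path_image g \<Longrightarrow> cmod (?f x) \<le> cmod (?f y)"
          using continuous_attains_sup[OF compact_path_image[OF g(1)] path_image_nonempty] by blast
        have "cmod (?f w) \<le> cmod (?f y)"
        proof (rule maximum_modulus_frontier[OF _ _ bC _ w])
          show "?f holomorphic_on interior ?C"
            by (intro holomorphic_intros holomorphic_on_subset[OF k]) (use CD oC interior_open in auto)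
          show "continuous_on (closure ?C) ?f"
            by (intro continuous_intros continuous_on_subset[OF kc] clD)
        qed (use y fC in auto)
        also have "\<dots> < r"
        proof -
          have "y \<in> S" using y(1) g(2) OS by blast
          then show ?thesis using S by simp
        qed
        finally show ?thesis .
      qed
      then have "?C \<subseteq> S" unfolding S using CD by blast
      then have clS: "closure ?C \<subseteq> S" using clC g(2) OS by blast
      have "?C \<noteq> UNIV" using bC not_bounded_UNIV by metis
      moreover have "?C \<noteq> {}" using zC by blast
      ultimately have "frontier ?C \<noteq> {}" by (metis frontier_not_empty)
      then obtain y where y: "y \<in> frontier ?C" by blast
      have "y \<in> ?O" using y fC g(2) by blast
      moreover have "closure ?C \<subseteq> connected_component_set S y"
        by (rule connected_component_maximal) (use y clS in \<open>auto simp: frontier_def intro: connected_imp_connected_closure\<close>)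
      ultimately have "closure ?C \<subseteq> ?O" using connected_component_eq by blast
      then show False using zC z closure_subset by blast
    qed
  qed
qed

text \<open>
  If \<open>z0\<close> is not in the component \<open>Z\<close> of \<open>S\<close> around the origin, then \<open>z - z0\<close> has a holomorphic
  square root \<open>\<rho>\<close> on the simply connected \<open>Z\<close>, and \<open>\<rho> ` Z\<close> is disjoint from its negative.
  Transplanting \<open>u\<close> to \<open>\<rho> ` Z\<close> and extending it by its minimum \<open>- c\<close> gives a function \<open>s\<close> with
  the sub-mean value property and \<open>s \<sigma> + s (- \<sigma>) \<le> - c\<close>. So its mean around the origin is at
  most \<open>- c / 2\<close>, and since \<open>\<rho> 0\<close> is close to the origin, the Harnack inequality bounds
  \<open>s (\<rho> 0) = u 0\<close>. The composition with \<open>g\<close> in the assumption on \<open>u\<close> is needed because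
  \<open>u\<close> is transplanted.
\<close>

lemma milloux:
  fixes k :: "complex \<Rightarrow> complex ^ 'n" and c :: real
  assumes c: "c > 0"
    and cu: "continuous_on (ball 0 1) u"
    and lo: "\<And>z. z \<in> ball 0 1 \<Longrightarrow> - c \<le> u z" and up: "\<And>z. z \<in> ball 0 1 \<Longrightarrow> u z \<le> 0"
    and k: "\<And>i. (\<lambda>z. k z $ i) holomorphic_on ball 0 1"
    and off: "\<And>z. z \<in> ball 0 1 \<Longrightarrow> \<not> (\<forall>i. cmod (k z $ i - p $ i) < r) \<Longrightarrow> u z = - c"
    and sub: "\<And>g \<sigma> e. e > 0 \<Longrightarrow> g holomorphic_on ball \<sigma> e \<Longrightarrow> g ` ball \<sigma> e \<subseteq> ball 0 1 \<Longrightarrow>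
        u (g \<sigma>) > - c \<Longrightarrow> submean_at (\<lambda>w. u (g w)) \<sigma>"
    and z0: "norm z0 \<le> 1/100" "\<not> (\<forall>i. cmod (k z0 $ i - p $ i) < r)"
  shows "u 0 \<le> - c / 3"
proof -
  define S where "S = {z\<in>ball 0 1. \<forall>i. cmod (k z $ i - p $ i) < r}"
  define Z where "Z = connected_component_set S 0"
  note SC = sublevel_component_simply_connected[OF k open_ball convex_ball S_def]
  have oZ: "open Z" unfolding Z_def using SC(1) open_connected_component by blast
  have ZS: "Z \<subseteq> S" unfolding Z_def by (rule connected_component_subset)
  have S1: "S \<subseteq> ball 0 1" by (auto simp: S_def)
  have z0S: "z0 \<notin> S" using z0(2) by (auto simp: S_def)
  have offS: "u z = - c" if "z \<in> ball 0 1" "z \<notin> S" for z using off[OF that(1)] that by (auto simp: S_def)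
  show ?thesis
  proof (cases "0 \<in> S")
    case False
    then show ?thesis using offS[of 0] c by simp
  next
    case True
    then have Z0: "0 \<in> Z" by (simp add: Z_def)
    have scZ: "simply_connected Z" using SC(2) by (simp add: Z_def)
    have hid: "(\<lambda>z. z - z0) holomorphic_on Z" by (intro holomorphic_intros)
    have nzZ: "z - z0 \<noteq> 0" if "z \<in> Z" for z using that z0S ZS by auto
    obtain \<rho> where \<rho>: "\<rho> holomorphic_on Z" "\<And>z. z \<in> Z \<Longrightarrow> z - z0 = (\<rho> z)\<^sup>2"
      using simply_connected_imp_holomorphic_sqrt[OF hid scZ open_imp_locally_path_connected[OF oZ] nzZ] by blast
    \<comment> \<open>\<open>q\<close> inverts \<open>\<rho>\<close>; on \<open>D\<close> its values stay in the unit disc, as \<open>0.95\<^sup>2 + 0.01 < 1\<close>\<close>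
    define q where "q = (\<lambda>\<sigma>::complex. \<sigma>\<^sup>2 + z0)"
    define W where "W = \<rho> ` Z"
    define D where "D = ball (0::complex) (95/100)"
    have q\<rho>: "q (\<rho> z) = z" if "z \<in> Z" for z using \<rho>(2)[OF that] by (simp add: q_def algebra_simps)
    have inj: "inj_on \<rho> Z" by (metis inj_onI q\<rho>)
    have oW: "open W" unfolding W_def by (rule open_mapping_thm3[OF \<rho>(1) oZ inj])
    have qW: "q \<sigma> \<in> Z" "\<rho> (q \<sigma>) = \<sigma>" if "\<sigma> \<in> W" for \<sigma> using that q\<rho> by (auto simp: W_def)
    have neg: "- \<sigma> \<notin> W" if "\<sigma> \<in> W" for \<sigma>
    proof
      assume m: "- \<sigma> \<in> W"
      have "q (- \<sigma>) = q \<sigma>" by (simp add: q_def)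
      then have "- \<sigma> = \<sigma>" using qW(2)[OF that] qW(2)[OF m] by simp
      then have "q \<sigma> = z0" by (simp add: q_def)
      then show False using qW(1)[OF that] ZS z0S by auto
    qed
    have qD: "q \<sigma> \<in> ball 0 1" if "\<sigma> \<in> D" for \<sigma>
    proof -
      have "(norm \<sigma>)\<^sup>2 \<le> (95/100)\<^sup>2" using that by (intro power_mono) (auto simp: D_def)
      moreover have "norm (q \<sigma>) \<le> (norm \<sigma>)\<^sup>2 + norm z0"
        unfolding q_def by (metis norm_triangle_ineq norm_power)
      ultimately show ?thesis using z0(1) by (simp add: power2_eq_square)
    qed
    have qc: "continuous_on X q" for X unfolding q_def by (intro continuous_intros)
    have qh: "q holomorphic_on X" for X unfolding q_def by (intro holomorphic_intros)
    \<comment> \<open>so \<open>u \<circ> q\<close> has its minimal value on the boundary of \<open>W\<close>, and the extension is continuous\<close>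
    have bdry: "q \<sigma> \<notin> S" if \<sigma>: "\<sigma> \<in> closure W" "\<sigma> \<notin> W" for \<sigma>
    proof
      assume "q \<sigma> \<in> S"
      then obtain e where e: "e > 0" "ball (q \<sigma>) e \<subseteq> S" using SC(1) open_contains_ball by blast
      obtain s where s: "\<And>n. s n \<in> W" "s \<longlonglongrightarrow> \<sigma>" using \<sigma>(1) closure_sequential by blast
      have "(\<lambda>n. q (s n)) \<longlonglongrightarrow> q \<sigma>" unfolding q_def by (intro tendsto_intros s)
      then have qs: "(\<lambda>n. q (s n)) \<longlonglongrightarrow> q \<sigma>" .
      then obtain n where n: "q (s n) \<in> ball (q \<sigma>) e"
        using e(1) by (metis LIMSEQ_iff dist_commute dist_norm mem_ball order_refl)
      have "ball (q \<sigma>) e \<subseteq> connected_component_set S (q (s n))"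
        by (rule connected_component_maximal[OF n _ e(2)]) simp
      moreover have "q (s n) \<in> Z" using qW s by blast
      ultimately have "ball (q \<sigma>) e \<subseteq> Z" unfolding Z_def using connected_component_eq by blast
      then have qZ: "q \<sigma> \<in> Z" using e(1) by auto
      have "isCont \<rho> (q \<sigma>)"
        using holomorphic_on_imp_continuous_on[OF \<rho>(1)] continuous_on_eq_continuous_at[OF oZ] qZ by blast
      then have "(\<lambda>n. \<rho> (q (s n))) \<longlonglongrightarrow> \<rho> (q \<sigma>)" using isCont_tendsto_compose qs by blast
      then have "s \<longlonglongrightarrow> \<rho> (q \<sigma>)" using qW(2) s(1) by simp
      then have "\<sigma> = \<rho> (q \<sigma>)" using s(2) LIMSEQ_unique by blast
      then show False using \<sigma>(2) qZ by (auto simp: W_def)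
    qed
    define s where "s = (\<lambda>\<sigma>. if \<sigma> \<in> W then u (q \<sigma>) else - c)"
    have cuq: "continuous_on D (\<lambda>\<sigma>. u (q \<sigma>))"
      by (rule continuous_on_compose2[OF cu qc]) (use qD in auto)
    have Dsplit: "(D \<inter> closure W) \<union> (D - W) = D" using closure_subset by blast
    have cs: "continuous_on D s"
    proof -
      have cl1: "closedin (top_of_set D) (D \<inter> closure W)" "closedin (top_of_set D) (D - W)"
        using oW by (auto intro: closedin_closed_Int simp: Diff_eq)
      have "continuous_on ((D \<inter> closure W) \<union> (D - W)) (\<lambda>\<sigma>. if \<sigma> \<in> W then u (q \<sigma>) else - c)"
      proof (rule continuous_on_cases_local)
        show "continuous_on (D \<inter> closure W) (\<lambda>\<sigma>. u (q \<sigma>))" using cuq by (rule continuous_on_subset) auto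
        fix x assume "x \<in> D \<inter> closure W \<and> x \<notin> W \<or> x \<in> D - W \<and> x \<in> W"
        then show "u (q x) = - c" using offS[OF qD bdry] by blast
      qed (use cl1 Dsplit in auto)
      then show ?thesis by (simp add: Dsplit s_def)
    qed
    have qW1: "q \<sigma> \<in> ball 0 1" if "\<sigma> \<in> W" for \<sigma> using qW(1)[OF that] ZS S1 by blast
    have s_lo: "- c \<le> s \<sigma>" for \<sigma> using lo[OF qW1] c by (simp add: s_def)
    have s_up: "s \<sigma> \<le> 0" for \<sigma> using up[OF qW1] c by (simp add: s_def)
    have pair: "s \<sigma> + s (- \<sigma>) \<le> - c" for \<sigma>
      using neg[of \<sigma>] s_up[of \<sigma>] s_up[of "- \<sigma>"] by (cases "\<sigma> \<in> W") (auto simp: s_def)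
    have subs: "submean_at s \<sigma>" if \<sigma>: "\<sigma> \<in> D" for \<sigma>
    proof (cases "s \<sigma> > - c")
      case True
      then have \<sigma>W: "\<sigma> \<in> W" by (auto simp: s_def split: if_splits)
      have "open (W \<inter> D)" using oW by (auto simp: D_def)
      then obtain e where e: "e > 0" "ball \<sigma> e \<subseteq> W \<inter> D" using \<sigma> \<sigma>W open_contains_ball by blast
      have "submean_at (\<lambda>w. u (q w)) \<sigma>"
        by (rule sub[OF e(1) qh]) (use e qD True \<sigma>W in \<open>auto simp: s_def\<close>)
      then show ?thesis
        by (rule submean_at_cong[OF _ e(1)]) (use e(2) in \<open>auto simp: s_def\<close>)
    next
      case False
      obtain e where e: "e > 0" "ball \<sigma> e \<subseteq> D" using \<sigma> open_contains_ball[of D] open_ball unfolding D_def by blast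
      have "s \<sigma> \<le> s w" for w using False s_lo[of w] by linarith
      then show ?thesis
        by (rule submean_at_minimum[OF e(1) continuous_on_subset[OF cs e(2)]])
    qed
    let ?R = "9/10 :: real"
    have RD: "cball 0 ?R \<subseteq> D" by (auto simp: D_def)
    have csR: "continuous_on (cball 0 ?R) s" using cs RD continuous_on_subset by blast
    have css: "continuous_on (sphere 0 ?R) s" using csR by (rule continuous_on_subset) auto
    have mean: "circle_mean s 0 ?R \<le> - c / 2"
    proof -
      let ?h = "\<lambda>t. s (0 + of_real ?R * cis t)"
      have ch: "continuous_on A ?h" for A by (rule continuous_on_circle[OF css]) auto
      have ch2: "continuous_on A (\<lambda>t. ?h (t + pi))" for A
        by (rule continuous_on_compose2[OF ch[of UNIV]]) (auto intro!: continuous_intros)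
      have ii: "?h integrable_on {a..b}" for a b by (rule integrable_continuous_interval[OF ch])
      have "integral {0..2*pi} ?h = integral {0..pi} ?h + integral {pi..2*pi} ?h"
        by (rule Henstock_Kurzweil_Integration.integral_combine[symmetric]) (use ii in auto)
      also have "integral {pi..2*pi} ?h = integral {0..pi} (\<lambda>t. ?h (t + pi))"
        using integral_shift[of 0 pi pi ?h, OF ch] by (simp add: o_def)
      also have "integral {0..pi} ?h + integral {0..pi} (\<lambda>t. ?h (t + pi))
          = integral {0..pi} (\<lambda>t. ?h t + ?h (t + pi))"
        by (rule integral_add[symmetric]; rule integrable_continuous_interval; rule ch ch2)
      also have "\<dots> \<le> integral {0..pi} (\<lambda>t. - c)"
      proof (rule integral_le)
        show "(\<lambda>t. ?h t + ?h (t + pi)) integrable_on {0..pi}"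
          by (rule integrable_continuous_interval; rule continuous_on_add; rule ch ch2)
        show "?h t + ?h (t + pi) \<le> - c" for t
          using pair[of "of_real ?R * cis t"] by (simp add: cis_mult[symmetric])
      qed auto
      finally have "integral {0..2*pi} ?h \<le> - c * pi" by (simp add: mult.commute)
      then show ?thesis by (simp add: circle_mean_def field_simps)
    qed
    \<comment> \<open>the error in approximating the boundary values; \<open>4/5 * (1/2 + 1/100) - 3/100 \<ge> 1/3\<close>\<close>
    define e where "e = c / 100"
    have e: "e > 0" using c by (simp add: e_def)
    obtain p where p: "\<forall>w\<in>sphere 0 ?R. \<bar>s w - Re (poly p ((w - 0) / of_real ?R))\<bar> < e"
      using Re_poly_dense_on_circle[OF css _ e] by auto
    have p1: "Re (poly p w) < s (of_real ?R * w) + e" "s (of_real ?R * w) < Re (poly p w) + e" if "norm w = 1" for w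
      using bspec[OF p, of "of_real ?R * w"] that by (auto simp: abs_if norm_mult split: if_splits)
    let ?f = "\<lambda>w. poly p w - of_real (2 * e)"
    have fneg: "Re (?f w) < 0" if "w \<in> ball 0 1" for w
    proof -
      have "Re (?f w) \<le> - e"
      proof (rule maximum_real_frontier[of ?f "cball 0 1"])
        fix z :: complex assume "z \<in> frontier (cball 0 1)"
        then have "norm z = 1" by simp
        from p1(1)[OF this] s_up[of "of_real ?R * z"] show "Re (?f z) \<le> - e" by simp
      qed (use that in \<open>auto intro!: holomorphic_intros continuous_intros\<close>)
      then show ?thesis using e by linarith
    qed
    have Re0: "Re (?f 0) \<le> - c / 2 - e"
    proof -
      have "Re (poly p 0) = circle_mean (\<lambda>w. Re (poly p (w / of_real ?R))) 0 ?R"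
        by (subst circle_mean_Re_holomorphic) (auto intro!: holomorphic_intros)
      also have "\<dots> \<le> circle_mean (\<lambda>w. s w + e) 0 ?R"
      proof (rule circle_mean_mono)
        fix w :: complex assume "w \<in> sphere 0 ?R"
        then show "Re (poly p (w / of_real ?R)) \<le> s w + e"
          using p1(1)[of "w / of_real ?R"] by (simp add: norm_divide)
      qed (auto intro!: continuous_intros css)
      also have "\<dots> = circle_mean s 0 ?R + e"
        using circle_mean_add[OF css, of "\<lambda>_. e"] by simp
      finally show ?thesis using mean by simp
    qed
    define \<sigma>0 where "\<sigma>0 = \<rho> 0"
    have \<sigma>0W: "\<sigma>0 \<in> W" using Z0 by (auto simp: \<sigma>0_def W_def)
    have "(norm \<sigma>0)\<^sup>2 = norm z0" using \<rho>(2)[OF Z0] by (metis \<sigma>0_def norm_minus_cancel norm_power diff_0)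
    also have "\<dots> \<le> (1/10)\<^sup>2" using z0(1) by (simp add: power2_eq_square)
    finally have n0: "norm \<sigma>0 \<le> 1/10" by (rule power2_le_imp_le) simp
    let ?w = "\<sigma>0 / of_real ?R"
    have w: "norm ?w \<le> 1/9" using n0 by (simp add: norm_divide)
    have "Re (?f ?w) * (1 + 1/9) \<le> Re (?f 0) * (1 - 1/9)"
      by (rule harnack_left_half_plane[OF _ fneg w]) (auto intro!: holomorphic_intros)
    then have "Re (?f ?w) \<le> 4/5 * Re (?f 0)" by simp
    also have "\<dots> \<le> 4/5 * (- c / 2 - e)" using Re0 by (intro mult_left_mono) auto
    finally have fw: "Re (?f ?w) \<le> 4/5 * (- c / 2 - e)" .
    have "s \<sigma>0 \<le> Re (poly (p + [:of_real e:]) ((\<sigma>0 - 0) / of_real ?R))"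
    proof (rule submean_disc_punctured[OF csR])
      show "submean_at s w" if "w \<in> ball 0 ?R - {0}" for w
        by (rule subs) (use that in \<open>simp add: D_def\<close>)
      show "s w \<le> Re (poly (p + [:of_real e:]) ((w - 0) / of_real ?R))" if "w \<in> sphere 0 ?R" for w
        using bspec[OF p that] by (simp add: abs_if split: if_splits)
    qed (use n0 in auto)
    then have "s \<sigma>0 \<le> Re (?f ?w) + 3 * e" by simp
    moreover have "s \<sigma>0 = u 0" using \<sigma>0W q\<rho>[OF Z0] by (simp add: s_def \<sigma>0_def)
    ultimately show ?thesis using fw c by (simp add: e_def)
  qed
qed

section \<open>Lowering a homogeneous subharmonic polynomial\<close>

lemma eval_zzbar_homogeneous:
  fixes P :: "complex poly poly"
  assumes "homogeneous_zzbar d P"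
  defines "b \<equiv> \<lambda>k. coeff (coeff P k) (d - k)"
  shows "eval_zzbar P z = (\<Sum>k\<le>d. b k * z ^ (d - k) * cnj z ^ k)"
    and "\<exists>k\<le>d. b k \<noteq> 0"
proof -
  have hom: "coeff (coeff P k) j \<noteq> 0 \<Longrightarrow> j + k = d" for j k
    using assms(1) by (auto simp: homogeneous_zzbar_def)
  have mon: "coeff P k = (if k \<le> d then monom (b k) (d - k) else 0)" for k
  proof (rule poly_eqI)
    fix j
    show "coeff (coeff P k) j = coeff (if k \<le> d then monom (b k) (d - k) else 0) j"
      using hom[of k j] by (cases "coeff (coeff P k) j = 0") (auto simp: b_def)
  qed
  have "degree P \<le> d" by (rule degree_le) (simp add: mon)
  then have "poly P x = (\<Sum>k\<le>d. coeff P k * x ^ k)" for x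
    unfolding poly_altdef by (intro sum.mono_neutral_left) (auto simp: coeff_eq_0)
  then show "eval_zzbar P z = (\<Sum>k\<le>d. b k * z ^ (d - k) * cnj z ^ k)"
    by (simp add: eval_zzbar_def poly_sum mon poly_monom)
  have "P \<noteq> 0" using assms(1) by (simp add: homogeneous_zzbar_def)
  then obtain k where "coeff P k \<noteq> 0" using poly_eqI[of P 0] by auto
  then show "\<exists>k\<le>d. b k \<noteq> 0" by (auto simp: mon split: if_splits)
qed

text \<open>
  A homogeneous function of degree \<open>N\<close> with angular part \<open>f\<close> satisfies
  \<open>r\<^sup>2 \<Delta> = r\<^bsup>N\<^esup> (f'' + N\<^sup>2 f)\<close>, and the angular parts of the harmonic functions \<open>Re (c z\<^bsup>N\<^esup>)\<close>
  are the sinusoids of frequency \<open>N\<close>. This is the sinusoid with the value and the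
  derivative of \<open>f\<close> at \<open>w\<close>.
\<close>

definition tangent_sinusoid :: "real \<Rightarrow> (real \<Rightarrow> real) \<Rightarrow> (real \<Rightarrow> real) \<Rightarrow> real \<Rightarrow> real \<Rightarrow> real" where
  "tangent_sinusoid N f f1 w \<theta> = f w * cos (N * (\<theta> - w)) + f1 w / N * sin (N * (\<theta> - w))"

text \<open>
  The function \<open>E\<close> in the proof is a Wronskian of \<open>f\<close> with \<open>sin (N * (\<theta> - t))\<close>: its derivative
  contains \<open>f\<close> only through \<open>f2 + N\<^sup>2 f\<close>, and its values at \<open>w\<close> and \<open>\<theta>\<close> are \<open>N\<close> times the two
  sides of the claim.
\<close>

lemma tangent_sinusoid_less_right:
  assumes N: "N > 0" and d: "\<And>t. (f has_real_derivative f1 t) (at t)" "\<And>t. (f1 has_real_derivative f2 t) (at t)"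
    and w: "w < \<theta>" "\<theta> - w < pi / N"
    and pos: "\<And>t. w \<le> t \<Longrightarrow> t \<le> \<theta> \<Longrightarrow> f2 t + N\<^sup>2 * f t \<ge> 0"
    and t0: "w < t0" "t0 < \<theta>" "f2 t0 + N\<^sup>2 * f t0 \<noteq> 0"
  shows "tangent_sinusoid N f f1 w \<theta> < f \<theta>"
proof -
  define E where "E = (\<lambda>t. N * f t * cos (N * (\<theta> - t)) + f1 t * sin (N * (\<theta> - t)))"
  have dE: "(E has_real_derivative sin (N * (\<theta> - t)) * (f2 t + N\<^sup>2 * f t)) (at t)" for t
    unfolding E_def
    by (rule derivative_eq_intros d refl | simp)+ (simp add: algebra_simps power2_eq_square)
  have sin_pos: "sin (N * (\<theta> - t)) \<ge> 0" "t < \<theta> \<Longrightarrow> sin (N * (\<theta> - t)) > 0" if "w \<le> t" "t \<le> \<theta>" for t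
  proof -
    have "N * (\<theta> - t) \<le> N * (\<theta> - w)" using that N by (intro mult_left_mono) auto
    also have "\<dots> < pi" using w N by (simp add: field_simps)
    finally have "N * (\<theta> - t) < pi" .
    then show "sin (N * (\<theta> - t)) \<ge> 0" "t < \<theta> \<Longrightarrow> sin (N * (\<theta> - t)) > 0"
      using that N by (auto intro!: sin_ge_zero sin_gt_zero)
  qed
  have mono: "E x \<le> E y" if "w \<le> x" "x \<le> y" "y \<le> \<theta>" for x y
  proof (rule DERIV_nonneg_imp_nondecreasing[OF that(2)])
    fix t assume "x \<le> t" "t \<le> y"
    then have "0 \<le> sin (N * (\<theta> - t)) * (f2 t + N\<^sup>2 * f t)"
      using that sin_pos(1)[of t] pos[of t] by simp
    then show "\<exists>d. (E has_real_derivative d) (at t) \<and> 0 \<le> d" using dE by blast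
  qed
  have "E w < E \<theta>"
  proof (rule ccontr)
    assume "\<not> E w < E \<theta>"
    then have const: "E t = E w" if "w \<le> t" "t \<le> \<theta>" for t
      using mono[of w t] mono[of t \<theta>] that by linarith
    have "sin (N * (\<theta> - t0)) * (f2 t0 + N\<^sup>2 * f t0) = 0"
    proof (rule DERIV_local_const[OF dE, of "min (t0 - w) (\<theta> - t0)"])
      show "\<forall>y. \<bar>t0 - y\<bar> < min (t0 - w) (\<theta> - t0) \<longrightarrow> E t0 = E y"
      proof (intro allI impI)
        fix y assume "\<bar>t0 - y\<bar> < min (t0 - w) (\<theta> - t0)"
        then have "w \<le> y" "y \<le> \<theta>" by linarith+
        then show "E t0 = E y" using const[of y] const[of t0] t0 by simp
      qed
    qed (use t0 in auto)
    then show False using sin_pos(2)[of t0] t0 by auto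
  qed
  then show ?thesis using N by (simp add: E_def tangent_sinusoid_def field_simps)
qed

lemma tangent_sinusoid_less_left:
  assumes N: "N > 0" and d: "\<And>t. (f has_real_derivative f1 t) (at t)" "\<And>t. (f1 has_real_derivative f2 t) (at t)"
    and w: "\<theta> < w" "w - \<theta> < pi / N"
    and pos: "\<And>t. \<theta> \<le> t \<Longrightarrow> t \<le> w \<Longrightarrow> f2 t + N\<^sup>2 * f t \<ge> 0"
    and t0: "\<theta> < t0" "t0 < w" "f2 t0 + N\<^sup>2 * f t0 \<noteq> 0"
  shows "tangent_sinusoid N f f1 w \<theta> < f \<theta>"
proof -
  have u: "((\<lambda>x. - x) has_real_derivative -1) (at t)" for t :: real
    by (auto intro!: derivative_eq_intros)
  have d1: "((\<lambda>t. f (- t)) has_real_derivative - f1 (- t)) (at t)" for t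
    using DERIV_chain2[OF d(1) u] by simp
  have d2: "((\<lambda>t. - f1 (- t)) has_real_derivative f2 (- t)) (at t)" for t
    using DERIV_minus[OF DERIV_chain2[OF d(2) u]] by simp
  have "tangent_sinusoid N (\<lambda>t. f (- t)) (\<lambda>t. - f1 (- t)) (- w) (- \<theta>) < f (- (- \<theta>))"
    by (rule tangent_sinusoid_less_right[OF N d1 d2, of _ _ "- t0"]) (use w pos t0 in auto)
  moreover have "N * (w - \<theta>) = - (N * (\<theta> - w))" by (simp add: algebra_simps)
  then have "sin (N * (w - \<theta>)) = - sin (N * (\<theta> - w))" "cos (N * (w - \<theta>)) = cos (N * (\<theta> - w))"
    by (metis sin_minus, metis cos_minus)
  ultimately show ?thesis by (simp add: tangent_sinusoid_def)
qed

lemma polar_near: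
  assumes "z0 \<noteq> 0" "z0 = of_real (norm z0) * cis \<theta>" "\<eta> > 0"
  shows "\<exists>e>0. \<forall>z\<in>ball z0 e. \<exists>\<phi>. \<bar>\<phi>\<bar> < \<eta> \<and> z = of_real (norm z) * cis (\<theta> + \<phi>)"
proof -
  have "isCont (\<lambda>z. Arg (z / z0)) z0"
    by (rule isCont_o2[OF _ continuous_at_Arg]) (use assms in \<open>auto intro!: continuous_intros\<close>)
  then obtain e where e: "e > 0" "\<And>z. dist z z0 < e \<Longrightarrow> dist (Arg (z / z0)) (Arg (z0 / z0)) < \<eta>"
    unfolding continuous_at_eps_delta using assms(3) by blast
  show ?thesis
  proof (intro exI conjI ballI)
    fix z assume "z \<in> ball z0 e"
    then have "\<bar>Arg (z / z0)\<bar> < \<eta>" using e(2)[of z] assms(1) by (simp add: dist_commute dist_real_def)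
    moreover have "z / z0 = of_real (norm (z / z0)) * cis (Arg (z / z0))"
      by (metis rcis_cmod_Arg rcis_def)
    then have "z / z0 * z0 = (of_real (norm (z / z0)) * cis (Arg (z / z0))) * (of_real (norm z0) * cis \<theta>)"
      using assms(2) by metis
    then have "z = of_real (norm z) * cis (\<theta> + Arg (z / z0))"
      using assms(1) by (simp add: norm_divide cis_mult[symmetric] mult_ac)
    ultimately show "\<bar>Arg (z / z0)\<bar> < \<eta>" "z = of_real (norm z) * cis (\<theta> + Arg (z / z0))" by auto
  qed (fact e(1))
qed

lemma Re_power_sinusoid:
  "Re (Complex \<alpha> (- \<beta>) * cis (- (real n * w)) * (of_real r * cis \<theta>) ^ n)
    = r ^ n * (\<alpha> * cos (real n * (\<theta> - w)) + \<beta> * sin (real n * (\<theta> - w)))"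
proof -
  have "Complex \<alpha> (- \<beta>) * cis (- (real n * w)) * (of_real r * cis \<theta>) ^ n
      = of_real (r ^ n) * (Complex \<alpha> (- \<beta>) * (cis (- (real n * w)) * cis (real n * \<theta>)))"
    by (simp add: power_mult_distrib Complex.DeMoivre)
  also have "cis (- (real n * w)) * cis (real n * \<theta>) = cis (real n * (\<theta> - w))"
    by (simp add: cis_mult algebra_simps)
  finally have eq: "Complex \<alpha> (- \<beta>) * cis (- (real n * w)) * (of_real r * cis \<theta>) ^ n
      = of_real (r ^ n) * (Complex \<alpha> (- \<beta>) * cis (real n * (\<theta> - w)))" .
  have "Re (of_real s * x) = s * Re x" for s x by simp
  then show ?thesis unfolding eq by simp
qed

text \<open>
  Here \<open>f1\<close> and \<open>f2\<close> are the derivatives of the trigonometric polynomial \<open>f\<close>. The frequency of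
  \<open>z\<^bsup>2m-k\<^esup> cnj z\<^sup>k\<close> is \<open>2m - 2k\<close>, and the operator in the last line multiplies its coefficient by
  \<open>4k (2m - k)\<close>; without harmonic terms none of these factors is zero. A nonzero trigonometric
  polynomial vanishes at finitely many angles only.
\<close>

lemma polynomial_angular_part:
  fixes P :: "complex poly poly" and H :: "complex \<Rightarrow> real"
  assumes m: "m \<ge> 1" and HP: "\<And>z. complex_of_real (H z) = eval_zzbar P z"
    and hom: "homogeneous_zzbar (2 * m) P" and nh: "no_harmonic_terms P"
  obtains f f1 f2 H1 where
    "\<And>r \<theta>. H (of_real r * cis \<theta>) = r ^ (2 * m) * f \<theta>"
    "\<And>r \<theta>. H1 (of_real r * cis \<theta>) = r ^ (2 * m) * f1 \<theta>"
    "continuous_on UNIV H1" "continuous_on UNIV f2"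
    "\<And>t. (f has_real_derivative f1 t) (at t)" "\<And>t. (f1 has_real_derivative f2 t) (at t)"
    "\<And>a b. a < b \<Longrightarrow> \<exists>t. a < t \<and> t < b \<and> f2 t + (real (2 * m))\<^sup>2 * f t \<noteq> 0"
proof -
  define b where "b = (\<lambda>k. coeff (coeff P k) (2 * m - k))"
  define n where "n = (\<lambda>k. 2 * real m - 2 * real k)"
  define T where "T = (\<lambda>a \<theta>. \<Sum>k\<le>2*m. a k * cis (n k * \<theta>))"
  define D where "D = (\<lambda>a k. \<i> * of_real (n k) * a k)"
  note ev = eval_zzbar_homogeneous[OF hom, folded b_def]
  have b0: "b 0 = 0" "b (2 * m) = 0" using nh by (auto simp: no_harmonic_terms_def b_def)
  have zz: "(of_real r * cis \<theta>) ^ (2 * m - k) * cnj (of_real r * cis \<theta>) ^ k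
      = of_real (r ^ (2 * m)) * cis (n k * \<theta>)" if "k \<le> 2 * m" for k r \<theta>
  proof -
    have "(of_real r * cis \<theta>) ^ (2 * m - k) * cnj (of_real r * cis \<theta>) ^ k
      = of_real (r ^ (2 * m - k + k)) * (cis (real (2 * m - k) * \<theta>) * cis (real k * (- \<theta>)))"
      by (simp add: power_mult_distrib Complex.DeMoivre cis_cnj power_add)
    also have "cis (real (2 * m - k) * \<theta>) * cis (real k * (- \<theta>)) = cis (n k * \<theta>)"
      using that by (simp add: cis_mult n_def of_nat_diff algebra_simps)
    finally show ?thesis using that by simp
  qed
  have poly_T: "(\<Sum>k\<le>2*m. a k * (of_real r * cis \<theta>) ^ (2 * m - k) * cnj (of_real r * cis \<theta>) ^ k)
      = of_real (r ^ (2 * m)) * T a \<theta>" for a r \<theta>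
    unfolding T_def sum_distrib_left
    by (rule sum.cong) (use zz in \<open>auto simp: mult.assoc mult.left_commute\<close>)
  have dT: "(T a has_vector_derivative T (D a) \<theta>) (at \<theta>)" for a \<theta>
  proof -
    have "((\<lambda>\<theta>. a k * cis (n k * \<theta>)) has_vector_derivative (D a k * cis (n k * \<theta>))) (at \<theta>)" for k
    proof -
      have "((\<lambda>z. a k * exp (\<i> * of_real (n k) * z)) has_field_derivative
          D a k * exp (\<i> * of_real (n k) * of_real \<theta>)) (at (of_real \<theta>))"
        by (rule derivative_eq_intros refl | simp)+ (simp add: D_def)
      from has_vector_derivative_real_field[OF this] show ?thesis
        by (simp add: cis_conv_exp mult.assoc)
    qed
    then show ?thesis unfolding T_def by (intro has_vector_derivative_sum) auto
  qed
  have dRe: "((\<lambda>\<theta>. Re (T a \<theta>)) has_real_derivative Re (T (D a) \<theta>)) (at \<theta>)"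
    and dIm: "((\<lambda>\<theta>. Im (T a \<theta>)) has_real_derivative Im (T (D a) \<theta>)) (at \<theta>)" for a \<theta>
    using bounded_linear.has_vector_derivative[OF bounded_linear_Re dT]
      bounded_linear.has_vector_derivative[OF bounded_linear_Im dT]
    by (auto simp: has_real_derivative_iff_has_vector_derivative)
  have HT: "complex_of_real (H (of_real r * cis \<theta>)) = of_real (r ^ (2 * m)) * T b \<theta>" for r \<theta>
    using poly_T[of b r \<theta>] unfolding HP ev(1) b_def .
  have Re_mult_left: "Re (of_real s * x) = s * Re x" for s x by simp
  have real0: "Im (T b \<theta>) = 0" for \<theta>
    using HT[of 1 \<theta>] by (metis Im_complex_of_real mult_1 of_real_1 power_one)
  have realD: "Im (T (D a) \<theta>) = 0" if "\<And>t. Im (T a t) = 0" for a \<theta>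
    using dIm[of a \<theta>] that DERIV_unique[OF _ DERIV_const[of 0]] by simp
  show thesis
  proof
    show "H (of_real r * cis \<theta>) = r ^ (2 * m) * Re (T b \<theta>)" for r \<theta>
      using arg_cong[OF HT[of r \<theta>], of Re] by (simp only: Re_mult_left Re_complex_of_real)
    show "Re (\<Sum>k\<le>2*m. D b k * (of_real r * cis \<theta>) ^ (2 * m - k) * cnj (of_real r * cis \<theta>) ^ k)
        = r ^ (2 * m) * Re (T (D b) \<theta>)" for r \<theta>
      unfolding poly_T by simp
    show "continuous_on UNIV (\<lambda>z. Re (\<Sum>k\<le>2*m. D b k * z ^ (2 * m - k) * cnj z ^ k))"
      by (intro continuous_intros)
    show "continuous_on UNIV (\<lambda>t. Re (T (D (D b)) t))"
      using dRe by (intro DERIV_continuous_on) (auto intro: has_field_derivative_at_within)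
    show "((\<lambda>\<theta>. Re (T b \<theta>)) has_real_derivative Re (T (D b) t)) (at t)" for t by (rule dRe)
    show "((\<lambda>\<theta>. Re (T (D b) \<theta>)) has_real_derivative Re (T (D (D b)) t)) (at t)" for t by (rule dRe)
    fix x y :: real assume xy: "x < y"
    show "\<exists>t. x < t \<and> t < y \<and> Re (T (D (D b)) t) + (real (2 * m))\<^sup>2 * Re (T b t) \<noteq> 0"
    proof (rule ccontr)
      assume neg: "\<not> ?thesis"
      \<comment> \<open>\<open>Q (cis t)\<close> is the complex trigonometric sum with coefficients \<open>a\<close>, shifted to nonnegative frequencies\<close>
      define a where "a = (\<lambda>k. of_real ((real (2 * m))\<^sup>2 - (n k)\<^sup>2) * b k)"
      define Q where "Q = (\<Sum>k\<le>2*m. monom (a k) (4 * m - 2 * k))"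
      have Ta: "T a t = T (D (D b)) t + of_real ((real (2 * m))\<^sup>2) * T b t" for t
        unfolding T_def sum_distrib_left sum.distrib[symmetric]
        by (rule sum.cong) (auto simp: a_def D_def algebra_simps power2_eq_square)
      have Ta0: "T a t = 0" if "x < t" "t < y" for t
      proof -
        have "Re (T a t) = 0" using neg that by (auto simp: Ta)
        moreover have "Im (T a t) = 0" using realD[OF realD[OF real0]] real0 by (simp add: Ta)
        ultimately show ?thesis by (simp add: complex_eq_iff)
      qed
      have Q0: "poly Q (cis t) = 0" if "x < t" "t < y" for t
      proof -
        have "poly Q (cis t) = (\<Sum>k\<le>2*m. a k * cis (real (4 * m - 2 * k) * t))"
          by (simp add: Q_def poly_sum poly_monom Complex.DeMoivre)
        also have "\<dots> = (\<Sum>k\<le>2*m. cis (2 * real m * t) * (a k * cis (n k * t)))"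
          by (rule sum.cong) (auto simp: n_def cis_mult of_nat_diff algebra_simps mult.left_commute[of _ "a _"])
        also have "\<dots> = cis (2 * real m * t) * T a t" by (simp add: T_def sum_distrib_left)
        finally show ?thesis using Ta0[OF that] by simp
      qed
      obtain k where k: "k \<le> 2 * m" "b k \<noteq> 0" using ev(2) unfolding b_def by blast
      then have k2: "0 < k" "k < 2 * m" using b0 by (auto intro: ccontr le_neq_implies_less)
      have "a k = of_real (4 * real k * (2 * real m - real k)) * b k"
        by (simp add: a_def n_def power2_eq_square algebra_simps)
      moreover have "4 * real k * (2 * real m - real k) \<noteq> 0" using k2 by simp
      ultimately have ak: "a k \<noteq> 0" using k(2) by (metis mult_eq_0_iff of_real_eq_0_iff)
      have "coeff Q (4 * m - 2 * k) = (\<Sum>j\<le>2*m. if j = k then a j else 0)"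
        unfolding Q_def coeff_sum by (rule sum.cong) (use k in auto)
      also have "\<dots> = a k" using k by simp
      finally have "Q \<noteq> 0" using ak by auto
      then have fin: "finite {z. poly Q z = 0}" by (rule poly_roots_finite)
      define y' where "y' = min y (x + 1)"
      have "cis ` {x<..<y'} \<subseteq> {z. poly Q z = 0}" using Q0 by (auto simp: y'_def)
      then have "finite (cis ` {x<..<y'})" using fin finite_subset by blast
      moreover have "inj_on cis {x<..<y'}"
      proof (rule inj_onI)
        fix s t assume st: "s \<in> {x<..<y'}" "t \<in> {x<..<y'}" "cis s = cis t"
        then obtain i :: int where "\<i> * of_real s = \<i> * of_real t + of_int (2 * i) * of_real pi * \<i>"
          unfolding cis_conv_exp exp_eq by auto
        then have "s = t + 2 * of_int i * pi" by (auto simp: complex_eq_iff)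
        moreover have "\<bar>s - t\<bar> < 1" using st by (auto simp: y'_def abs_if)
        ultimately have lt: "2 * pi * \<bar>of_int i\<bar> < 1" by (simp add: abs_mult mult_ac)
        have "i = 0"
        proof (rule ccontr)
          assume "i \<noteq> 0"
          then have "(1::real) \<le> \<bar>of_int i\<bar>" by linarith
          then have "2 * pi * 1 \<le> 2 * pi * \<bar>of_int i\<bar>" by (intro mult_left_mono) auto
          then show False using lt pi_gt3 by linarith
        qed
        then show "s = t" using \<open>s = t + 2 * of_int i * pi\<close> by simp
      qed
      ultimately have "finite {x<..<y'}" using finite_imageD by blast
      then show False using infinite_Ioo[of x y'] xy by (auto simp: y'_def)
    qed
  qed
qed

lemma tangent_sinusoid_holomorphic:
  "Re (Complex (f w) (- (f1 w / real n)) * cis (- (real n * w)) * (of_real r * cis \<theta>) ^ n)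
    = r ^ n * tangent_sinusoid (real n) f f1 w \<theta>"
  by (simp only: Re_power_sinusoid tangent_sinusoid_def)

text \<open>
  If the angular density were negative at \<open>t\<close>, then \<open>H\<close> would lie below the harmonic function
  tangent to it along the ray through \<open>cis t\<close>, strictly off the ray. The mean of the harmonic
  function over a small circle is its value at \<open>cis t\<close>, so the sub-mean value inequality
  forces equality on the circle, which does not lie on the ray.
\<close>

lemma angular_density_nonneg:
  fixes H :: "complex \<Rightarrow> real"
  assumes n: "n > 0" and Hf: "\<And>r \<theta>. H (of_real r * cis \<theta>) = r ^ n * f \<theta>"
    and cH: "continuous_on UNIV H" and sub: "\<And>z r. r > 0 \<Longrightarrow> H z \<le> circle_mean H z r"
    and d: "\<And>t. (f has_real_derivative f1 t) (at t)" "\<And>t. (f1 has_real_derivative f2 t) (at t)"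
    and cf2: "continuous_on UNIV f2"
  shows "f2 t + (real n)\<^sup>2 * f t \<ge> 0"
proof (rule ccontr)
  let ?N = "real n"
  let ?\<mu> = "\<lambda>t. f2 t + ?N\<^sup>2 * f t"
  assume "\<not> ?\<mu> t \<ge> 0"
  then have neg: "?\<mu> t < 0" by simp
  have "continuous_on UNIV f"
    using d(1) by (intro DERIV_continuous_on) (auto intro: has_field_derivative_at_within)
  then have "continuous_on UNIV ?\<mu>" by (intro continuous_intros cf2)
  then have "isCont ?\<mu> t" by (simp add: continuous_on_eq_continuous_at)
  then obtain d0 where d0: "d0 > 0" "\<And>s. dist s t < d0 \<Longrightarrow> dist (?\<mu> s) (?\<mu> t) < - ?\<mu> t"
    unfolding continuous_at_eps_delta using neg by (metis neg_0_less_iff_less)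
  have neg': "?\<mu> s < 0" if "\<bar>s - t\<bar> < d0" for s
    using d0(2)[of s] that unfolding dist_real_def by linarith
  define \<eta> where "\<eta> = min d0 (pi / ?N)"
  have \<eta>: "\<eta> > 0" using d0 n by (simp add: \<eta>_def)
  have tan: "f \<theta> < tangent_sinusoid ?N f f1 t \<theta>" if \<theta>: "\<bar>\<theta> - t\<bar> < \<eta>" "\<theta> \<noteq> t" for \<theta>
  proof -
    have dm: "((\<lambda>t. - f t) has_real_derivative - f1 s) (at s)" "((\<lambda>t. - f1 t) has_real_derivative - f2 s) (at s)" for s
      by (rule DERIV_minus[OF d(1)], rule DERIV_minus[OF d(2)])
    have mid: "?\<mu> ((t + \<theta>) / 2) < 0" by (rule neg') (use \<theta> in \<open>auto simp: \<eta>_def abs_if field_simps split: if_splits\<close>)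
    have pos: "- f2 s + ?N\<^sup>2 * - f s \<ge> 0" if "\<bar>s - t\<bar> < d0" for s
      using neg'[OF that] by simp
    have "tangent_sinusoid ?N (\<lambda>t. - f t) (\<lambda>t. - f1 t) t \<theta> < - f \<theta>"
    proof (cases "t < \<theta>")
      case True
      show ?thesis
        by (rule tangent_sinusoid_less_right[OF _ dm, of _ _ _ "(t + \<theta>) / 2"])
           (use True n \<theta> mid pos in \<open>auto simp: \<eta>_def\<close>)
    next
      case False
      show ?thesis
        by (rule tangent_sinusoid_less_left[OF _ dm, of _ _ _ "(t + \<theta>) / 2"])
           (use False n \<theta> mid pos in \<open>auto simp: \<eta>_def\<close>)
    qed
    then show ?thesis by (simp add: tangent_sinusoid_def)
  qed
  let ?z0 = "cis t"
  obtain e where e: "e > 0" "\<And>z. z \<in> ball ?z0 e \<Longrightarrow> \<exists>\<phi>. \<bar>\<phi>\<bar> < \<eta> \<and> z = of_real (norm z) * cis (t + \<phi>)"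
    using polar_near[of ?z0 t \<eta>] \<eta> by auto
  define g where "g = (\<lambda>z. Complex (f t) (- (f1 t / ?N)) * cis (- (?N * t)) * z ^ n)"
  have gr: "Re (g (of_real r * cis \<theta>)) = r ^ n * tangent_sinusoid ?N f f1 t \<theta>" for r \<theta>
    unfolding g_def by (rule tangent_sinusoid_holomorphic)
  have cmp: "H z \<le> Re (g z) \<and> (H z = Re (g z) \<longrightarrow> z = of_real (norm z) * ?z0)"
    if "z \<in> ball ?z0 (min e 1)" for z
  proof -
    have "z \<in> ball ?z0 e" using that by auto
    from e(2)[OF this] obtain \<phi> where \<phi>: "\<bar>\<phi>\<bar> < \<eta>" "z = of_real (norm z) * cis (t + \<phi>)" by blast
    have z: "norm z > 0" using that by auto
    have Hz: "H z = norm z ^ n * f (t + \<phi>)" "Re (g z) = norm z ^ n * tangent_sinusoid ?N f f1 t (t + \<phi>)"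
      using \<phi>(2) Hf gr by metis+
    show ?thesis
    proof (cases "\<phi> = 0")
      case True
      then show ?thesis using Hz \<phi>(2) by (simp add: tangent_sinusoid_def)
    next
      case False
      then have "f (t + \<phi>) < tangent_sinusoid ?N f f1 t (t + \<phi>)" using tan[of "t + \<phi>"] \<phi>(1) by simp
      then have "norm z ^ n * f (t + \<phi>) < norm z ^ n * tangent_sinusoid ?N f f1 t (t + \<phi>)"
        by (rule mult_strict_left_mono) (use z in simp)
      then have "H z < Re (g z)" using Hz by linarith
      then show ?thesis by simp
    qed
  qed
  define r where "r = min e 1 / 2"
  have r: "r > 0" "r < min e 1" using e(1) by (auto simp: r_def)
  have gh: "g holomorphic_on X" for X unfolding g_def by (intro holomorphic_intros)
  let ?u = "\<lambda>z. H z + Re (- g z)"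
  have inb: "?z0 + of_real r * cis s \<in> ball ?z0 (min e 1)" for s
    using r by (simp add: dist_norm norm_mult)
  have cg: "continuous_on X (\<lambda>z. Re (- g z))" for X
    using holomorphic_on_imp_continuous_on[OF gh] by (intro continuous_intros)
  have cH': "continuous_on X H" for X using cH by (rule continuous_on_subset) simp
  have "Re (g ?z0) = H ?z0" using gr[of 1 t] Hf[of 1 t] by (simp add: tangent_sinusoid_def)
  moreover have "circle_mean (\<lambda>z. Re (- g z)) ?z0 r = Re (- g ?z0)"
    by (rule circle_mean_Re_holomorphic[OF holomorphic_on_minus[OF gh] r(1)])
  ultimately have mean: "0 \<le> circle_mean ?u ?z0 r"
    using circle_mean_add[OF cH' cg, of r ?z0] sub[OF r(1), of ?z0] r(1) by simp
  have u0: "?u (?z0 + of_real r * cis s) = 0" if "s \<in> {0..2*pi}" for s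
    by (rule circle_mean_attains_bound[OF continuous_on_add[OF cH' cg] _ _ mean that]) (use cmp r in auto)
  \<comment> \<open>two points of the circle that cannot both lie on the ray\<close>
  have "H (?z0 + of_real r * cis 0) = Re (g (?z0 + of_real r * cis 0))"
    "H (?z0 + of_real r * cis (pi/2)) = Re (g (?z0 + of_real r * cis (pi/2)))"
    using u0[of 0] u0[of "pi/2"] by auto
  then have "?z0 + of_real r * cis 0 = of_real (norm (?z0 + of_real r * cis 0)) * ?z0"
    "?z0 + of_real r * cis (pi/2) = of_real (norm (?z0 + of_real r * cis (pi/2))) * ?z0"
    using cmp[OF inb[of 0]] cmp[OF inb[of "pi/2"]] by auto
  then obtain x y :: real where xy: "of_real r = of_real x * ?z0" "of_real r * \<i> = of_real y * ?z0"
    by (metis (no_types) add_diff_cancel_left' cis_pi_half cis_zero left_diff_distrib mult.right_neutral mult_1 of_real_1 of_real_diff)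
  have "of_real y * (of_real x * ?z0) = \<i> * of_real x * (of_real x * ?z0)"
    using xy by (metis mult.assoc mult.commute)
  then have "of_real y * of_real r = \<i> * of_real x * of_real r" using xy(1) by simp
  then have "complex_of_real y = \<i> * of_real x" using r(1) by simp
  then have "x = 0" by (simp add: complex_eq_iff)
  then show False using xy(1) r(1) by simp
qed

text \<open>
  For \<open>z\<close> with argument \<open>\<theta>\<close>, the value at \<open>z\<close> of the harmonic function tangent to \<open>H\<close> along the
  ray of argument \<open>\<theta> + \<phi>\<close> is \<open>\<tau>0 z \<phi>\<close>. Subtract from it \<open>\<delta>\<close> times the harmonic function
  \<open>Re (z / cis (\<theta> + \<phi>))\<^bsup>2m\<^esup>\<close>, which is positive near the ray of tangency, and let \<open>Ht z\<close> be the
  maximum of the result \<open>\<tau> z \<phi>\<close> over \<open>|\<phi>| \<le> \<eta>\<close>. Near the ray of tangency each of these harmonic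
  functions competes in the maximum, so \<open>Ht\<close> is supported wherever the maximum is attained in
  the interior of the window; for small \<open>\<delta>\<close> the tangent functions are so much below \<open>H\<close> at the
  ends of the window that these are never better than \<open>\<phi> = 0\<close>.
\<close>

lemma bumped_subharmonic:
  fixes P :: "complex poly poly" and H :: "complex \<Rightarrow> real"
  assumes m: "m \<ge> 1" and HP: "\<And>z. complex_of_real (H z) = eval_zzbar P z"
    and hom: "homogeneous_zzbar (2 * m) P" and nh: "no_harmonic_terms P"
    and subh: "continuous_subharmonic H"
  obtains Ht \<delta> where "\<And>r z. H (of_real r * z) = r ^ (2 * m) * H z"
    "\<And>z. z \<noteq> 0 \<Longrightarrow> supported_at H z"
    "\<delta> > 0" "continuous_on UNIV Ht" "Ht 0 = 0"
    "\<And>z. Ht z \<le> H z - \<delta> * norm z ^ (2 * m)"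
    "\<And>z. z \<noteq> 0 \<Longrightarrow> supported_at Ht z"
proof (rule polynomial_angular_part[OF m HP hom nh])
  fix f f1 f2 :: "real \<Rightarrow> real" and H1 :: "complex \<Rightarrow> real"
  assume Hf: "\<And>r \<theta>. H (of_real r * cis \<theta>) = r ^ (2 * m) * f \<theta>"
    and H1f: "\<And>r \<theta>. H1 (of_real r * cis \<theta>) = r ^ (2 * m) * f1 \<theta>"
    and cH1: "continuous_on UNIV H1" and cf2: "continuous_on UNIV f2"
    and d: "\<And>t. (f has_real_derivative f1 t) (at t)" "\<And>t. (f1 has_real_derivative f2 t) (at t)"
    and nz: "\<And>a b. a < b \<Longrightarrow> \<exists>t. a < t \<and> t < b \<and> f2 t + (real (2 * m))\<^sup>2 * f t \<noteq> 0"
  define n where "n = 2 * m"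
  have n: "n > 0" "n \<ge> 2" using m by (auto simp: n_def)
  note Hf = Hf[folded n_def] and H1f = H1f[folded n_def] and nz = nz[folded n_def]
  let ?N = "real n"
  have cH: "continuous_on UNIV H" and sm: "\<And>z r. r > 0 \<Longrightarrow> H z \<le> circle_mean H z r"
    using subh by (auto simp: continuous_subharmonic_def circle_mean_def)
  have \<mu>: "f2 t + ?N\<^sup>2 * f t \<ge> 0" for t
    by (rule angular_density_nonneg[OF n(1) Hf cH sm d cf2])
  have tan: "tangent_sinusoid ?N f f1 w \<theta> < f \<theta>" if "\<theta> \<noteq> w" "\<bar>\<theta> - w\<bar> < pi / ?N" for w \<theta>
  proof (cases "w < \<theta>")
    case True
    obtain t where "w < t" "t < \<theta>" "f2 t + ?N\<^sup>2 * f t \<noteq> 0" using nz[OF True] by blast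
    then show ?thesis
      by (intro tangent_sinusoid_less_right[OF _ d]) (use True that n \<mu> in auto)
  next
    case False
    then have "\<theta> < w" using that by simp
    then obtain t where "\<theta> < t" "t < w" "f2 t + ?N\<^sup>2 * f t \<noteq> 0" using nz by blast
    then show ?thesis
      by (intro tangent_sinusoid_less_left[OF _ d]) (use False that n \<mu> in auto)
  qed
  have tan_eq: "tangent_sinusoid ?N f f1 w w = f w" for w by (simp add: tangent_sinusoid_def)
  have polar: "\<exists>\<theta>. z = of_real (norm z) * cis \<theta>" for z :: complex
    by (metis rcis_cmod_Arg rcis_def)
  have homog: "H (of_real r * z) = r ^ n * H z" for r z
  proof -
    obtain \<theta> where \<theta>: "z = of_real (norm z) * cis \<theta>" using polar by blast
    have "H (of_real r * z) = H (of_real (r * norm z) * cis \<theta>)" using \<theta> by (metis mult.assoc of_real_mult)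
    also have "\<dots> = r ^ n * (norm z ^ n * f \<theta>)" by (simp only: Hf power_mult_distrib mult.assoc)
    also have "\<dots> = r ^ n * H z" using \<theta> Hf by metis
    finally show ?thesis .
  qed
  have suppH: "supported_at H z" if z: "z \<noteq> 0" for z
  proof -
    obtain \<theta> where \<theta>: "z = of_real (norm z) * cis \<theta>" using polar by blast
    obtain e where e: "e > 0" "\<And>x. x \<in> ball z e \<Longrightarrow> \<exists>\<phi>. \<bar>\<phi>\<bar> < pi / ?N \<and> x = of_real (norm x) * cis (\<theta> + \<phi>)"
      using polar_near[OF z \<theta>, of "pi / ?N"] n by auto
    let ?g = "\<lambda>x. Complex (f \<theta>) (- (f1 \<theta> / ?N)) * cis (- (?N * \<theta>)) * x ^ n"
    have "Re (?g z) = H z"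
      using tangent_sinusoid_holomorphic[of f \<theta> f1 n "norm z" \<theta>] \<theta> Hf[of "norm z" \<theta>] tan_eq by metis
    moreover have "Re (?g x) \<le> H x" if x: "x \<in> ball z e" for x
    proof -
      obtain \<phi> where \<phi>: "\<bar>\<phi>\<bar> < pi / ?N" "x = of_real (norm x) * cis (\<theta> + \<phi>)" using e(2)[OF x] by blast
      have "tangent_sinusoid ?N f f1 \<theta> (\<theta> + \<phi>) \<le> f (\<theta> + \<phi>)"
        using tan[of "\<theta> + \<phi>" \<theta>] \<phi>(1) tan_eq by (cases "\<phi> = 0") auto
      then have "norm x ^ n * tangent_sinusoid ?N f f1 \<theta> (\<theta> + \<phi>) \<le> norm x ^ n * f (\<theta> + \<phi>)"
        by (rule mult_left_mono) simp
      then show ?thesis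
        using tangent_sinusoid_holomorphic[of f \<theta> f1 n "norm x" "\<theta> + \<phi>"] \<phi>(2) Hf[of "norm x" "\<theta> + \<phi>"] by metis
    qed
    ultimately show ?thesis unfolding supported_at_def
      using e(1) by (intro exI[of _ ?g] exI[of _ e]) (auto intro!: holomorphic_intros)
  qed
  \<comment> \<open>a window on which \<open>cos (N * \<phi>) \<ge> cos (pi / 4) > 1/2\<close>\<close>
  define \<eta> where "\<eta> = pi / (4 * ?N)"
  have \<eta>: "\<eta> > 0" "\<eta> < pi / ?N" "?N * \<eta> = pi / 4" using n by (auto simp: \<eta>_def field_simps)
  define \<tau>0 where "\<tau>0 = (\<lambda>z \<phi>. H (z * cis \<phi>) * cos (?N * \<phi>) - H1 (z * cis \<phi>) * sin (?N * \<phi>) / ?N)"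
  have \<tau>0: "\<tau>0 (of_real r * cis \<theta>) \<phi> = r ^ n * tangent_sinusoid ?N f f1 (\<theta> + \<phi>) \<theta>" for r \<theta> \<phi>
  proof -
    have rot: "of_real r * cis \<theta> * cis \<phi> = of_real r * cis (\<theta> + \<phi>)" by (simp add: cis_mult mult.assoc)
    have "?N * (\<theta> - (\<theta> + \<phi>)) = - (?N * \<phi>)" by simp
    then show ?thesis
      unfolding \<tau>0_def rot Hf H1f tangent_sinusoid_def by (simp add: right_diff_distrib)
  qed
  have c\<tau>0: "continuous_on UNIV (\<lambda>x. \<tau>0 (fst x) (snd x))"
    unfolding \<tau>0_def
    by (intro continuous_intros continuous_on_compose2[OF cH] continuous_on_compose2[OF cH1]) (use n in auto)
  have c\<tau>0': "continuous_on UNIV (\<lambda>z. \<tau>0 z \<phi>)" for \<phi>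
    using continuous_on_compose2[OF c\<tau>0 continuous_on_Pair[OF continuous_on_id continuous_on_const]]
    by simp
  have gap: "\<exists>\<kappa>>0. \<forall>z\<in>sphere 0 1. \<kappa> \<le> H z - \<tau>0 z \<phi>" if \<phi>: "\<phi> \<noteq> 0" "\<bar>\<phi>\<bar> < pi / ?N" for \<phi>
  proof -
    have "continuous_on (sphere 0 1) (\<lambda>z. H z - \<tau>0 z \<phi>)"
      by (intro continuous_on_diff continuous_on_subset[OF cH] continuous_on_subset[OF c\<tau>0']) auto
    then obtain z where z: "z \<in> sphere 0 1" "\<And>y. y \<in> sphere 0 1 \<Longrightarrow> H z - \<tau>0 z \<phi> \<le> H y - \<tau>0 y \<phi>"
      using continuous_attains_inf[of "sphere (0::complex) 1" "\<lambda>z. H z - \<tau>0 z \<phi>"] by auto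
    obtain \<theta> where "z = of_real 1 * cis \<theta>" using polar[of z] z(1) by auto
    then have "H z - \<tau>0 z \<phi> = f \<theta> - tangent_sinusoid ?N f f1 (\<theta> + \<phi>) \<theta>"
      using Hf[of 1 \<theta>] \<tau>0[of 1 \<theta> \<phi>] by simp
    then have "H z - \<tau>0 z \<phi> > 0" using tan[of \<theta> "\<theta> + \<phi>"] \<phi> by simp
    then show ?thesis using z(2) by blast
  qed
  \<comment> \<open>at the ends of the window the tangent functions are below \<open>H\<close> by a definite amount\<close>
  obtain \<kappa>1 where \<kappa>1: "\<kappa>1 > 0" "\<And>z. z \<in> sphere 0 1 \<Longrightarrow> \<kappa>1 \<le> H z - \<tau>0 z \<eta>"
    using gap[of \<eta>] \<eta> by auto
  obtain \<kappa>2 where \<kappa>2: "\<kappa>2 > 0" "\<And>z. z \<in> sphere 0 1 \<Longrightarrow> \<kappa>2 \<le> H z - \<tau>0 z (- \<eta>)"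
    using gap[of "- \<eta>"] \<eta> by auto
  define \<delta> where "\<delta> = min \<kappa>1 \<kappa>2"
  have \<delta>: "\<delta> > 0" using \<kappa>1 \<kappa>2 by (simp add: \<delta>_def)
  define \<tau> where "\<tau> = (\<lambda>z \<phi>. \<tau>0 z \<phi> - \<delta> * norm z ^ n * cos (?N * \<phi>))"
  let ?K = "{-\<eta>..\<eta>}"
  have c\<tau>: "continuous_on UNIV (\<lambda>x. \<tau> (fst x) (snd x))"
    unfolding \<tau>_def by (intro continuous_intros c\<tau>0)
  have c\<tau>': "continuous_on ?K (\<tau> z)" for z
    using continuous_on_compose2[OF c\<tau> continuous_on_Pair[OF continuous_on_const continuous_on_id]]
    by simp
  have "\<exists>M. (\<exists>\<phi>\<in>?K. \<tau> z \<phi> = M) \<and> (\<forall>\<phi>\<in>?K. \<tau> z \<phi> \<le> M)" for z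
    using continuous_attains_sup[OF _ _ c\<tau>'[of z]] \<eta>(1) by auto
  then obtain Ht where Ht: "\<And>z. \<exists>\<phi>\<in>?K. \<tau> z \<phi> = Ht z" "\<And>z \<phi>. \<phi> \<in> ?K \<Longrightarrow> \<tau> z \<phi> \<le> Ht z"
    by metis
  have cHt: "continuous_on UNIV Ht"
    unfolding continuous_on_iff
  proof (intro ballI allI impI)
    fix z :: complex and e :: real assume e: "e > 0"
    have "uniformly_continuous_on (cball z 1 \<times> ?K) (\<lambda>x. \<tau> (fst x) (snd x))"
      by (rule compact_uniformly_continuous) (auto intro!: compact_Times continuous_on_subset[OF c\<tau>])
    then obtain d where d: "d > 0" "\<And>x y. x \<in> cball z 1 \<times> ?K \<Longrightarrow> y \<in> cball z 1 \<times> ?K \<Longrightarrow> dist y x < d \<Longrightarrow>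
        dist (\<tau> (fst y) (snd y)) (\<tau> (fst x) (snd x)) < e"
      unfolding uniformly_continuous_on_def using e by meson
    have close: "Ht x < Ht y + e" if "x \<in> cball z 1" "y \<in> cball z 1" "dist x y < d" for x y
    proof -
      obtain \<phi> where \<phi>: "\<phi> \<in> ?K" "\<tau> x \<phi> = Ht x" using Ht(1) by blast
      have "dist (\<tau> x \<phi>) (\<tau> y \<phi>) < e"
        using d(2)[of "(y, \<phi>)" "(x, \<phi>)"] that \<phi>(1) by (simp add: dist_Pair_Pair)
      then show ?thesis using \<phi> Ht(2)[of \<phi> y] by (simp add: dist_real_def abs_if split: if_splits)
    qed
    show "\<exists>d>0. \<forall>x'\<in>UNIV. dist x' z < d \<longrightarrow> dist (Ht x') (Ht z) < e"
    proof (intro exI[of _ "min d 1"] conjI ballI impI)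
      fix x assume "dist x z < min d 1"
      then have "Ht x < Ht z + e" "Ht z < Ht x + e" by (auto intro!: close simp: dist_commute)
      then show "dist (Ht x) (Ht z) < e" by (simp add: dist_real_def abs_if)
    qed (use d in auto)
  qed
  have cos_ge: "cos (?N * \<phi>) \<ge> 1/2" if "\<phi> \<in> ?K" for \<phi>
  proof -
    have "\<bar>?N * \<phi>\<bar> \<le> pi / 4"
      using that \<eta>(3) n by (metis abs_le_iff abs_mult abs_of_nat atLeastAtMost_iff minus_le_iff mult_left_mono of_nat_0_le_iff)
    then have "cos (pi / 3) \<le> cos \<bar>?N * \<phi>\<bar>" by (intro cos_monotone_0_pi_le) auto
    then show ?thesis by (simp add: cos_60)
  qed
  have le: "Ht z \<le> H z - \<delta> / 2 * norm z ^ n" for z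
  proof -
    obtain \<phi> where \<phi>: "\<phi> \<in> ?K" "\<tau> z \<phi> = Ht z" using Ht(1) by blast
    obtain \<theta> where \<theta>: "z = of_real (norm z) * cis \<theta>" using polar by blast
    have "\<bar>\<phi>\<bar> < pi / ?N" using \<phi>(1) \<eta>(2) by (simp add: abs_if)
    then have "tangent_sinusoid ?N f f1 (\<theta> + \<phi>) \<theta> \<le> f \<theta>"
      using tan[of \<theta> "\<theta> + \<phi>"] tan_eq by (cases "\<phi> = 0") auto
    then have "norm z ^ n * tangent_sinusoid ?N f f1 (\<theta> + \<phi>) \<theta> \<le> norm z ^ n * f \<theta>"
      by (rule mult_left_mono) simp
    then have "\<tau>0 z \<phi> \<le> H z" using \<theta> Hf \<tau>0 by metis
    moreover have "\<delta> * norm z ^ n * (1/2) \<le> \<delta> * norm z ^ n * cos (?N * \<phi>)"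
      by (rule mult_left_mono[OF cos_ge[OF \<phi>(1)]]) (use \<delta> in simp)
    ultimately show ?thesis using \<phi>(2) by (simp add: \<tau>_def)
  qed
  have Ht0: "Ht 0 = 0"
  proof -
    have "H 0 = 0" "H1 0 = 0" using Hf[of 0 0] H1f[of 0 0] n by auto
    then have "\<tau> 0 \<phi> = 0" for \<phi> using n by (simp add: \<tau>_def \<tau>0_def)
    then show ?thesis using Ht(1)[of 0] by auto
  qed
  have suppHt: "supported_at Ht z" if z: "z \<noteq> 0" for z
  proof -
    have r: "norm z > 0" using z by simp
    obtain \<theta> where \<theta>: "z = of_real (norm z) * cis \<theta>" using polar by blast
    obtain \<phi> where \<phi>: "\<phi> \<in> ?K" "\<tau> z \<phi> = Ht z" using Ht(1) by blast
    have edge: "\<tau> z \<phi> \<le> \<tau> z 0" if "\<phi> = \<eta> \<or> \<phi> = - \<eta>"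
    proof -
      have "\<delta> \<le> H (cis \<theta>) - \<tau>0 (cis \<theta>) \<phi>"
        using that \<kappa>1(2)[of "cis \<theta>"] \<kappa>2(2)[of "cis \<theta>"] by (auto simp: \<delta>_def)
      also have "\<dots> = f \<theta> - tangent_sinusoid ?N f f1 (\<theta> + \<phi>) \<theta>"
        using Hf[of 1 \<theta>] \<tau>0[of 1 \<theta> \<phi>] by simp
      finally have "norm z ^ n * \<delta> \<le> norm z ^ n * (f \<theta> - tangent_sinusoid ?N f f1 (\<theta> + \<phi>) \<theta>)"
        by (rule mult_left_mono) simp
      also have "\<dots> = norm z ^ n * f \<theta> - norm z ^ n * tangent_sinusoid ?N f f1 (\<theta> + \<phi>) \<theta>"
        by (simp add: algebra_simps)
      also have "\<dots> = H z - \<tau>0 z \<phi>" using \<theta> Hf \<tau>0 by metis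
      finally have 1: "\<delta> * norm z ^ n \<le> H z - \<tau>0 z \<phi>" by (simp add: mult.commute)
      have "0 \<le> \<delta> * norm z ^ n * cos (?N * \<phi>)" using cos_ge[OF \<phi>(1)] \<delta> by simp
      with 1 have "\<tau> z \<phi> \<le> H z - \<delta> * norm z ^ n" by (simp add: \<tau>_def)
      also have "\<dots> = \<tau> z 0" by (simp add: \<tau>_def \<tau>0_def)
      finally show ?thesis .
    qed
    have "\<exists>\<psi>. \<bar>\<psi>\<bar> < \<eta> \<and> \<tau> z \<psi> = Ht z"
    proof (cases "\<phi> = \<eta> \<or> \<phi> = - \<eta>")
      case True
      then have "\<tau> z 0 = Ht z" using edge \<phi>(2) Ht(2)[of 0 z] \<eta> by simp
      then show ?thesis using \<eta> by (intro exI[of _ 0]) simp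
    next
      case False
      then show ?thesis using \<phi> by (intro exI[of _ \<phi>]) (auto simp: abs_if)
    qed
    then obtain \<psi> where \<psi>: "\<bar>\<psi>\<bar> < \<eta>" "\<tau> z \<psi> = Ht z" by blast
    define w where "w = \<theta> + \<psi>"
    obtain e where e: "e > 0" "\<And>x. x \<in> ball z e \<Longrightarrow> \<exists>\<phi>. \<bar>\<phi>\<bar> < \<eta> - \<bar>\<psi>\<bar> \<and> x = of_real (norm x) * cis (\<theta> + \<phi>)"
      using polar_near[OF z \<theta>, of "\<eta> - \<bar>\<psi>\<bar>"] \<psi> by auto
    \<comment> \<open>the competitor that attains the maximum at \<open>z\<close> supports \<open>Ht\<close> near \<open>z\<close>\<close>
    let ?g = "\<lambda>x. Complex (f w - \<delta>) (- (f1 w / ?N)) * cis (- (?N * w)) * x ^ n"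
    have g: "Re (?g (of_real r * cis t)) = \<tau> (of_real r * cis t) (w - t)" if "r \<ge> 0" for r t
    proof -
      have "cos (?N * (w - t)) = cos (?N * (t - w))" by (metis cos_minus minus_diff_eq mult_minus_right)
      then show ?thesis unfolding Re_power_sinusoid \<tau>_def \<tau>0
        using that by (simp add: tangent_sinusoid_def norm_mult algebra_simps)
    qed
    have "Re (?g z) = Ht z" using g[of "norm z" \<theta>] \<theta> \<psi>(2) by (metis add_diff_cancel_left' norm_ge_zero w_def)
    moreover have "Re (?g x) \<le> Ht x" if x: "x \<in> ball z e" for x
    proof -
      obtain \<phi> where \<phi>: "\<bar>\<phi>\<bar> < \<eta> - \<bar>\<psi>\<bar>" "x = of_real (norm x) * cis (\<theta> + \<phi>)" using e(2)[OF x] by blast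
      have "Re (?g x) = \<tau> x (w - (\<theta> + \<phi>))" using g[of "norm x" "\<theta> + \<phi>"] \<phi>(2) by (metis norm_ge_zero)
      also have "\<dots> \<le> Ht x" by (rule Ht(2)) (use \<phi>(1) in \<open>auto simp: w_def abs_if split: if_splits\<close>)
      finally show ?thesis .
    qed
    ultimately show ?thesis unfolding supported_at_def
      using e(1) by (intro exI[of _ ?g] exI[of _ e]) (auto intro!: holomorphic_intros)
  qed
  show thesis
    by (rule that[of "\<delta> / 2" Ht]) (use homog suppH \<delta> cHt Ht0 le suppHt in \<open>auto simp: n_def\<close>)
qed

section \<open>Cauchy estimates and normal families in several variables\<close>

lemma norm_vector_smult: "norm (c *s (v :: complex ^ 'n)) = cmod c * norm v"
  by (simp add: norm_vec_def norm_mult L2_set_right_distrib)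

lemma norm_le_sum_component: "norm (x :: complex ^ 'n) \<le> (\<Sum>i\<in>UNIV. cmod (x $ i))"
  unfolding norm_vec_def by (rule L2_set_le_sum) auto

lemma norm_le_card_component:
  fixes x :: "complex ^ 'n"
  assumes "\<And>i. cmod (x $ i) \<le> B"
  shows "norm x \<le> real CARD('n) * B"
  using order_trans[OF norm_le_sum_component sum_bounded_above[of UNIV "\<lambda>i. cmod (x $ i)" B]] assms by simp

lemma has_derivative_vec_componentwise:
  fixes f D :: "'a::real_normed_vector \<Rightarrow> complex ^ 'm"
  assumes "\<And>i. ((\<lambda>x. f x $ i) has_derivative (\<lambda>h. D h $ i)) (at x within S)"
  shows "(f has_derivative D) (at x within S)"
proof (subst has_derivative_componentwise_within, rule ballI)
  fix e :: "complex ^ 'm" assume "e \<in> Basis"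
  then obtain i b where "e = axis i b" by (auto simp: Basis_vec_def)
  then show "((\<lambda>x. f x \<bullet> e) has_derivative (\<lambda>x. D x \<bullet> e)) (at x within S)"
    using has_derivative_inner_left[OF assms[of i], of b] by (simp add: inner_axis)
qed

lemma holomorphic_map_on_subset: "holomorphic_map_on f S \<Longrightarrow> T \<subseteq> S \<Longrightarrow> holomorphic_map_on f T"
  by (auto simp: holomorphic_map_on_def)

lemma holomorphic_map_on_imp_continuous_on: "holomorphic_map_on f S \<Longrightarrow> continuous_on S f"
  unfolding holomorphic_map_on_def
  by (meson continuous_at_imp_continuous_on has_derivative_continuous)

lemma holomorphic_map_on_compose:
  assumes "holomorphic_map_on f S" "holomorphic_map_on g T" "f ` S \<subseteq> T"
  shows "holomorphic_map_on (g \<circ> f) S"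
  unfolding holomorphic_map_on_def
proof
  fix x assume x: "x \<in> S"
  obtain D where D: "(f has_derivative D) (at x)" "\<And>c v. D (c *s v) = c *s D v"
    using assms(1) x by (auto simp: holomorphic_map_on_def)
  have "f x \<in> T" using assms(3) x by auto
  then obtain E where E: "(g has_derivative E) (at (f x))" "\<And>c v. E (c *s v) = c *s E v"
    using assms(2) by (auto simp: holomorphic_map_on_def)
  show "\<exists>D. (g \<circ> f has_derivative D) (at x) \<and> (\<forall>c v. D (c *s v) = c *s D v)"
    using diff_chain_at[OF D(1) E(1)] D(2) E(2) by (intro exI[of _ "E \<circ> D"]) auto
qed

lemma holomorphic_curve_compose:
  fixes k :: "complex \<Rightarrow> complex ^ 'n" and F :: "complex ^ 'n \<Rightarrow> complex ^ 'm"
  assumes F: "holomorphic_map_on F T" and k: "\<And>j. (\<lambda>z. k z $ j) holomorphic_on S" "open S" "k ` S \<subseteq> T"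
  shows "(\<lambda>z. F (k z) $ i) holomorphic_on S"
  unfolding holomorphic_on_open[OF k(2)]
proof
  fix z assume z: "z \<in> S"
  have "\<forall>j. \<exists>d. ((\<lambda>z. k z $ j) has_field_derivative d) (at z)"
    using k(1,2) z holomorphic_on_open by blast
  then obtain d where d: "\<And>j. ((\<lambda>z. k z $ j) has_field_derivative d j) (at z)" by metis
  have dk: "(k has_derivative (\<lambda>h. h *s (\<chi> j. d j))) (at z)"
    by (rule has_derivative_vec_componentwise)
       (use d in \<open>simp add: has_field_derivative_def mult_commute_abs\<close>)
  obtain D where D: "(F has_derivative D) (at (k z))" "\<And>c v. D (c *s v) = c *s D v"
    using F k(3) z unfolding holomorphic_map_on_def by blast
  have "((\<lambda>z. F (k z)) has_derivative (\<lambda>h. h *s D (\<chi> j. d j))) (at z)"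
    using diff_chain_at[OF dk D(1)] D(2) by (simp add: o_def)
  from bounded_linear.has_derivative[OF bounded_linear_vec_nth this, of i]
  have "((\<lambda>z. F (k z) $ i) has_field_derivative (D (\<chi> j. d j) $ i)) (at z)"
    by (simp add: has_field_derivative_def mult_commute_abs)
  then show "\<exists>f'. ((\<lambda>z. F (k z) $ i) has_field_derivative f') (at z)" by blast
qed

lemma affine_curve_holomorphic: "(\<lambda>z. (x + z *s (v :: complex ^ 'n)) $ j) holomorphic_on S"
  by (simp, intro holomorphic_intros)

lemma holomorphic_map_on_line:
  fixes F :: "complex ^ 'n \<Rightarrow> complex ^ 'm"
  assumes F: "holomorphic_map_on F T" and "open S" "\<And>z. z \<in> S \<Longrightarrow> x + z *s v \<in> T"
  shows "(\<lambda>z. F (x + z *s v) $ i) holomorphic_on S"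
  by (rule holomorphic_curve_compose[OF F affine_curve_holomorphic assms(2)]) (use assms(3) in auto)

lemma continuous_on_line: "continuous_on S (\<lambda>z. x + z *s (v :: complex ^ 'n))"
proof -
  have "((\<lambda>z. x + z *s v) has_derivative (\<lambda>h. h *s v)) (at z within S)" for z
    by (rule has_derivative_vec_componentwise) (auto intro!: derivative_eq_intros)
  from has_derivative_continuous[OF this] show ?thesis
    unfolding continuous_on_eq_continuous_within by blast
qed

text \<open>
  The one-variable estimate on the complex line through \<open>x\<close> in the direction \<open>v\<close>; half the
  radius is given away so that \<open>f\<close> is holomorphic beyond the circle.
\<close>

lemma cauchy_estimate:
  fixes f :: "complex ^ 'n \<Rightarrow> complex ^ 'm"
  assumes f: "holomorphic_map_on f (ball x r)" and r: "r > 0"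
    and B: "\<And>y. y \<in> ball x r \<Longrightarrow> norm (f y) \<le> B"
    and D: "(f has_derivative D) (at x)" "\<And>c v. D (c *s v) = c *s D v"
  shows "norm (D v) \<le> real CARD('m) * (2 * B / r) * norm v"
proof (cases "v = 0")
  case True
  then show ?thesis using D(2)[of 0 0] by simp
next
  case False
  define R where "R = r / (2 * norm v)"
  have R: "R > 0" using False r by (simp add: R_def)
  have in_ball: "x + z *s v \<in> ball x r" if "z \<in> ball 0 (2 * R)" for z
    using that False by (simp add: dist_norm norm_vector_smult R_def field_simps)
  have "cmod (D v $ i) \<le> 2 * B / r * norm v" for i
  proof -
    let ?\<phi> = "\<lambda>z. f (x + z *s v) $ i"
    have hol: "?\<phi> holomorphic_on ball 0 (2 * R)"
      by (rule holomorphic_map_on_line[OF f open_ball in_ball])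
    have cb: "cball 0 R \<subseteq> ball 0 (2 * R)" using R by auto
    have "cmod ((deriv ^^ 1) ?\<phi> 0) \<le> fact 1 * B / R ^ 1"
    proof (rule Cauchy_inequality)
      show "?\<phi> holomorphic_on ball 0 R" using hol cb ball_subset_cball by (meson holomorphic_on_subset)
      show "continuous_on (cball 0 R) ?\<phi>" using hol cb by (meson holomorphic_on_imp_continuous_on holomorphic_on_subset)
      fix z :: complex assume "cmod (0 - z) = R"
      then have "norm (f (x + z *s v)) \<le> B" using R by (intro B in_ball) auto
      then show "cmod (?\<phi> z) \<le> B" by (meson component_le_norm_cart Finite_Cartesian_Product.norm_nth_le order_trans)
    qed (fact R)
    moreover have "(?\<phi> has_field_derivative D v $ i) (at 0)"
    proof -
      have l: "((\<lambda>z. x + z *s v) has_derivative (\<lambda>h. h *s v)) (at 0)"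
        by (rule has_derivative_vec_componentwise) (auto intro!: derivative_eq_intros)
      have "((\<lambda>z. f (x + z *s v)) has_derivative (\<lambda>h. h *s D v)) (at 0)"
        using diff_chain_at[OF l, of f D] D by (simp add: o_def)
      from bounded_linear.has_derivative[OF bounded_linear_vec_nth this, of i]
      show ?thesis by (simp add: has_field_derivative_def mult_commute_abs)
    qed
    then have "deriv ?\<phi> 0 = D v $ i" by (rule DERIV_imp_deriv)
    ultimately show ?thesis using False r by (simp add: R_def field_simps)
  qed
  from norm_le_card_component[OF this] show ?thesis by (simp add: mult.assoc)
qed

lemma holomorphic_map_lipschitz:
  fixes f :: "complex ^ 'n \<Rightarrow> complex ^ 'm"
  assumes f: "holomorphic_map_on f (ball x r)" and r: "r > 0"
    and B: "\<And>y. y \<in> ball x r \<Longrightarrow> norm (f y) \<le> B"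
    and yz: "y \<in> ball x (r/2)" "z \<in> ball x (r/2)"
  shows "norm (f y - f z) \<le> real CARD('m) * (4 * B / r) * norm (y - z)"
proof -
  have sub: "ball y (r/2) \<subseteq> ball x r" if "y \<in> ball x (r/2)" for y
  proof
    fix w assume "w \<in> ball y (r/2)"
    then show "w \<in> ball x r" using that dist_triangle[of x w y] by simp
  qed
  have "\<forall>y\<in>ball x (r/2). \<exists>D. (f has_derivative D) (at y) \<and> (\<forall>c v. D (c *s v) = c *s D v)"
    using f sub r unfolding holomorphic_map_on_def by (auto simp: subset_iff)
  then obtain D where D: "\<And>y. y \<in> ball x (r/2) \<Longrightarrow> (f has_derivative D y) (at y)"
    "\<And>y c v. y \<in> ball x (r/2) \<Longrightarrow> D y (c *s v) = c *s D y v" by metis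
  have bd: "norm (D y v) \<le> real CARD('m) * (4 * B / r) * norm v" if y: "y \<in> ball x (r/2)" for y v
  proof -
    have "norm (D y v) \<le> real CARD('m) * (2 * B / (r/2)) * norm v"
      by (rule cauchy_estimate[OF holomorphic_map_on_subset[OF f sub[OF y]]])
         (use r B sub[OF y] D y in auto)
    then show ?thesis by (simp add: field_simps)
  qed
  show ?thesis
  proof (rule differentiable_bound[of "ball x (r/2)" f D])
    fix w assume w: "w \<in> ball x (r/2)"
    show "(f has_derivative D w) (at w within ball x (r/2))"
      by (rule has_derivative_at_withinI[OF D(1)[OF w]])
    show "onorm (D w) \<le> real CARD('m) * (4 * B / r)"
      by (rule onorm_le) (rule bd[OF w])
  qed (use yz in auto)
qed

text \<open>
  The diagonal argument, reduced to uniformly bounded sequences by dividing by the eventual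
  bounds and replacing the finitely many exceptional values at each point by zero.
\<close>

lemma diagonal_subsequence_pointwise:
  fixes f :: "nat \<Rightarrow> 'a \<Rightarrow> complex ^ 'm"
  assumes "countable S" and bd: "\<And>x. x \<in> S \<Longrightarrow> \<exists>B. \<forall>\<^sub>F n in sequentially. norm (f n x) \<le> B"
  shows "\<exists>k. strict_mono (k::nat\<Rightarrow>nat) \<and> (\<forall>x\<in>S. convergent (\<lambda>n. f (k n) x))"
proof -
  obtain B where B: "\<And>x. x \<in> S \<Longrightarrow> \<forall>\<^sub>F n in sequentially. norm (f n x) \<le> B x" using bd by metis
  define b where "b = (\<lambda>x. max 1 (B x))"
  define f' where "f' = (\<lambda>n x. if norm (f n x) \<le> b x then (1 / b x) *\<^sub>R f n x else 0)"
  have b: "b x \<ge> 1" "b x > 0" for x by (auto simp: b_def)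
  have "norm (f' n x) \<le> 1" for n x
    using b(2)[of x] by (auto simp: f'_def field_simps)
  then obtain k where k: "strict_mono (k::nat\<Rightarrow>nat)" "\<And>x. x \<in> S \<Longrightarrow> \<exists>l. (\<lambda>n. f' (k n) x) \<longlonglongrightarrow> l"
    using function_convergent_subsequence[OF assms(1), of f' 1] by blast
  show ?thesis
  proof (intro exI[of _ k] conjI ballI k(1))
    fix x assume x: "x \<in> S"
    obtain l where l: "(\<lambda>n. f' (k n) x) \<longlonglongrightarrow> l" using k(2)[OF x] by blast
    have "\<forall>\<^sub>F n in sequentially. norm (f (k n) x) \<le> B x"
      using eventually_subseq[OF k(1) B[OF x]] by simp
    then have "\<forall>\<^sub>F n in sequentially. b x *\<^sub>R f' (k n) x = f (k n) x"
      by eventually_elim (use b(2)[of x] in \<open>auto simp: f'_def b_def\<close>)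
    moreover have "(\<lambda>n. b x *\<^sub>R f' (k n) x) \<longlonglongrightarrow> b x *\<^sub>R l" by (intro tendsto_intros l)
    ultimately have "(\<lambda>n. f (k n) x) \<longlonglongrightarrow> b x *\<^sub>R l"
      by (rule Lim_transform_eventually[rotated])
    then show "convergent (\<lambda>n. f (k n) x)" by (auto simp: convergent_def)
  qed
qed

text \<open>
  Uniformly Cauchy sequences of holomorphic maps have uniformly Cauchy derivatives on smaller
  balls, by the Cauchy estimate for differences; the limit of the derivatives is complex linear
  and is the derivative of the limit.
\<close>

lemma uniformly_Cauchy_holomorphic_limit:
  fixes f :: "nat \<Rightarrow> complex ^ 'n \<Rightarrow> complex ^ 'm"
  assumes r: "r > 0" and hol: "\<forall>\<^sub>F n in sequentially. holomorphic_map_on (f n) (ball x r)"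
    and cau: "\<And>e. e > 0 \<Longrightarrow> \<exists>N. \<forall>m\<ge>N. \<forall>n\<ge>N. \<forall>y\<in>ball x r. norm (f m y - f n y) \<le> e"
  shows "holomorphic_map_on (\<lambda>y. lim (\<lambda>n. f n y)) (ball x (r/2))"
    and "uniform_limit (ball x (r/2)) f (\<lambda>y. lim (\<lambda>n. f n y)) sequentially"
proof -
  obtain N0 where N0: "\<And>n. n \<ge> N0 \<Longrightarrow> holomorphic_map_on (f n) (ball x r)"
    using hol by (auto simp: eventually_sequentially)
  \<comment> \<open>drops the finitely many maps that need not be holomorphic on the ball\<close>
  define F where "F = (\<lambda>n. f (n + N0))"
  have F: "holomorphic_map_on (F n) (ball x r)" for n using N0 by (simp add: F_def)
  have sub: "ball y (r/2) \<subseteq> ball x r" if "y \<in> ball x (r/2)" for y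
  proof
    fix w assume "w \<in> ball y (r/2)"
    then show "w \<in> ball x r" using that dist_triangle[of x w y] by simp
  qed
  have xr: "ball x (r/2) \<subseteq> ball x r" using r by auto
  have "\<forall>n. \<forall>y\<in>ball x r. \<exists>D. (F n has_derivative D) (at y) \<and> (\<forall>c v. D (c *s v) = c *s D v)"
    using F by (simp add: holomorphic_map_on_def)
  then obtain D where D: "\<And>n y. y \<in> ball x r \<Longrightarrow> (F n has_derivative D n y) (at y)"
    "\<And>n y c v. y \<in> ball x r \<Longrightarrow> D n y (c *s v) = c *s D n y v" by metis
  have Dcau: "\<exists>N. \<forall>m\<ge>N. \<forall>n\<ge>N. \<forall>y\<in>ball x (r/2). \<forall>v. norm (D m y v - D n y v) \<le> e * norm v"
    if e: "e > 0" for e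
  proof -
    define e' where "e' = e * r / (4 * real CARD('m))"
    have e': "e' > 0" using e r by (simp add: e'_def)
    obtain N where N: "\<And>m n y. m \<ge> N \<Longrightarrow> n \<ge> N \<Longrightarrow> y \<in> ball x r \<Longrightarrow> norm (f m y - f n y) \<le> e'"
      using cau[OF e'] by blast
    have "norm (D m y v - D n y v) \<le> e * norm v" if mn: "m \<ge> N" "n \<ge> N" and y: "y \<in> ball x (r/2)" for m n y v
    proof -
      have dd: "((\<lambda>y. F m y - F n y) has_derivative (\<lambda>v. D m w v - D n w v)) (at w)" if "w \<in> ball x r" for w
        by (intro has_derivative_diff D that)
      have "norm (D m y v - D n y v) \<le> real CARD('m) * (2 * e' / (r/2)) * norm v"
      proof (rule cauchy_estimate[of "\<lambda>y. F m y - F n y"])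
        show "holomorphic_map_on (\<lambda>y. F m y - F n y) (ball y (r/2))"
          unfolding holomorphic_map_on_def
        proof
          fix w assume "w \<in> ball y (r/2)"
          then have w: "w \<in> ball x r" using sub[OF y] by blast
          show "\<exists>E. ((\<lambda>y. F m y - F n y) has_derivative E) (at w) \<and> (\<forall>c v. E (c *s v) = c *s E v)"
            by (intro exI[of _ "\<lambda>v. D m w v - D n w v"])
               (simp add: dd[OF w] D(2)[OF w] vector_ssub_ldistrib)
        qed
        show "norm (F m w - F n w) \<le> e'" if "w \<in> ball y (r/2)" for w
          using N[of "m + N0" "n + N0" w] that sub[OF y] mn by (auto simp: F_def)
        show "((\<lambda>y. F m y - F n y) has_derivative (\<lambda>v. D m y v - D n y v)) (at y)"
          by (rule dd) (use y xr in blast)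
        show "D m y (c *s v) - D n y (c *s v) = c *s (D m y v - D n y v)" for c v
          using D(2)[of y] y xr by (simp add: vector_ssub_ldistrib subset_iff)
      qed (use r in simp)
      also have "real CARD('m) * (2 * e' / (r/2)) = e" using r by (simp add: e'_def)
      finally show ?thesis .
    qed
    then show ?thesis by blast
  qed
  have conv: "convergent (\<lambda>n. D n y v)" if y: "y \<in> ball x (r/2)" for y v
  proof -
    have "Cauchy (\<lambda>n. D n y v)"
      unfolding Cauchy_def
    proof (intro allI impI)
      fix e :: real assume e: "e > 0"
      define e' where "e' = e / (norm v + 1)"
      have e': "e' > 0" "e' * norm v < e" using e by (auto simp: e'_def field_simps add_pos_nonneg)
      obtain N where N: "\<And>m n. m \<ge> N \<Longrightarrow> n \<ge> N \<Longrightarrow> norm (D m y v - D n y v) \<le> e' * norm v"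
        using Dcau[OF e'(1)] y by blast
      show "\<exists>M. \<forall>m\<ge>M. \<forall>n\<ge>M. dist (D m y v) (D n y v) < e"
        using N e'(2) by (intro exI[of _ N]) (auto simp: dist_norm intro: le_less_trans)
    qed
    then show ?thesis by (rule Cauchy_convergent)
  qed
  define g' where "g' = (\<lambda>y v. lim (\<lambda>n. D n y v))"
  have g': "(\<lambda>n. D n y v) \<longlonglongrightarrow> g' y v" if "y \<in> ball x (r/2)" for y v
    using conv[OF that] by (simp add: g'_def convergent_LIMSEQ_iff)
  have nle: "\<forall>\<^sub>F n in sequentially. \<forall>y\<in>ball x (r/2). \<forall>v. norm (D n y v - g' y v) \<le> e * norm v" if e: "e > 0" for e
  proof -
    obtain N where N: "\<And>m n y v. m \<ge> N \<Longrightarrow> n \<ge> N \<Longrightarrow> y \<in> ball x (r/2) \<Longrightarrow> norm (D m y v - D n y v) \<le> e * norm v"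
      using Dcau[OF e] by blast
    have "norm (D n y v - g' y v) \<le> e * norm v" if "n \<ge> N" "y \<in> ball x (r/2)" for n y v
    proof (rule tendsto_upperbound)
      show "(\<lambda>m. norm (D n y v - D m y v)) \<longlonglongrightarrow> norm (D n y v - g' y v)"
        by (intro tendsto_intros g' that)
      show "\<forall>\<^sub>F m in sequentially. norm (D n y v - D m y v) \<le> e * norm v"
        unfolding eventually_sequentially using N that by blast
    qed simp
    then show ?thesis unfolding eventually_sequentially by blast
  qed
  have fconv: "convergent (\<lambda>n. f n y)" if y: "y \<in> ball x r" for y
  proof (rule Cauchy_convergent, unfold Cauchy_def, intro allI impI)
    fix e :: real assume "e > 0"
    then obtain N where "\<forall>m\<ge>N. \<forall>n\<ge>N. \<forall>y\<in>ball x r. norm (f m y - f n y) \<le> e/2" using cau[of "e/2"] by auto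
    then show "\<exists>M. \<forall>m\<ge>M. \<forall>n\<ge>M. dist (f m y) (f n y) < e"
      using y \<open>e > 0\<close> by (intro exI[of _ N]) (auto simp: dist_norm intro: le_less_trans[of _ "e/2"])
  qed
  let ?g = "\<lambda>y. lim (\<lambda>n. f n y)"
  have flim: "(\<lambda>n. f n y) \<longlonglongrightarrow> ?g y" if "y \<in> ball x r" for y
    using fconv[OF that] by (simp add: convergent_LIMSEQ_iff)
  have Flim: "(\<lambda>n. F n y) \<longlonglongrightarrow> ?g y" if "y \<in> ball x r" for y
    unfolding F_def by (rule LIMSEQ_ignore_initial_segment[OF flim[OF that]])
  have dF: "(F n has_derivative D n y) (at y within ball x (r/2))" if "y \<in> ball x (r/2)" for n y
    by (rule has_derivative_at_withinI[OF D(1)]) (use that xr in blast)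
  have xm: "x \<in> ball x (r/2)" using r by simp
  have "x \<in> ball x r" using r by simp
  from has_derivative_sequence[where S = "ball x (r/2)" and f = F and f' = D and g' = g' and ?x0.0 = x and l = "?g x",
      OF convex_ball dF nle xm Flim[OF this]]
  have "\<exists>g. \<forall>y\<in>ball x (r/2). (\<lambda>n. F n y) \<longlonglongrightarrow> g y \<and> (g has_derivative g' y) (at y within ball x (r/2))"
    by simp
  then obtain g where g: "\<And>y. y \<in> ball x (r/2) \<Longrightarrow> (\<lambda>n. F n y) \<longlonglongrightarrow> g y"
    "\<And>y. y \<in> ball x (r/2) \<Longrightarrow> (g has_derivative g' y) (at y within ball x (r/2))" by blast
  have geq: "g y = ?g y" if "y \<in> ball x (r/2)" for y
    using g(1)[OF that] Flim[of y] that xr LIMSEQ_unique by blast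
  have g'lin: "g' y (c *s v) = c *s g' y v" if y: "y \<in> ball x (r/2)" for y c v
  proof -
    have cs: "(\<lambda>v :: complex ^ 'm. c *s v) = (\<lambda>v. \<chi> i. c * v $ i)" by (simp add: vector_scalar_mult_def)
    have "(\<lambda>n. c *s D n y v) \<longlonglongrightarrow> c *s g' y v"
      unfolding cs vector_scalar_mult_def by (intro tendsto_intros tendsto_vec_lambda g'[OF y])
    moreover have "(\<lambda>n. c *s D n y v) = (\<lambda>n. D n y (c *s v))" using D(2) y xr by fastforce
    ultimately show ?thesis using g'[OF y, of "c *s v"] LIMSEQ_unique by metis
  qed
  show "holomorphic_map_on ?g (ball x (r/2))"
    unfolding holomorphic_map_on_def
  proof
    fix y assume y: "y \<in> ball x (r/2)"
    have "(g has_derivative g' y) (at y)" using g(2)[OF y] at_within_open[OF y open_ball] by simp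
    then have "(?g has_derivative g' y) (at y)"
      by (rule has_derivative_transform_within_open[OF _ open_ball y]) (rule geq)
    then show "\<exists>D. (?g has_derivative D) (at y) \<and> (\<forall>c v. D (c *s v) = c *s D v)" using g'lin[OF y] by blast
  qed
  show "uniform_limit (ball x (r/2)) f ?g sequentially"
    unfolding uniform_limit_iff
  proof (intro allI impI)
    fix e :: real assume e: "e > 0"
    then obtain N where N: "\<And>m n y. m \<ge> N \<Longrightarrow> n \<ge> N \<Longrightarrow> y \<in> ball x r \<Longrightarrow> norm (f m y - f n y) \<le> e/2"
      using cau[OF half_gt_zero[OF e]] by blast
    have norm_le: "norm (f n y - ?g y) \<le> e/2" if "n \<ge> N" "y \<in> ball x r" for n y
    proof (rule tendsto_upperbound)
      show "(\<lambda>m. norm (f n y - f m y)) \<longlonglongrightarrow> norm (f n y - ?g y)"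
        by (intro tendsto_intros flim that)
      show "\<forall>\<^sub>F m in sequentially. norm (f n y - f m y) \<le> e/2"
        unfolding eventually_sequentially using N that by blast
    qed simp
    then have "dist (f n y) (?g y) < e" if "n \<ge> N" "y \<in> ball x (r/2)" for n y
    proof -
      have "norm (f n y - ?g y) \<le> e/2" using norm_le[of n y] that xr by blast
      then show ?thesis using e by (simp add: dist_norm)
    qed
    then show "\<forall>\<^sub>F n in sequentially. \<forall>y\<in>ball x (r/2). dist (f n y) (?g y) < e"
      unfolding eventually_sequentially by blast
  qed
qed

text \<open>
  Domains and bounds are required only from some index on, locally, because the maps to which
  this is applied are defined on exhausting sequences of domains. Cauchy estimates make the
  sequence locally equi-Lipschitz, so convergence on a countable dense set is enough.
\<close>

lemma montel:
  fixes f :: "nat \<Rightarrow> complex ^ 'n \<Rightarrow> complex ^ 'm"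
  assumes loc: "\<And>x. x \<in> W \<Longrightarrow> \<exists>r>0. \<exists>B. ball x r \<subseteq> W \<and>
      (\<forall>\<^sub>F n in sequentially. holomorphic_map_on (f n) (ball x r) \<and> (\<forall>y\<in>ball x r. norm (f n y) \<le> B))"
  obtains k g where "strict_mono (k :: nat \<Rightarrow> nat)" "holomorphic_map_on g W"
    "\<And>x. x \<in> W \<Longrightarrow> \<exists>r>0. ball x r \<subseteq> W \<and> uniform_limit (ball x r) (\<lambda>n. f (k n)) g sequentially"
proof -
  obtain S where S: "countable S" "S \<subseteq> W" "W \<subseteq> closure S" using separable by blast
  have bdS: "\<exists>B. \<forall>\<^sub>F n in sequentially. norm (f n x) \<le> B" if x: "x \<in> S" for x
  proof -
    obtain r B where "r > 0" "\<forall>\<^sub>F n in sequentially. holomorphic_map_on (f n) (ball x r) \<and> (\<forall>y\<in>ball x r. norm (f n y) \<le> B)"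
      using loc[of x] x S(2) by blast
    then show ?thesis by (intro exI[of _ B]) (auto elim: eventually_mono)
  qed
  have "\<exists>k. strict_mono (k::nat\<Rightarrow>nat) \<and> (\<forall>x\<in>S. convergent (\<lambda>n. f (k n) x))"
    by (rule diagonal_subsequence_pointwise[OF S(1)]) (rule bdS)
  then obtain k where k: "strict_mono (k :: nat \<Rightarrow> nat)" "\<And>x. x \<in> S \<Longrightarrow> convergent (\<lambda>n. f (k n) x)"
    by blast
  let ?g = "\<lambda>y. lim (\<lambda>n. f (k n) y)"
  have main: "\<exists>r>0. ball x r \<subseteq> W \<and> holomorphic_map_on ?g (ball x r) \<and> uniform_limit (ball x r) (\<lambda>n. f (k n)) ?g sequentially"
    if x: "x \<in> W" for x
  proof -
    obtain r B where r: "r > 0" "ball x r \<subseteq> W" and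
      ev: "\<forall>\<^sub>F n in sequentially. holomorphic_map_on (f n) (ball x r) \<and> (\<forall>y\<in>ball x r. norm (f n y) \<le> B)"
      using loc[OF x] by blast
    have evk: "\<forall>\<^sub>F n in sequentially. holomorphic_map_on (f (k n)) (ball x r) \<and> (\<forall>y\<in>ball x r. norm (f (k n) y) \<le> B)"
      using eventually_subseq[OF k(1) ev] by simp
    then obtain N0 where N0: "\<And>n. n \<ge> N0 \<Longrightarrow> holomorphic_map_on (f (k n)) (ball x r)"
      "\<And>n y. n \<ge> N0 \<Longrightarrow> y \<in> ball x r \<Longrightarrow> norm (f (k n) y) \<le> B"
      unfolding eventually_sequentially by blast
    define L where "L = \<bar>real CARD('m) * (4 * B / r)\<bar> + 1"
    have L: "L > 0" by (simp add: L_def add_nonneg_pos)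
    have lip: "norm (f (k n) y - f (k n) z) \<le> L * norm (y - z)"
      if "n \<ge> N0" "y \<in> ball x (r/2)" "z \<in> ball x (r/2)" for n y z
    proof -
      have "norm (f (k n) y - f (k n) z) \<le> real CARD('m) * (4 * B / r) * norm (y - z)"
        by (rule holomorphic_map_lipschitz[OF N0(1) r(1) N0(2)]) (use that in auto)
      also have "real CARD('m) * (4 * B / r) \<le> L"
        unfolding L_def by (rule order_trans[OF abs_ge_self]) simp
      then have "real CARD('m) * (4 * B / r) * norm (y - z) \<le> L * norm (y - z)" by (intro mult_right_mono) auto
      finally show ?thesis .
    qed
    have cau: "\<exists>N. \<forall>m\<ge>N. \<forall>n\<ge>N. \<forall>y\<in>ball x (r/4). norm (f (k m) y - f (k n) y) \<le> e" if e: "e > 0" for e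
    proof -
      define d where "d = min (e / (3 * L)) (r/4)"
      have d: "d > 0" "d \<le> r/4" "L * d \<le> e/3"
        using e L r by (auto simp: d_def min_def field_simps)
      have cover: "cball x (r/4) \<subseteq> (\<Union>s\<in>S \<inter> ball x (r/2). ball s d)"
      proof
        fix y assume y: "y \<in> cball x (r/4)"
        then have "y \<in> W" using r by (auto simp: subset_iff)
        then obtain s where s: "s \<in> S" "dist s y < d" using S(3) d(1) closure_approachable by blast
        have "dist x s < r/2" using dist_triangle[of x s y] y s(2) d(2) by (simp add: dist_commute)
        then show "y \<in> (\<Union>s\<in>S \<inter> ball x (r/2). ball s d)" using s by auto
      qed
      obtain C where C: "C \<subseteq> S \<inter> ball x (r/2)" "finite C" "cball x (r/4) \<subseteq> (\<Union>s\<in>C. ball s d)"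
        using compactE_image[OF compact_cball _ cover] by blast
      have "\<forall>s\<in>C. \<exists>N. \<forall>m\<ge>N. \<forall>n\<ge>N. dist (f (k m) s) (f (k n) s) < e/3"
      proof
        fix s assume "s \<in> C"
        then have "Cauchy (\<lambda>n. f (k n) s)" using k(2) C(1) convergent_Cauchy by blast
        then show "\<exists>N. \<forall>m\<ge>N. \<forall>n\<ge>N. dist (f (k m) s) (f (k n) s) < e/3"
          unfolding Cauchy_def using e by (metis divide_pos_pos zero_less_numeral)
      qed
      then obtain N where N: "\<And>s m n. s \<in> C \<Longrightarrow> m \<ge> N s \<Longrightarrow> n \<ge> N s \<Longrightarrow> dist (f (k m) s) (f (k n) s) < e/3"
        by metis
      define M where "M = Max (insert N0 (N ` C))"
      have M: "M \<ge> N0" "\<And>s. s \<in> C \<Longrightarrow> M \<ge> N s" using C(2) by (auto simp: M_def)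
      have "norm (f (k m) y - f (k n) y) \<le> e" if mn: "m \<ge> M" "n \<ge> M" and y: "y \<in> ball x (r/4)" for m n y
      proof -
        have "y \<in> cball x (r/4)" using y by simp
        then obtain s where s: "s \<in> C" "dist s y < d" using C(3) by auto
        have sy: "s \<in> ball x (r/2)" "y \<in> ball x (r/2)" using s C(1) y r by auto
        have ly: "norm (f (k i) y - f (k i) s) \<le> e/3" if "i \<ge> M" for i
        proof -
          have "norm (f (k i) y - f (k i) s) \<le> L * norm (y - s)" using lip[of i y s] that M(1) sy by simp
          also have "\<dots> \<le> L * d" using s(2) L by (intro mult_left_mono) (auto simp: dist_norm norm_minus_commute)
          finally show ?thesis using d(3) by simp
        qed
        have c3: "norm (f (k m) s - f (k n) s) < e/3"
          using N[OF s(1), of m n] M(2)[OF s(1)] mn by (simp add: dist_norm)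
        have "f (k m) y - f (k n) y = (f (k m) y - f (k m) s) + (f (k m) s - f (k n) s) - (f (k n) y - f (k n) s)" by simp
        also have "norm \<dots> \<le> norm (f (k m) y - f (k m) s) + norm (f (k m) s - f (k n) s) + norm (f (k n) y - f (k n) s)"
          by (meson add_mono norm_triangle_ineq norm_triangle_ineq4 order_refl order_trans)
        finally show ?thesis using ly[OF mn(1)] ly[OF mn(2)] c3 by linarith
      qed
      then show ?thesis by blast
    qed
    have hol4: "\<forall>\<^sub>F n in sequentially. holomorphic_map_on (f (k n)) (ball x (r/4))"
      unfolding eventually_sequentially
      by (intro exI[of _ N0] allI impI holomorphic_map_on_subset[OF N0(1)]) (use r in auto)
    have r4: "r/4 > 0" using r by simp
    note u = uniformly_Cauchy_holomorphic_limit[OF r4 hol4 cau]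
    show ?thesis using u r by (intro exI[of _ "r/4/2"]) (auto simp: subset_iff)
  qed
  show thesis
  proof (rule that[OF k(1), of ?g])
    show "holomorphic_map_on ?g W" 
      unfolding holomorphic_map_on_def
    proof
      fix x assume "x \<in> W"
      from main[OF this] obtain r where "r > 0" "holomorphic_map_on ?g (ball x r)" by blast
      then show "\<exists>D. (?g has_derivative D) (at x) \<and> (\<forall>c v. D (c *s v) = c *s D v)"
        by (auto simp: holomorphic_map_on_def)
    qed
  qed (use main in blast)
qed

lemma eventually_on_compact:
  assumes "compact K" "\<And>x. x \<in> K \<Longrightarrow> \<exists>s>0. \<forall>\<^sub>F n in F. \<forall>y\<in>ball x s. P n y"
  shows "\<forall>\<^sub>F n in F. \<forall>y\<in>K. P n y"
proof -
  obtain s where s: "\<And>x. x \<in> K \<Longrightarrow> s x > 0" "\<And>x. x \<in> K \<Longrightarrow> \<forall>\<^sub>F n in F. \<forall>y\<in>ball x (s x). P n y"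
    using assms(2) by metis
  have "K \<subseteq> (\<Union>x\<in>K. ball x (s x))" using s(1) by force
  then obtain C where C: "C \<subseteq> K" "finite C" "K \<subseteq> (\<Union>x\<in>C. ball x (s x))"
    using compactE_image[OF assms(1), of K "\<lambda>x. ball x (s x)"] by blast
  have "\<forall>\<^sub>F n in F. \<forall>x\<in>C. \<forall>y\<in>ball x (s x). P n y"
    by (rule eventually_ball_finite[OF C(2)]) (use C(1) s(2) in blast)
  then show ?thesis by eventually_elim (use C(3) in blast)
qed

section \<open>The model: maximum principle and peak function\<close>

text \<open>
  Every homogeneous subharmonic polynomial without harmonic terms is of this kind.
\<close>

locale supported_model =
  fixes H :: "complex \<Rightarrow> real"
  assumes contH: "continuous_on UNIV H" and suppH: "z \<noteq> 0 \<Longrightarrow> supported_at H z"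
begin

definition \<rho> :: "complex ^ 2 \<Rightarrow> real" where "\<rho> y = Re (y $ 2) + H (y $ 1)"

lemma model_iff: "y \<in> model H \<longleftrightarrow> \<rho> y < 0"
  by (simp add: model_def \<rho>_def)

lemma continuous_on_\<rho>: "continuous_on S \<rho>"
  unfolding \<rho>_def by (intro continuous_intros continuous_on_compose2[OF contH]) auto

lemma open_model: "open (model H)"
proof -
  have "model H = {y. \<rho> y < 0}" by (auto simp: model_iff)
  then show ?thesis using open_Collect_less[OF continuous_on_\<rho> continuous_on_const] by metis
qed

text \<open>
  On every complex line \<open>\<rho> \<circ> G\<close> is the sum of a harmonic function and \<open>H\<close> composed with a
  holomorphic function, hence satisfies the sub-mean value inequality on all discs. The set
  where it vanishes is therefore open.
\<close>

lemma strong_maximum_principle: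
  fixes G :: "complex ^ 'n \<Rightarrow> complex ^ 2"
  assumes W: "open W" "connected W" and G: "holomorphic_map_on G W"
    and le: "\<And>x. x \<in> W \<Longrightarrow> \<rho> (G x) \<le> 0" and x0: "x0 \<in> W" "\<rho> (G x0) < 0" and x: "x \<in> W"
  shows "\<rho> (G x) < 0"
proof -
  let ?Z = "{x\<in>W. \<rho> (G x) = 0}"
  have cG: "continuous_on W (\<lambda>x. \<rho> (G x))"
    by (rule continuous_on_compose2[OF continuous_on_\<rho> holomorphic_map_on_imp_continuous_on[OF G]]) auto
  have "closedin (top_of_set W) ?Z" by (rule continuous_closedin_preimage_constant[OF cG])
  moreover have "open ?Z"
    unfolding open_contains_ball
  proof
    fix x assume x: "x \<in> ?Z"
    then obtain r where r: "r > 0" "ball x r \<subseteq> W" using W(1) open_contains_ball by blast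
    have "y \<in> ?Z" if y: "y \<in> ball x r" for y
    proof (cases "y = x")
      case False
      define v where "v = y - x"
      define R where "R = r / norm v"
      have v: "v \<noteq> 0" "norm v < r" using False y by (auto simp: v_def dist_norm norm_minus_commute)
      then have R: "R > 1" by (simp add: R_def)
      have inW: "x + \<zeta> *s v \<in> W" if "\<zeta> \<in> ball 0 R" for \<zeta>
      proof -
        have "norm (\<zeta> *s v) < r" using that v by (simp add: norm_vector_smult R_def field_simps)
        then show ?thesis using r(2) by (auto simp: dist_norm subset_iff)
      qed
      let ?k = "\<lambda>\<zeta>. G (x + \<zeta> *s v)"
      have hol: "(\<lambda>\<zeta>. ?k \<zeta> $ i) holomorphic_on ball 0 R" for i
        by (rule holomorphic_map_on_line[OF G open_ball inW])
      let ?u = "\<lambda>\<zeta>. H (?k \<zeta> $ 1) + Re (?k \<zeta> $ 2)"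
      have u: "?u \<zeta> = \<rho> (?k \<zeta>)" for \<zeta> by (simp add: \<rho>_def)
      have cb: "cball 0 1 \<subseteq> ball (0::complex) R" using R by auto
      have cu: "continuous_on (cball 0 1) ?u"
        unfolding u by (rule continuous_on_compose2[OF cG continuous_on_line]) (use inW cb in auto)
      have sub: "submean_at ?u w" if "w \<in> ball 0 1 - {0}" for w
        by (rule submean_at_compose_supported[OF contH suppH hol hol open_ball]) (use that R in auto)
      have "?u 0 \<le> circle_mean ?u 0 1" by (rule submean_disc[OF cu _ sub]) auto
      moreover have "?u 0 = 0" unfolding u using x by simp
      ultimately have "0 \<le> circle_mean ?u 0 1" by simp
      then have "?u (0 + of_real 1 * cis 0) = 0"
        by (intro circle_mean_attains_bound continuous_on_subset[OF cu])
           (use le inW R in \<open>auto simp: u\<close>)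
      then have "\<rho> (G (x + v)) = 0" by (simp add: \<rho>_def add.commute)
      then show ?thesis using r(2) y by (auto simp: v_def)
    qed (use x in simp)
    then show "\<exists>e>0. ball x e \<subseteq> ?Z" using r(1) by blast
  qed
  then have "openin (top_of_set W) ?Z" by (intro open_subset) auto
  ultimately have "?Z = {} \<or> ?Z = W" using W(2) connected_clopen by blast
  then show ?thesis using x0 x le[OF x] by force
qed

end

locale peaked_model = supported_model +
  fixes m :: nat and Ht :: "complex \<Rightarrow> real" and \<delta> :: real
  assumes m: "m \<ge> 1" and homogeneous: "H (of_real r * z) = r ^ (2 * m) * H z"
    and \<delta>: "\<delta> > 0" and contHt: "continuous_on UNIV Ht" and Ht0: "Ht 0 = 0"
    and Ht_le: "Ht z \<le> H z - \<delta> * norm z ^ (2 * m)" and suppHt: "z \<noteq> 0 \<Longrightarrow> supported_at Ht z"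
begin

text \<open>
  The holomorphic function \<open>z\<^sub>2 + z\<^sub>2\<^sup>2\<close> in place of \<open>z\<^sub>2\<close> contributes \<open>- (Im z\<^sub>2)\<^sup>2\<close> to the real part,
  without which \<open>\<psi>\<close> would vanish at all points \<open>(0, i t)\<close> of the boundary.
\<close>

definition \<psi> :: "complex ^ 2 \<Rightarrow> real" where
  "\<psi> y = Ht (y $ 1) + Re (y $ 2 + (y $ 2)\<^sup>2)"

lemma continuous_on_\<psi>: "continuous_on S \<psi>"
  unfolding \<psi>_def by (intro continuous_intros continuous_on_compose2[OF contHt]) auto

lemma \<psi>_0: "\<psi> 0 = 0" by (simp add: \<psi>_def Ht0)

lemma H0: "H 0 = 0" using homogeneous[of 0 0] m by (simp add: power_0_left)

lemma H_bound: obtains C where "C > 0" "\<And>z. \<bar>H z\<bar> \<le> C * norm z ^ (2 * m)"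
proof -
  have "compact (H ` sphere 0 1)"
    by (intro compact_continuous_image continuous_on_subset[OF contH]) auto
  then obtain C where C: "C > 0" "\<And>z. z \<in> sphere 0 1 \<Longrightarrow> \<bar>H z\<bar> \<le> C"
    using compact_imp_bounded bounded_pos by (metis image_eqI real_norm_def)
  have "\<bar>H z\<bar> \<le> C * norm z ^ (2 * m)" for z
  proof (cases "z = 0")
    case False
    have "H z = norm z ^ (2 * m) * H (z / of_real (norm z))"
      using homogeneous[of "norm z" "z / of_real (norm z)"] False by simp
    moreover have "\<bar>H (z / of_real (norm z))\<bar> \<le> C" using False by (intro C(2)) (simp add: norm_divide)
    ultimately show ?thesis by (simp add: abs_mult mult.commute mult_right_mono)
  qed (use C(1) in \<open>simp add: H0\<close>)
  then show thesis using that C(1) by blast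
qed

text \<open>
  Where \<open>Re z\<^sub>2 \<le> - H\<close>, monotonicity of \<open>x + x\<^sup>2\<close> near zero gives
  \<open>\<psi> \<le> - H + H\<^sup>2 - (Im z\<^sub>2)\<^sup>2 + Ht \<le> H\<^sup>2 - (Im z\<^sub>2)\<^sup>2 - \<delta> |z\<^sub>1|\<^bsup>2m\<^esup>\<close>, and \<open>H\<^sup>2\<close> is of higher order
  than the last term.
\<close>

lemma peak: "\<exists>R>0. \<forall>y. \<rho> y \<le> 0 \<and> norm y \<le> R \<and> y \<noteq> 0 \<longrightarrow> \<psi> y < 0"
proof -
  obtain C where C: "C > 0" "\<And>z. \<bar>H z\<bar> \<le> C * norm z ^ (2 * m)" using H_bound by blast
  define R where "R = min (1/4) (min (1 / (4 * C)) (\<delta> / (2 * C\<^sup>2)))"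
  have R: "R > 0" "R \<le> 1/4" "R \<le> 1 / (4 * C)" "R \<le> \<delta> / (2 * C\<^sup>2)" using C \<delta> by (auto simp: R_def)
  have "\<psi> y < 0" if y: "\<rho> y \<le> 0" "norm y \<le> R" "y \<noteq> 0" for y
  proof -
    define a where "a = norm (y $ 1) ^ (2 * m)"
    define x where "x = Re (y $ 2)"
    define t where "t = Im (y $ 2)"
    define h where "h = H (y $ 1)"
    have n1: "norm (y $ 1) \<le> R" "norm (y $ 2) \<le> R"
      using y(2) Finite_Cartesian_Product.norm_nth_le order_trans by blast+
    have "a \<le> norm (y $ 1) ^ 1"
      unfolding a_def by (rule power_decreasing) (use m n1 R in auto)
    then have a: "0 \<le> a" "a \<le> R" using n1 by (auto simp: a_def)
    have xr: "\<bar>x\<bar> \<le> 1/4" using abs_Re_le_cmod[of "y $ 2"] n1 R by (simp add: x_def)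
    have h: "\<bar>h\<bar> \<le> C * a" using C(2) by (simp add: h_def a_def)
    also have "C * a \<le> C * (1 / (4 * C))" using a R C by (intro mult_left_mono) auto
    finally have h4: "\<bar>h\<bar> \<le> 1/4" using C by simp
    have xh: "x \<le> - h" using y(1) by (simp add: \<rho>_def x_def h_def)
    have "0 \<le> (- h - x) * (1 - h + x)" using xh xr h4 by (intro mult_nonneg_nonneg) linarith+
    then have quad: "x + x\<^sup>2 \<le> - h + h\<^sup>2" by (simp add: algebra_simps power2_eq_square)
    have \<psi>y: "\<psi> y = Ht (y $ 1) + (x + x\<^sup>2) - t\<^sup>2"
      by (simp add: \<psi>_def x_def t_def power2_eq_square)
    show ?thesis
    proof (cases "y $ 1 = 0")
      case False
      then have ap: "a > 0" by (simp add: a_def)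
      have "h\<^sup>2 \<le> (C * a)\<^sup>2" using h by (simp add: abs_le_square_iff[symmetric])
      also have "\<dots> = C\<^sup>2 * a * a" by (simp add: power2_eq_square)
      also have "\<dots> \<le> C\<^sup>2 * (\<delta> / (2 * C\<^sup>2)) * a"
        using a R C by (intro mult_right_mono mult_left_mono) auto
      also have "\<dots> = \<delta> / 2 * a" using C by simp
      finally have "h\<^sup>2 \<le> \<delta> / 2 * a" .
      moreover have "Ht (y $ 1) \<le> h - \<delta> * a" using Ht_le by (simp add: h_def a_def)
      moreover have "\<delta> * a > 0" using \<delta> ap by simp
      moreover have "t\<^sup>2 \<ge> 0" by simp
      ultimately show ?thesis using quad \<psi>y by linarith
    next
      case True
      then have "h = 0" by (simp add: h_def H0)
      have nz: "y $ 2 \<noteq> 0" using True y(3) by (metis exhaust_2 vec_eq_iff zero_index)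
      have \<psi>2: "\<psi> y = x * (1 + x) - t\<^sup>2" using \<psi>y True by (simp add: Ht0 algebra_simps power2_eq_square)
      have xneg: "x * (1 + x) \<le> 0" using xh \<open>h = 0\<close> xr by (intro mult_nonpos_nonneg) auto
      show ?thesis
      proof (cases "x = 0")
        case True
        then have "t \<noteq> 0" using nz by (simp add: x_def t_def complex_eq_iff)
        then show ?thesis using \<psi>2 True by simp
      next
        case False
        then have "x < 0" using xh \<open>h = 0\<close> by simp
        then have "x * (1 + x) < 0" using xr by (intro mult_neg_pos) auto
        then show ?thesis using \<psi>2 zero_le_power2[of t] by linarith
      qed
    qed
  qed
  then show ?thesis using R(1) by blast
qed

end

section \<open>Attraction of analytic discs\<close>

text \<open>
  The smaller disc has a radius that does not depend on \<open>r\<close>; the radius \<open>1/100\<close> comes from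
  the lemma \<open>milloux\<close>.
\<close>

definition attracts_discs :: "(complex ^ 2) set \<Rightarrow> complex ^ 2 \<Rightarrow> bool" where
  "attracts_discs \<Omega> p \<longleftrightarrow> (\<forall>r>0. \<exists>r'>0. \<forall>k.
     (\<forall>i. (\<lambda>\<zeta>. k \<zeta> $ i) holomorphic_on ball 0 1) \<and> k ` ball 0 1 \<subseteq> \<Omega> \<and> dist (k 0) p < r' \<longrightarrow>
     (\<forall>\<zeta>. norm \<zeta> \<le> 1/100 \<longrightarrow> dist (k \<zeta>) p < r))"

context peaked_model begin

text \<open>
  The homeomorphic extension of \<open>\<Phi>\<close> is what localizes: points of \<open>U \<inter> \<Omega>\<close> with small image are
  close to \<open>p\<close>, and conversely. So \<open>\<psi> \<circ> \<Phi>\<close>, cut off from below at a level \<open>- c\<close> that it only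
  exceeds where \<open>\<Phi>\<close> is small, extends by \<open>- c\<close> to a function \<open>\<phi>\<close> on all of \<open>\<Omega>\<close>. Along an
  analytic disc \<open>\<phi>\<close> has the properties of \<open>u\<close> in the lemma \<open>milloux\<close>; since \<open>\<phi>\<close> tends to zero
  at \<open>p\<close>, the conclusion of that lemma fails for discs with centre close to \<open>p\<close>.
\<close>

lemma condition_M_attracts_discs:
  assumes \<Omega>: "open \<Omega>" "p \<in> closure \<Omega>" and cond: "condition_M H \<Omega> p U V \<Phi>"
  shows "attracts_discs \<Omega> p"
  unfolding attracts_discs_def
proof (intro allI impI)
  fix r :: real assume r: "r > 0"
  have U: "open U" "p \<in> U" and bih: "biholomorphic_map (U \<inter> \<Omega>) (V \<inter> model H) \<Phi>" and \<Phi>p: "\<Phi> p = 0"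
    using cond by (auto simp: condition_M_def)
  obtain \<Psi> where hom: "homeomorphism (U \<inter> closure \<Omega>) (\<Phi> ` (U \<inter> closure \<Omega>)) \<Phi> \<Psi>"
    using cond by (auto simp: condition_M_def)
  have c\<Phi>: "continuous_on (U \<inter> closure \<Omega>) \<Phi>" and c\<Psi>: "continuous_on (\<Phi> ` (U \<inter> closure \<Omega>)) \<Psi>"
    and \<Psi>\<Phi>: "\<And>z. z \<in> U \<inter> closure \<Omega> \<Longrightarrow> \<Psi> (\<Phi> z) = z"
    using hom by (auto simp: homeomorphism_def)
  have hol\<Phi>: "holomorphic_map_on \<Phi> (U \<inter> \<Omega>)" and im\<Phi>: "\<And>z. z \<in> U \<inter> \<Omega> \<Longrightarrow> \<Phi> z \<in> model H"
    using bih by (auto simp: biholomorphic_map_def bij_betw_def)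
  have oU\<Omega>: "open (U \<inter> \<Omega>)" using U \<Omega> by blast
  have c\<Phi>\<Omega>: "continuous_on (U \<inter> \<Omega>) \<Phi>" by (rule holomorphic_map_on_imp_continuous_on[OF hol\<Phi>])
  have pcl: "p \<in> U \<inter> closure \<Omega>" using U \<Omega> by blast
  obtain r1 where r1: "r1 > 0" "cball p r1 \<subseteq> U" using U open_contains_cball by blast
  \<comment> \<open>the polydisc of radius \<open>r0\<close> lies in the ball of radius \<open>2 * r0 < min r r1\<close>\<close>
  define r0 where "r0 = min r r1 / 3"
  have r0: "r0 > 0" "r0 \<le> r1" using r r1 by (auto simp: r0_def)
  have box: "dist z p < r" if "\<And>i. cmod (z $ i - p $ i) < r0" for z
  proof -
    have "norm (z - p) \<le> real CARD(2) * r0"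
      by (rule norm_le_card_component) (use that less_imp_le in auto)
    then show ?thesis using r r1 by (simp add: dist_norm r0_def)
  qed
  obtain R0 where R0: "R0 > 0" "\<And>y. \<rho> y \<le> 0 \<Longrightarrow> norm y \<le> R0 \<Longrightarrow> y \<noteq> 0 \<Longrightarrow> \<psi> y < 0"
    using peak by blast
  obtain R' where R': "R' > 0" "\<And>z. z \<in> U \<inter> closure \<Omega> \<Longrightarrow> norm (\<Phi> z) < R' \<Longrightarrow> dist z p < r0"
  proof -
    have "\<Phi> p \<in> \<Phi> ` (U \<inter> closure \<Omega>)" using pcl by blast
    then obtain d where d: "d > 0" "\<forall>y\<in>\<Phi> ` (U \<inter> closure \<Omega>). dist y (\<Phi> p) < d \<longrightarrow> dist (\<Psi> y) (\<Psi> (\<Phi> p)) < r0"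
      using c\<Psi> r0(1) unfolding continuous_on_iff by blast
    show thesis
    proof (rule that[OF d(1)])
      fix z assume "z \<in> U \<inter> closure \<Omega>" "norm (\<Phi> z) < d"
      then show "dist z p < r0" using d(2) \<Psi>\<Phi> pcl \<Phi>p by (metis dist_0_norm dist_commute imageI)
    qed
  qed
  define R where "R = min R0 R'"
  have R: "R > 0" "R \<le> R0" "R \<le> R'" using R0 R' by (auto simp: R_def)
  \<comment> \<open>on this compact shell the peak function is below a negative constant\<close>
  let ?A = "{y. R / 2 \<le> norm y \<and> norm y \<le> R \<and> \<rho> y \<le> 0}"
  obtain c where c: "c > 0" "\<And>y. y \<in> ?A \<Longrightarrow> \<psi> y \<le> - c"
  proof (cases "?A = {}")
    case True
    then show thesis using that[of 1] by auto
  next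
    case False
    have "?A = cball 0 R \<inter> ({y. R / 2 \<le> norm y} \<inter> {y. \<rho> y \<le> 0})" by auto
    moreover have "closed {y :: complex ^ 2. R / 2 \<le> norm y}" "closed {y. \<rho> y \<le> 0}"
      by (intro closed_Collect_le continuous_intros continuous_on_\<rho>)+
    ultimately have "compact ?A" by (metis compact_cball compact_Int_closed closed_Int)
    then obtain y where y: "y \<in> ?A" "\<And>x. x \<in> ?A \<Longrightarrow> \<psi> x \<le> \<psi> y"
      using continuous_attains_sup[OF _ False continuous_on_\<psi>] by blast
    have "\<psi> y < 0" using y(1) R by (intro R0(2)) auto
    then show thesis using that[of "- \<psi> y"] y(2) by auto
  qed
  define N where "N = {z\<in>U \<inter> \<Omega>. norm (\<Phi> z) < R}"
  define \<phi> where "\<phi> = (\<lambda>z. if z \<in> N then max (\<psi> (\<Phi> z)) (- c) else - c)"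
  have N_eq: "N = (U \<inter> \<Omega>) \<inter> \<Phi> -` ball 0 R" by (auto simp: N_def)
  have oN: "open N" unfolding N_eq by (rule continuous_open_preimage[OF c\<Phi>\<Omega> oU\<Omega> open_ball])
  have N_near: "dist z p < r0" if "z \<in> N" for z
    using that R(3) closure_subset[of \<Omega>] by (intro R'(2)) (auto simp: N_def)
  have c\<psi>\<Phi>: "continuous_on N (\<lambda>z. \<psi> (\<Phi> z))"
    by (rule continuous_on_compose2[OF continuous_on_\<psi> continuous_on_subset[OF c\<Phi>\<Omega>]]) (auto simp: N_def)
  let ?M = "{z\<in>U \<inter> \<Omega>. norm (\<Phi> z) \<le> R / 2}"
  \<comment> \<open>\<open>?M\<close> is relatively closed in \<open>\<Omega>\<close>, because it lies in a closed ball contained in \<open>U\<close>\<close>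
  have oM: "open (\<Omega> - ?M)"
  proof -
    have "\<Omega> - ?M = (\<Omega> - cball p r1) \<union> ((U \<inter> \<Omega>) \<inter> \<Phi> -` (- cball 0 (R/2)))"
    proof (intro equalityI subsetI)
      fix z assume "z \<in> \<Omega> - ?M"
      then show "z \<in> (\<Omega> - cball p r1) \<union> ((U \<inter> \<Omega>) \<inter> \<Phi> -` (- cball 0 (R/2)))" using r1(2) by auto
    next
      fix z assume z: "z \<in> (\<Omega> - cball p r1) \<union> ((U \<inter> \<Omega>) \<inter> \<Phi> -` (- cball 0 (R/2)))"
      have "z \<in> cball p r1" if "z \<in> ?M"
      proof -
        have "z \<in> N" using that R by (auto simp: N_def)
        then show ?thesis using N_near r0 by (fastforce simp: dist_commute)
      qed
      then show "z \<in> \<Omega> - ?M" using z by auto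
    qed
    moreover have "open ((U \<inter> \<Omega>) \<inter> \<Phi> -` (- cball 0 (R/2)))"
      by (rule continuous_open_preimage[OF c\<Phi>\<Omega> oU\<Omega>]) auto
    ultimately show ?thesis using \<Omega>(1) by (simp add: open_Diff open_Un)
  qed
  have \<phi>M: "\<phi> z = - c" if "z \<in> \<Omega> - ?M" for z
  proof (cases "z \<in> N")
    case True
    have "z \<in> U \<inter> \<Omega>" "norm (\<Phi> z) < R" using True by (auto simp: N_def)
    moreover have "\<rho> (\<Phi> z) < 0" using im\<Phi>[OF \<open>z \<in> U \<inter> \<Omega>\<close>] by (simp add: model_iff)
    ultimately have "\<psi> (\<Phi> z) \<le> - c" using that by (intro c(2)) auto
    then show ?thesis by (simp add: \<phi>_def)
  qed (simp add: \<phi>_def)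
  have c\<phi>: "continuous_on \<Omega> \<phi>"
  proof -
    have "continuous_on N \<phi>"
      by (rule continuous_on_eq[of N "\<lambda>z. max (\<psi> (\<Phi> z)) (- c)"]) (auto intro!: continuous_intros c\<psi>\<Phi> simp: \<phi>_def)
    moreover have "continuous_on (\<Omega> - ?M) \<phi>"
      by (rule continuous_on_eq[of _ "\<lambda>z. - c"]) (use \<phi>M in auto)
    ultimately have "continuous_on (N \<union> (\<Omega> - ?M)) \<phi>" by (rule continuous_on_open_Un[OF oN oM])
    then show ?thesis by (rule continuous_on_subset) (use R in \<open>auto simp: N_def\<close>)
  qed
  have \<phi>lo: "- c \<le> \<phi> z" for z by (simp add: \<phi>_def)
  have \<psi>neg: "\<psi> (\<Phi> z) \<le> 0" if "z \<in> N" for z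
  proof (cases "\<Phi> z = 0")
    case False
    have "z \<in> U \<inter> \<Omega>" "norm (\<Phi> z) < R" using that by (auto simp: N_def)
    then have "\<psi> (\<Phi> z) < 0" using im\<Phi>[of z] R False by (intro R0(2)) (auto simp: model_iff)
    then show ?thesis by simp
  qed (simp add: \<psi>_0)
  have \<phi>up: "\<phi> z \<le> 0" for z using \<psi>neg[of z] c(1) by (simp add: \<phi>_def)
  obtain r' where r': "r' > 0" "\<And>z. z \<in> \<Omega> \<Longrightarrow> dist z p < r' \<Longrightarrow> \<phi> z > - c / 3"
  proof -
    have "isCont \<psi> 0" using continuous_on_\<psi>[of UNIV] by (simp add: continuous_on_eq_continuous_at)
    then obtain d where d: "d > 0" "\<And>y. dist y 0 < d \<Longrightarrow> dist (\<psi> y) (\<psi> 0) < c / 3"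
      unfolding continuous_at_eps_delta using c(1) by (metis divide_pos_pos zero_less_numeral)
    have "min d R > 0" using d R by simp
    then obtain e where e: "e > 0" "\<And>z. z \<in> U \<inter> closure \<Omega> \<Longrightarrow> dist z p < e \<Longrightarrow> dist (\<Phi> z) (\<Phi> p) < min d R"
      using c\<Phi> pcl unfolding continuous_on_iff by metis
    show thesis
    proof (rule that[of "min e r1"])
      fix z assume z: "z \<in> \<Omega>" "dist z p < min e r1"
      then have zU: "z \<in> U" using r1(2) by (auto simp: subset_iff dist_commute)
      have "norm (\<Phi> z) < min d R" using e(2)[of z] z zU closure_subset[of \<Omega>] \<Phi>p by auto
      then have "z \<in> N" "\<bar>\<psi> (\<Phi> z)\<bar> < c / 3" using z zU d(2)[of "\<Phi> z"] by (auto simp: N_def \<psi>_0)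
      then show "\<phi> z > - c / 3" by (auto simp: \<phi>_def abs_less_iff)
    qed (use e r1 in simp)
  qed
  show "\<exists>r'>0. \<forall>k. (\<forall>i. (\<lambda>\<zeta>. k \<zeta> $ i) holomorphic_on ball 0 1) \<and> k ` ball 0 1 \<subseteq> \<Omega> \<and> dist (k 0) p < r' \<longrightarrow>
     (\<forall>\<zeta>. norm \<zeta> \<le> 1/100 \<longrightarrow> dist (k \<zeta>) p < r)"
  proof (intro exI[of _ r'] conjI allI impI r'(1), elim conjE)
    fix k :: "complex \<Rightarrow> complex ^ 2" and \<zeta> :: complex
    assume k: "\<forall>i. (\<lambda>\<zeta>. k \<zeta> $ i) holomorphic_on ball 0 1" "k ` ball 0 1 \<subseteq> \<Omega>" "dist (k 0) p < r'"
      and \<zeta>: "norm \<zeta> \<le> 1/100"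
    have kc: "continuous_on (ball 0 1) k"
    proof -
      have "continuous_on (ball 0 1) (\<lambda>z. \<chi> i. k z $ i)"
        by (rule continuous_on_vec_lambda) (use k(1) holomorphic_on_imp_continuous_on in blast)
      then show ?thesis by simp
    qed
    have box\<zeta>: "\<forall>i. cmod (k \<zeta> $ i - p $ i) < r0"
    proof (rule ccontr)
      assume no: "\<not> ?thesis"
      have "(\<lambda>z. \<phi> (k z)) 0 \<le> - c / 3"
      proof (rule milloux[where u = "\<lambda>z. \<phi> (k z)" and k = k and p = p and r = r0 and ?z0.0 = \<zeta>, OF c(1)])
        show "cmod \<zeta> \<le> 1/100" "\<not> (\<forall>i. cmod (k \<zeta> $ i - p $ i) < r0)" by (fact \<zeta>, fact no)
        show "- c \<le> \<phi> (k z)" "\<phi> (k z) \<le> 0" for z by (rule \<phi>lo, rule \<phi>up)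
        show "continuous_on (ball 0 1) (\<lambda>z. \<phi> (k z))"
          by (rule continuous_on_compose2[OF c\<phi> kc k(2)])
        show "(\<lambda>z. k z $ i) holomorphic_on ball 0 1" for i using k(1) by blast
        show "\<phi> (k z) = - c" if "\<not> (\<forall>i. cmod (k z $ i - p $ i) < r0)" for z
        proof -
          have "k z \<notin> N"
          proof
            assume "k z \<in> N"
            then have "norm (k z - p) < r0" using N_near by (simp add: dist_norm)
            then show False using that Finite_Cartesian_Product.norm_nth_le[of "k z - p"] by (metis le_less_trans vector_minus_component)
          qed
          then show ?thesis by (simp add: \<phi>_def)
        qed
        fix g \<sigma> e assume e: "e > 0" and g: "g holomorphic_on ball \<sigma> e" "g ` ball \<sigma> e \<subseteq> ball 0 1" and gt: "\<phi> (k (g \<sigma>)) > - c"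
        let ?N3 = "N \<inter> (\<lambda>z. \<psi> (\<Phi> z)) -` {- c<..}"
        have o3: "open ?N3" by (rule continuous_open_preimage[OF c\<psi>\<Phi> oN]) simp
        have in3: "k (g \<sigma>) \<in> ?N3" using gt by (auto simp: \<phi>_def split: if_splits)
        have ckg: "continuous_on (ball \<sigma> e) (\<lambda>w. k (g w))"
          by (rule continuous_on_compose2[OF kc holomorphic_on_imp_continuous_on[OF g(1)] g(2)])
        have "open (ball \<sigma> e \<inter> (\<lambda>w. k (g w)) -` ?N3)"
          by (rule continuous_open_preimage[OF ckg open_ball o3])
        moreover have "\<sigma> \<in> ball \<sigma> e \<inter> (\<lambda>w. k (g w)) -` ?N3" using in3 e by simp
        ultimately obtain d where d: "d > 0" "ball \<sigma> d \<subseteq> ball \<sigma> e \<inter> (\<lambda>w. k (g w)) -` ?N3"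
          using open_contains_ball by blast
        have gd: "g holomorphic_on ball \<sigma> d" "g ` ball \<sigma> d \<subseteq> ball 0 1" using g d by (auto intro: holomorphic_on_subset)
        have kg: "(\<lambda>w. k (g w) $ j) holomorphic_on ball \<sigma> d" for j
          using holomorphic_on_compose_gen[OF gd(1) spec[OF k(1), of j] gd(2)] by (simp add: o_def)
        have Y: "(\<lambda>w. \<Phi> (k (g w)) $ j) holomorphic_on ball \<sigma> d" for j
          by (rule holomorphic_curve_compose[OF hol\<Phi> kg open_ball]) (use d(2) in \<open>auto simp: N_def\<close>)
        have "submean_at (\<lambda>w. Ht (\<Phi> (k (g w)) $ 1) + Re (\<Phi> (k (g w)) $ 2 + (\<Phi> (k (g w)) $ 2)\<^sup>2)) \<sigma>"
          by (rule submean_at_compose_supported[OF contHt suppHt Y _ open_ball])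
             (use d(1) in \<open>auto intro!: holomorphic_intros Y\<close>)
        then show "submean_at (\<lambda>w. \<phi> (k (g w))) \<sigma>"
        proof (rule submean_at_cong[OF _ d(1)])
          fix w assume "w \<in> ball \<sigma> d"
          then have "k (g w) \<in> N" "\<psi> (\<Phi> (k (g w))) > - c" using d(2) by auto
          then show "Ht (\<Phi> (k (g w)) $ 1) + Re (\<Phi> (k (g w)) $ 2 + (\<Phi> (k (g w)) $ 2)\<^sup>2) = \<phi> (k (g w))"
            by (simp add: \<phi>_def \<psi>_def)
        qed
      qed
      moreover have "k 0 \<in> \<Omega>" using k(2) by auto
      ultimately show False using r'(2)[of "k 0"] k(3) by simp
    qed
    show "dist (k \<zeta>) p < r" by (rule box) (use box\<zeta> in blast)
  qed
qed

end

text \<open>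
  The set of points at which \<open>h\<close> converges to \<open>p\<close> is open and relatively closed, by attraction of
  discs in complex lines. Base points and domains may vary with the index.
\<close>

lemma attraction_locally_uniform:
  fixes h :: "nat \<Rightarrow> complex ^ 'n \<Rightarrow> complex ^ 2"
  assumes att: "attracts_discs \<Omega> p" and W: "open W" "connected W"
    and h: "\<And>n. holomorphic_map_on (h n) (D n)" "\<And>n. h n ` D n \<subseteq> \<Omega>"
    and D: "\<And>K. compact K \<Longrightarrow> K \<subseteq> W \<Longrightarrow> \<forall>\<^sub>F n in sequentially. K \<subseteq> D n"
    and w: "w \<longlonglongrightarrow> w0" "w0 \<in> W" "(\<lambda>n. h n (w n)) \<longlonglongrightarrow> p"
    and K: "compact K" "K \<subseteq> W" and r: "r > 0"
  shows "\<forall>\<^sub>F n in sequentially. \<forall>x\<in>K. dist (h n x) p < r"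
proof -
  \<comment> \<open>for \<open>y\<close> within \<open>s / 400\<close> of \<open>a\<close>, the disc \<open>b n + \<zeta> * 100 (y - b n)\<close> stays within \<open>s\<close> of \<open>a\<close>
      and passes through \<open>y\<close> at \<open>\<zeta> = 1/100\<close>\<close>
  have step: "\<forall>\<^sub>F n in sequentially. \<forall>y\<in>ball a (s / 400). dist (h n y) p < r"
    if b: "b \<longlonglongrightarrow> a" "(\<lambda>n. h n (b n)) \<longlonglongrightarrow> p" and s: "s > 0" "cball a s \<subseteq> W" and r: "r > 0" for b a s r
  proof -
    obtain r' where r': "r' > 0" "\<And>k. (\<forall>i. (\<lambda>\<zeta>. k \<zeta> $ i) holomorphic_on ball 0 1) \<Longrightarrow> k ` ball 0 1 \<subseteq> \<Omega> \<Longrightarrow>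
        dist (k 0) p < r' \<Longrightarrow> (\<forall>\<zeta>. norm \<zeta> \<le> 1/100 \<longrightarrow> dist (k \<zeta>) p < r)"
      using att r unfolding attracts_discs_def by meson
    have "\<forall>\<^sub>F n in sequentially. dist (b n) a < s / 400" using b(1) s(1) by (intro tendstoD) auto
    moreover have "\<forall>\<^sub>F n in sequentially. dist (h n (b n)) p < r'" using b(2) r'(1) by (intro tendstoD) auto
    moreover have "\<forall>\<^sub>F n in sequentially. cball a s \<subseteq> D n" by (rule D) (use s in auto)
    ultimately show ?thesis
    proof eventually_elim
      case (elim n)
      show ?case
      proof
        fix y assume y: "y \<in> ball a (s / 400)"
        define v where "v = 100 *s (y - b n)"
        have "dist y (b n) < s / 200" using y elim(1) dist_triangle[of y "b n" a] by (simp add: dist_commute)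
        moreover have "norm v = 100 * norm (y - b n)" unfolding v_def norm_vector_smult by simp
        ultimately have v: "norm v \<le> s / 2" by (simp add: dist_norm)
        have inD: "b n + \<zeta> *s v \<in> D n" if "\<zeta> \<in> ball 0 1" for \<zeta>
        proof -
          have "norm (\<zeta> *s v) \<le> 1 * (s / 2)" unfolding norm_vector_smult using that v by (intro mult_mono) auto
          then have "dist (b n) (b n + \<zeta> *s v) \<le> s / 2" by (simp add: dist_norm)
          then have "dist a (b n + \<zeta> *s v) \<le> s"
            using elim(1) s(1) dist_triangle[of a "b n + \<zeta> *s v" "b n"] by (simp add: dist_commute)
          then show ?thesis using elim(3) by auto
        qed
        have "\<forall>\<zeta>. norm \<zeta> \<le> 1/100 \<longrightarrow> dist (h n (b n + \<zeta> *s v)) p < r"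
        proof (rule r'(2))
          show "\<forall>i. (\<lambda>\<zeta>. h n (b n + \<zeta> *s v) $ i) holomorphic_on ball 0 1"
            using holomorphic_map_on_line[OF h(1) open_ball inD] by blast
          show "(\<lambda>\<zeta>. h n (b n + \<zeta> *s v)) ` ball 0 1 \<subseteq> \<Omega>" using h(2) inD by blast
          show "dist (h n (b n + 0 *s v)) p < r'" using elim(2) by simp
        qed
        from spec[OF this, of "1/100"] show "dist (h n y) p < r" by (simp add: v_def)
      qed
    qed
  qed
  have stepc: "(\<lambda>n. h n y) \<longlonglongrightarrow> p" if "b \<longlonglongrightarrow> a" "(\<lambda>n. h n (b n)) \<longlonglongrightarrow> p" "s > 0" "cball a s \<subseteq> W" "y \<in> ball a (s / 400)" for b a s y
  proof (rule tendstoI)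
    fix r :: real assume "r > 0"
    from step[OF that(1-4) this] show "\<forall>\<^sub>F n in sequentially. dist (h n y) p < r"
      by eventually_elim (use that(5) in blast)
  qed
  let ?G = "{x\<in>W. (\<lambda>n. h n x) \<longlonglongrightarrow> p}"
  have stepG: "ball a (s / 400) \<subseteq> ?G" if "a \<in> ?G" "s > 0" "cball a s \<subseteq> W" for a s
  proof
    fix y assume y: "y \<in> ball a (s / 400)"
    have "(\<lambda>n. h n y) \<longlonglongrightarrow> p" by (rule stepc[of "\<lambda>_. a" a, OF tendsto_const _ that(2,3) y]) (use that(1) in simp)
    moreover have "y \<in> cball a s" using y that(2) by simp
    ultimately show "y \<in> ?G" using that(3) by blast
  qed
  have "open ?G"
    unfolding open_contains_ball
  proof
    fix x assume x: "x \<in> ?G"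
    then obtain s where "s > 0" "cball x s \<subseteq> W" using W(1) open_contains_cball by blast
    then show "\<exists>e>0. ball x e \<subseteq> ?G" using stepG[OF x] by (intro exI[of _ "s / 400"]) auto
  qed
  moreover have "W \<inter> closure ?G \<subseteq> ?G"
  proof
    fix x assume x: "x \<in> W \<inter> closure ?G"
    then obtain s where s: "s > 0" "cball x s \<subseteq> W" using W(1) open_contains_cball by blast
    obtain a where a: "a \<in> ?G" "dist a x < s / 1000" using x s(1) closure_approachable[of x ?G] by (metis (no_types, lifting) IntD2 divide_pos_pos zero_less_numeral)
    have "cball a (s / 2) \<subseteq> W"
    proof
      fix y assume "y \<in> cball a (s / 2)"
      then have "dist x y \<le> s" using a(2) dist_triangle[of x y a] s(1) by (simp add: dist_commute)
      then show "y \<in> W" using s(2) by auto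
    qed
    then have "ball a (s / 2 / 400) \<subseteq> ?G" by (rule stepG[OF a(1) half_gt_zero[OF s(1)]])
    then show "x \<in> ?G" using a(2) s(1) by (auto simp: subset_iff)
  qed
  then have "closedin (top_of_set W) ?G"
    unfolding closedin_closed by (intro exI[of _ "closure ?G"]) (use closure_subset[of ?G] in auto)
  moreover have "w0 \<in> ?G"
  proof -
    obtain s where s: "s > 0" "cball w0 s \<subseteq> W" using W(1) w(2) open_contains_cball by blast
    show ?thesis using stepc[OF w(1,3) s, of w0] s(1) w(2) by simp
  qed
  ultimately have GW: "?G = W"
    using W(2) open_subset[of ?G W] connected_clopen[of W] by blast
  show ?thesis
  proof (rule eventually_on_compact[OF K(1)])
    fix x assume "x \<in> K"
    then have x: "x \<in> W" "(\<lambda>n. h n x) \<longlonglongrightarrow> p" using K(2) GW by blast+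
    obtain s where s: "s > 0" "cball x s \<subseteq> W" using W(1) x(1) open_contains_cball by blast
    show "\<exists>s>0. \<forall>\<^sub>F n in sequentially. \<forall>y\<in>ball x s. dist (h n y) p < r"
      using step[OF tendsto_const x(2) s r] s(1) by (intro exI[of _ "s / 400"]) auto
  qed
qed

section \<open>Automorphisms of the model\<close>

lemma frequently_subsequence:
  assumes "\<And>j::nat. \<exists>\<^sub>F n in sequentially. P j n"
  shows "\<exists>s. strict_mono (s :: nat \<Rightarrow> nat) \<and> (\<forall>j. P j (s j))"
proof -
  have ex: "\<exists>n>m. P j n" for j m
    using assms[of j] unfolding frequently_sequentially by (metis Suc_le_eq)
  have "\<exists>s. \<forall>j. P j (s j) \<and> s j < s (Suc j)"
  proof (rule dependent_nat_choice)
    show "\<exists>x. P 0 x" using ex by blast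
  qed (use ex in blast)
  then show ?thesis using strict_mono_Suc_iff by blast
qed

lemma locally_uniform_limit_tendsto:
  fixes g :: "'a::metric_space \<Rightarrow> 'b::metric_space"
  assumes u: "uniform_limit (ball x r) u g sequentially" "r > 0" and g: "isCont g x" and z: "z \<longlonglongrightarrow> x"
  shows "(\<lambda>n. u n (z n)) \<longlonglongrightarrow> g x"
proof (rule tendstoI)
  fix e :: real assume e: "e > 0"
  have "\<forall>\<^sub>F n in sequentially. \<forall>y\<in>ball x r. dist (u n y) (g y) < e/2"
    by (rule uniform_limitD[OF u(1) half_gt_zero[OF e]])
  moreover have "\<forall>\<^sub>F n in sequentially. dist (z n) x < r" using z u(2) by (rule tendstoD)
  moreover have "\<forall>\<^sub>F n in sequentially. dist (g (z n)) (g x) < e/2"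
    using isCont_tendsto_compose[OF g z] half_gt_zero[OF e] by (rule tendstoD)
  ultimately show "\<forall>\<^sub>F n in sequentially. dist (u n (z n)) (g x) < e"
  proof eventually_elim
    case (elim n)
    then have "dist (u n (z n)) (g (z n)) < e/2" by (simp add: dist_commute)
    then show ?case using elim(3) dist_triangle[of "u n (z n)" "g x" "g (z n)"] by linarith
  qed
qed

lemma holomorphic_map_on_imp_isCont: "holomorphic_map_on g W \<Longrightarrow> x \<in> W \<Longrightarrow> isCont g x"
  unfolding holomorphic_map_on_def using has_derivative_continuous by blast

definition diagonal_affine :: "complex \<Rightarrow> complex \<Rightarrow> complex \<Rightarrow> complex ^ 2 \<Rightarrow> complex ^ 2" where
  "diagonal_affine a b c y = (\<chi> i. if i = 1 then a * y $ 1 else b * y $ 2 + c)"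

lemma diagonal_affine_nth [simp]:
  "diagonal_affine a b c y $ 1 = a * y $ 1" "diagonal_affine a b c y $ 2 = b * y $ 2 + c"
  by (simp_all add: diagonal_affine_def)

lemma vec2_eqI: "x $ 1 = y $ 1 \<Longrightarrow> x $ 2 = y $ 2 \<Longrightarrow> x = (y :: complex ^ 2)"
  by (metis exhaust_2 vec_eq_iff)

lemma holomorphic_diagonal_affine: "holomorphic_map_on (diagonal_affine a b c) S"
  unfolding holomorphic_map_on_def
proof
  fix x :: "complex ^ 2"
  have "(diagonal_affine a b c has_derivative diagonal_affine a b 0) (at x)"
  proof (rule has_derivative_vec_componentwise)
    fix i :: 2
    have "((\<lambda>y. a * y $ 1) has_derivative (\<lambda>h. a * h $ 1)) (at x)" "((\<lambda>y. b * y $ 2 + c) has_derivative (\<lambda>h. b * h $ 2)) (at x)"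
      by (auto intro!: derivative_eq_intros bounded_linear_imp_has_derivative[OF bounded_linear_vec_nth])
    then show "((\<lambda>x. diagonal_affine a b c x $ i) has_derivative (\<lambda>h. diagonal_affine a b 0 h $ i)) (at x)"
      using exhaust_2[of i] by auto
  qed
  moreover have "diagonal_affine a b 0 (t *s v) = t *s diagonal_affine a b 0 v" for t v
    by (rule vec2_eqI) auto
  ultimately show "\<exists>D. (diagonal_affine a b c has_derivative D) (at x) \<and> (\<forall>c v. D (c *s v) = c *s D v)" by blast
qed

lemma norm_diagonal_affine_le: "norm (diagonal_affine a b c y) \<le> norm a * norm y + norm b * norm y + norm c"
proof -
  have "norm (diagonal_affine a b c y) \<le> norm (a * y $ 1) + norm (b * y $ 2 + c)"
    using norm_le_sum_component[of "diagonal_affine a b c y"] by (simp add: UNIV_2)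
  also have "\<dots> \<le> norm a * norm (y $ 1) + (norm b * norm (y $ 2) + norm c)"
    by (intro add_mono order_trans[OF norm_triangle_ineq]) (auto simp: norm_mult)
  also have "\<dots> \<le> norm a * norm y + (norm b * norm y + norm c)"
    by (intro add_mono mult_left_mono order_refl Finite_Cartesian_Product.norm_nth_le) auto
  finally show ?thesis by simp
qed

context peaked_model begin

text \<open>
  Both are automorphisms of the model: a translation by \<open>\<mp> i t\<close> in the second coordinate combined
  with the dilation by \<open>1 / l\<close> or \<open>l\<close>. They are inverse to each other.
\<close>

definition rescale :: "real \<Rightarrow> real \<Rightarrow> complex ^ 2 \<Rightarrow> complex ^ 2" where
  "rescale l t = diagonal_affine (1 / of_real l) (1 / of_real (l ^ (2*m))) (- \<i> * of_real t / of_real (l ^ (2*m)))"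

definition unscale :: "real \<Rightarrow> real \<Rightarrow> complex ^ 2 \<Rightarrow> complex ^ 2" where
  "unscale l t = diagonal_affine (of_real l) (of_real (l ^ (2*m))) (\<i> * of_real t)"

lemma rescale_unscale: "l > 0 \<Longrightarrow> rescale l t (unscale l t y) = y"
  by (rule vec2_eqI) (auto simp: rescale_def unscale_def field_simps)

lemma unscale_rescale: "l > 0 \<Longrightarrow> unscale l t (rescale l t y) = y"
  by (rule vec2_eqI) (auto simp: rescale_def unscale_def field_simps)

lemma \<rho>_unscale: "l > 0 \<Longrightarrow> \<rho> (unscale l t y) = l ^ (2*m) * \<rho> y"
proof -
  have "Re (of_real s * x) = s * Re x" for s x by simp
  then have "Re (of_real (l ^ (2*m)) * y $ 2) = l ^ (2*m) * Re (y $ 2)" .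
  then show ?thesis
    unfolding \<rho>_def unscale_def diagonal_affine_nth homogeneous by (simp add: distrib_left)
qed

lemma \<rho>_rescale: "l > 0 \<Longrightarrow> \<rho> (rescale l t y) = \<rho> y / l ^ (2*m)"
  using \<rho>_unscale[of l t "rescale l t y"] by (simp add: unscale_rescale)

lemma rescale_in_model: "l > 0 \<Longrightarrow> rescale l t y \<in> model H \<longleftrightarrow> y \<in> model H"
  by (simp add: model_iff \<rho>_rescale divide_less_0_iff)

lemma unscale_in_model: "l > 0 \<Longrightarrow> unscale l t y \<in> model H \<longleftrightarrow> y \<in> model H"
  by (simp add: model_iff \<rho>_unscale mult_less_0_iff)

lemma zero_in_closure_model: "0 \<in> closure (model H)"
  unfolding closure_approachable
proof (intro allI impI)
  fix e :: real assume e: "e > 0"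
  let ?y = "diagonal_affine 0 0 (- of_real (e/2)) 0"
  have "norm ?y \<le> e/2" using norm_diagonal_affine_le[of 0 0 "- of_real (e/2)" 0] e by simp
  moreover have "?y \<in> model H" using e by (simp add: model_iff \<rho>_def H0)
  ultimately show "\<exists>y\<in>model H. dist y 0 < e" using e by (intro bexI[of _ ?y]) auto
qed

lemma model_attracts_discs: "attracts_discs (model H) 0"
proof (rule condition_M_attracts_discs[OF open_model zero_in_closure_model, of UNIV UNIV id])
  have "holomorphic_map_on id (model H)"
    unfolding holomorphic_map_on_def by (intro ballI exI[of _ id]) (auto intro: has_derivative_ident[folded id_def])
  then show "condition_M H (model H) 0 UNIV UNIV id"
    by (auto simp: condition_M_def biholomorphic_map_def homeomorphism_def intro!: exI[of _ id])
qed

lemma connected_model: "connected (model H)"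
proof -
  let ?b = "diagonal_affine 0 0 (- 1) 0"
  have "connected_component (model H) ?b y" if y: "y \<in> model H" for y
  proof -
    let ?g = "\<lambda>t::real. diagonal_affine (of_real t) (of_real (t ^ (2*m))) (- of_real (1 - t)) y"
    have c: "continuous_on {0..1} ?g"
      unfolding diagonal_affine_def
    proof (rule continuous_on_vec_lambda)
      fix i :: 2
      show "continuous_on {0..1} (\<lambda>t. if i = 1 then of_real t * y $ 1 else of_real (t ^ (2*m)) * y $ 2 + - of_real (1 - t))"
        by (cases "i = 1") (auto intro!: continuous_intros)
    qed
    have Re_eq: "Re (of_real s * x) = s * Re x" for s x by simp
    have "?g t \<in> model H" if t: "t \<in> {0..1}" for t
    proof -
      have "\<rho> (?g t) = t ^ (2*m) * \<rho> y - (1 - t)"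
        unfolding \<rho>_def diagonal_affine_nth homogeneous plus_complex.sel Re_eq by (simp add: algebra_simps)
      moreover have "t ^ (2*m) * \<rho> y \<le> 0" using y t by (simp add: model_iff mult_nonneg_nonpos)
      moreover have "t = 1 \<Longrightarrow> t ^ (2*m) * \<rho> y < 0" using y by (simp add: model_iff)
      ultimately show ?thesis using t by (cases "t = 1") (auto simp: model_iff)
    qed
    moreover have "connected (?g ` {0..1})" by (rule connected_continuous_image[OF c]) auto
    moreover have "?g 0 = ?b" "?g 1 = y" using m by (auto intro!: vec2_eqI simp: power_0_left)
    ultimately show ?thesis
      unfolding connected_component_def
      by (intro exI[of _ "?g ` {0..1}"]) (auto simp: image_iff intro: bexI[of _ 0] bexI[of _ 1])
  qed
  then have "connected_component_set (model H) ?b = model H"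
    using connected_component_subset by blast
  then show ?thesis by (metis connected_connected_component)
qed

end

section \<open>Scaled maps into the model\<close>

text \<open>
  The situation after normalization. The inverses of \<open>\<Phi>\<close> and of the automorphisms are parameters,
  and the last assumption is the only trace of tangential convergence. All assumptions pass to
  subsequences.
\<close>

locale scaling_sequence = peaked_model +
  fixes \<Omega> U V :: "(complex ^ 2) set" and p q :: "complex ^ 2" and \<Phi> \<Phi>i :: "complex ^ 2 \<Rightarrow> complex ^ 2"
    and f fi :: "nat \<Rightarrow> complex ^ 2 \<Rightarrow> complex ^ 2" and l t :: "nat \<Rightarrow> real" and w0 :: "complex ^ 2"
  assumes open\<Omega>: "open \<Omega>" and conn\<Omega>: "connected \<Omega>" and q: "q \<in> \<Omega>" and pcl: "p \<in> closure \<Omega>"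
    and cond: "condition_M H \<Omega> p U V \<Phi>"
    and f: "\<And>n. holomorphic_map_on (f n) \<Omega>" "\<And>n x. x \<in> \<Omega> \<Longrightarrow> f n x \<in> \<Omega>"
    and fi: "\<And>n. holomorphic_map_on (fi n) \<Omega>" "\<And>n x. x \<in> \<Omega> \<Longrightarrow> fi n x \<in> \<Omega>"
      "\<And>n x. x \<in> \<Omega> \<Longrightarrow> fi n (f n x) = x" "\<And>n x. x \<in> \<Omega> \<Longrightarrow> f n (fi n x) = x"
    and \<Phi>i: "holomorphic_map_on \<Phi>i (V \<inter> model H)" "\<And>y. y \<in> V \<inter> model H \<Longrightarrow> \<Phi>i y \<in> U \<inter> \<Omega>"
      "\<And>z. z \<in> U \<inter> \<Omega> \<Longrightarrow> \<Phi>i (\<Phi> z) = z" "\<And>y. y \<in> V \<inter> model H \<Longrightarrow> \<Phi> (\<Phi>i y) = y"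
    and fq: "\<And>n. f n q \<in> U" "(\<lambda>n. f n q) \<longlonglongrightarrow> p"
    and l: "\<And>n. l n > 0" "l \<longlonglongrightarrow> 0" and t: "t \<longlonglongrightarrow> 0"
    and w0: "(\<lambda>n. rescale (l n) (t n) (\<Phi> (f n q))) \<longlonglongrightarrow> w0" "w0 \<in> model H"
begin

lemma subsequence:
  assumes "strict_mono (k :: nat \<Rightarrow> nat)"
  shows "scaling_sequence H m Ht \<delta> \<Omega> U V p q \<Phi> \<Phi>i (\<lambda>n. f (k n)) (\<lambda>n. fi (k n)) (\<lambda>n. l (k n)) (\<lambda>n. t (k n)) w0"
  by unfold_locales
     (use open\<Omega> conn\<Omega> q pcl cond f fi \<Phi>i fq(1) l(1) w0(2) LIMSEQ_subseq_LIMSEQ[OF fq(2) assms]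
        LIMSEQ_subseq_LIMSEQ[OF l(2) assms] LIMSEQ_subseq_LIMSEQ[OF t assms] LIMSEQ_subseq_LIMSEQ[OF w0(1) assms]
      in \<open>auto simp: o_def\<close>)

lemma U: "open U" "p \<in> U" and V: "open V" "0 \<in> V" and \<Phi>p: "\<Phi> p = 0"
  using cond by (auto simp: condition_M_def)

lemma \<Phi>: "holomorphic_map_on \<Phi> (U \<inter> \<Omega>)" "\<And>z. z \<in> U \<inter> \<Omega> \<Longrightarrow> \<Phi> z \<in> V \<inter> model H"
  using cond by (auto simp: condition_M_def biholomorphic_map_def bij_betw_def)

lemma cont\<Phi>: "continuous_on (U \<inter> closure \<Omega>) \<Phi>"
  using cond by (auto simp: condition_M_def homeomorphism_def)

definition G where "G n x = rescale (l n) (t n) (\<Phi> (f n x))"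
definition F where "F n y = fi n (\<Phi>i (unscale (l n) (t n) y))"
definition domG where "domG n = {x\<in>\<Omega>. f n x \<in> U}"
definition domF where "domF n = {y\<in>model H. unscale (l n) (t n) y \<in> V}"

lemma G_in: "x \<in> domG n \<Longrightarrow> G n x \<in> domF n"
  using \<Phi>(2)[of "f n x"] f(2)[of x n] l(1)[of n]
  by (auto simp: domG_def domF_def G_def rescale_in_model unscale_rescale)

lemma F_in: "y \<in> domF n \<Longrightarrow> F n y \<in> domG n"
  using \<Phi>i(2)[of "unscale (l n) (t n) y"] l(1)[of n] fi(2,4)
  by (auto simp: domG_def domF_def F_def unscale_in_model)

lemma F_G: "x \<in> domG n \<Longrightarrow> F n (G n x) = x"
  using \<Phi>i(3)[of "f n x"] f(2)[of x n] fi(3)[of x n] l(1)[of n]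
  by (auto simp: domG_def G_def F_def unscale_rescale)

lemma G_F: "y \<in> domF n \<Longrightarrow> G n (F n y) = y"
  using \<Phi>i(2,4)[of "unscale (l n) (t n) y"] l(1)[of n] fi(4)
  by (auto simp: domF_def G_def F_def unscale_in_model rescale_unscale)

lemma G_model: "x \<in> domG n \<Longrightarrow> G n x \<in> model H"
  using G_in by (auto simp: domF_def)

lemma F_\<Omega>: "y \<in> domF n \<Longrightarrow> F n y \<in> \<Omega>"
  using F_in by (auto simp: domG_def)

lemma holG: "holomorphic_map_on (G n) (domG n)"
proof -
  have 1: "holomorphic_map_on (f n) (domG n)" by (rule holomorphic_map_on_subset[OF f(1)]) (auto simp: domG_def)
  have 2: "holomorphic_map_on (\<Phi> \<circ> f n) (domG n)"
    by (rule holomorphic_map_on_compose[OF 1 \<Phi>(1)]) (use f(2) in \<open>auto simp: domG_def\<close>)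
  have "holomorphic_map_on (rescale (l n) (t n) \<circ> (\<Phi> \<circ> f n)) (domG n)"
    unfolding rescale_def by (rule holomorphic_map_on_compose[OF 2 holomorphic_diagonal_affine[of _ _ _ UNIV]]) auto
  then show ?thesis by (simp add: G_def[abs_def] o_def)
qed

lemma holF: "holomorphic_map_on (F n) (domF n)"
proof -
  have 1: "holomorphic_map_on (unscale (l n) (t n)) (domF n)"
    unfolding unscale_def by (rule holomorphic_diagonal_affine)
  have 2: "holomorphic_map_on (\<Phi>i \<circ> unscale (l n) (t n)) (domF n)"
    by (rule holomorphic_map_on_compose[OF 1 \<Phi>i(1)]) (use l(1)[of n] in \<open>auto simp: domF_def unscale_in_model\<close>)
  have "holomorphic_map_on (fi n \<circ> (\<Phi>i \<circ> unscale (l n) (t n))) (domF n)"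
    by (rule holomorphic_map_on_compose[OF 2 fi(1)]) (use \<Phi>i(2) l(1)[of n] in \<open>auto simp: domF_def unscale_in_model\<close>)
  then show ?thesis by (simp add: F_def[abs_def] o_def)
qed

lemma \<Omega>_attracts_discs: "attracts_discs \<Omega> p"
  by (rule condition_M_attracts_discs[OF open\<Omega> pcl cond])

lemma f_near_p:
  assumes "compact K" "K \<subseteq> \<Omega>" "r > 0"
  shows "\<forall>\<^sub>F n in sequentially. \<forall>x\<in>K. dist (f n x) p < r"
  by (rule attraction_locally_uniform[where D = "\<lambda>_. \<Omega>" and w = "\<lambda>_. q" and ?w0.0 = q, OF \<Omega>_attracts_discs open\<Omega> conn\<Omega> f(1) _ _ _ q fq(2) assms])
     (use f(2) in auto)

lemma domG_exhausts:
  assumes "compact K" "K \<subseteq> \<Omega>"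
  shows "\<forall>\<^sub>F n in sequentially. K \<subseteq> domG n"
proof -
  obtain r where r: "r > 0" "ball p r \<subseteq> U" using U open_contains_ball by blast
  from f_near_p[OF assms r(1)] show ?thesis
    by eventually_elim (use r(2) assms(2) in \<open>auto simp: domG_def dist_commute subset_iff\<close>)
qed

lemma domF_exhausts:
  assumes "compact K" "K \<subseteq> model H"
  shows "\<forall>\<^sub>F n in sequentially. K \<subseteq> domF n"
proof -
  obtain r where r: "r > 0" "ball 0 r \<subseteq> V" using V open_contains_ball by blast
  obtain B where B: "B > 0" "\<And>y. y \<in> K \<Longrightarrow> norm y \<le> B" using compact_imp_bounded[OF assms(1)] bounded_pos by metis
  have "(\<lambda>n. l n * B + l n ^ (2*m) * B + \<bar>t n\<bar>) \<longlonglongrightarrow> 0 * B + 0 ^ (2*m) * B + \<bar>0\<bar>"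
    by (intro tendsto_intros l(2) t)
  then have "(\<lambda>n. l n * B + l n ^ (2*m) * B + \<bar>t n\<bar>) \<longlonglongrightarrow> 0" using m by (simp add: power_0_left)
  then have "\<forall>\<^sub>F n in sequentially. l n * B + l n ^ (2*m) * B + \<bar>t n\<bar> < r" using order_tendstoD(2) r(1) by blast
  then show ?thesis
  proof eventually_elim
    case (elim n)
    have "unscale (l n) (t n) y \<in> V" if y: "y \<in> K" for y
    proof -
      have "norm (unscale (l n) (t n) y) \<le> l n * norm y + l n ^ (2*m) * norm y + \<bar>t n\<bar>"
        unfolding unscale_def
        using norm_diagonal_affine_le[of "of_real (l n)" "of_real (l n ^ (2*m))" "\<i> * of_real (t n)" y] l(1)[of n]
        by (simp add: norm_mult norm_power)
      also have "\<dots> \<le> l n * B + l n ^ (2*m) * B + \<bar>t n\<bar>"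
        using B(2)[OF y] l(1)[of n] by (intro add_mono mult_left_mono) auto
      finally show ?thesis using elim r(2) by (auto simp: subset_iff)
    qed
    then show ?case using assms(2) by (auto simp: domF_def)
  qed
qed

lemma q_domG: "q \<in> domG n" using q fq(1) by (simp add: domG_def)

lemma G_q: "(\<lambda>n. G n q) \<longlonglongrightarrow> w0" using w0(1) by (simp add: G_def)

text \<open>
  If the maps \<open>G\<close> were unbounded on \<open>K\<close>, dilations with suitably slowly growing factors would
  send some values on \<open>K\<close> out of the unit ball while the values at \<open>q\<close> still tend to the
  origin. This contradicts attraction of discs for the model at the origin.
\<close>

lemma G_locally_bounded:
  assumes K: "compact K" "K \<subseteq> \<Omega>"
  shows "\<exists>B. \<forall>\<^sub>F n in sequentially. \<forall>x\<in>K. norm (G n x) \<le> B"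
proof (rule ccontr)
  assume "\<not> ?thesis"
  then have "\<exists>\<^sub>F n in sequentially. \<not> (\<forall>x\<in>K. norm (G n x) \<le> real (Suc j))" for j
    by (auto simp: frequently_def)
  from frequently_subsequence[of "\<lambda>j n. \<not> (\<forall>x\<in>K. norm (G n x) \<le> real (Suc j))", OF this]
  obtain s where s: "strict_mono s" "\<And>j. \<exists>x\<in>K. norm (G (s j) x) > real (Suc j)" by (auto simp: not_le)
  \<comment> \<open>the factor for which a vector of norm larger than \<open>j + 1\<close> keeps norm larger than \<open>1\<close>\<close>
  define T where "T = (\<lambda>j. root (2*m) (real (Suc j)))"
  have T: "T j \<ge> 1" "T j > 0" "T j ^ (2*m) = real (Suc j)" for j
    using m real_root_ge_1_iff[of "2*m" "real (Suc j)"] real_root_gt_zero[of "2*m" "real (Suc j)"] by (auto simp: T_def)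
  have le1: "1 / T j ^ (2*m) \<le> 1 / T j" for j
    using T[of j] m self_le_power[of "T j" "2*m"] by (intro divide_left_mono) auto
  have T0: "(\<lambda>j. 1 / T j) \<longlonglongrightarrow> 0"
  proof -
    have "(\<lambda>j. root (2*m) (inverse (real (Suc j)))) \<longlonglongrightarrow> root (2*m) 0"
      by (intro tendsto_real_root LIMSEQ_inverse_real_of_nat)
    then show ?thesis using m by (simp add: T_def inverse_eq_divide real_root_divide)
  qed
  define h where "h = (\<lambda>j. rescale (T j) 0 \<circ> G (s j))"
  have small: "norm (rescale (T j) 0 y) \<le> 2 * norm y * (1 / T j)" for j y
  proof -
    have "norm (rescale (T j) 0 y) \<le> 1 / T j * norm y + 1 / T j ^ (2*m) * norm y"
      unfolding rescale_def
      using norm_diagonal_affine_le[of "1 / of_real (T j)" "1 / of_real (T j ^ (2*m))" 0 y] T(2)[of j]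
      by (simp add: norm_divide norm_power)
    also have "\<dots> \<le> 1 / T j * norm y + 1 / T j * norm y"
      using le1 by (intro add_left_mono mult_right_mono) auto
    finally show ?thesis by simp
  qed
  have hq: "(\<lambda>j. h j q) \<longlonglongrightarrow> 0"
  proof -
    have "(\<lambda>j. G (s j) q) \<longlonglongrightarrow> w0" using LIMSEQ_subseq_LIMSEQ[OF G_q s(1)] by (simp add: o_def)
    then have "(\<lambda>j. 2 * norm (G (s j) q) * (1 / T j)) \<longlonglongrightarrow> 2 * norm w0 * 0"
      by (intro tendsto_intros T0)
    then have lim: "(\<lambda>j. 2 * norm (G (s j) q) * (1 / T j)) \<longlonglongrightarrow> 0" by simp
    show ?thesis by (rule Lim_null_comparison[OF _ lim]) (use small in \<open>auto simp: h_def\<close>)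
  qed
  have "\<forall>\<^sub>F j in sequentially. \<forall>x\<in>K. dist (h j x) 0 < 1"
  proof (rule attraction_locally_uniform[where h = h and D = "\<lambda>j. domG (s j)" and w = "\<lambda>_. q" and ?w0.0 = q,
      OF model_attracts_discs open\<Omega> conn\<Omega> _ _ _ tendsto_const q hq K])
    show "holomorphic_map_on (h j) (domG (s j))" for j
      unfolding h_def rescale_def
      by (rule holomorphic_map_on_compose[OF holG holomorphic_diagonal_affine[of _ _ _ UNIV]]) auto
    show "h j ` domG (s j) \<subseteq> model H" for j
      using G_model T(2)[of j] by (auto simp: h_def rescale_in_model)
    show "\<forall>\<^sub>F j in sequentially. K \<subseteq> domG (s j)" if "compact K" "K \<subseteq> \<Omega>" for K
      using eventually_subseq[OF s(1) domG_exhausts[OF that]] .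
  qed simp
  then obtain j where j: "\<And>x. x \<in> K \<Longrightarrow> norm (h j x) < 1" by (auto simp: eventually_sequentially)
  obtain x where x: "x \<in> K" "norm (G (s j) x) > real (Suc j)" using s(2) by blast
  have "G (s j) x = unscale (T j) 0 (h j x)" using T(2)[of j] by (simp add: h_def unscale_rescale)
  also have "norm \<dots> \<le> norm ((of_real (T j ^ (2*m)) :: complex) *s h j x)"
  proof (rule norm_le_componentwise_cart)
    fix i :: 2
    have "T j * c \<le> T j ^ (2*m) * c" if "c \<ge> 0" for c
      using T[of j] m self_le_power[of "T j" "2*m"] that by (intro mult_right_mono) auto
    then show "norm (unscale (T j) 0 (h j x) $ i) \<le> norm (((of_real (T j ^ (2*m)) :: complex) *s h j x) $ i)"
      using exhaust_2[of i] T(2)[of j] by (auto simp: unscale_def norm_mult norm_power)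
  qed
  also have "\<dots> = real (Suc j) * norm (h j x)" unfolding norm_vector_smult T(3) norm_of_real by simp
  also have "\<dots> \<le> real (Suc j) * 1" using j[OF x(1)] by (intro mult_left_mono) auto
  finally show False using x(2) by simp
qed

lemma G_limit:
  obtains k g where "strict_mono (k :: nat \<Rightarrow> nat)" "holomorphic_map_on g \<Omega>" "g ` \<Omega> \<subseteq> model H"
    "\<And>x. x \<in> \<Omega> \<Longrightarrow> \<exists>r>0. uniform_limit (ball x r) (\<lambda>n. G (k n)) g sequentially"
proof -
  have "\<exists>r>0. \<exists>B. ball x r \<subseteq> \<Omega> \<and>
      (\<forall>\<^sub>F n in sequentially. holomorphic_map_on (G n) (ball x r) \<and> (\<forall>y\<in>ball x r. norm (G n y) \<le> B))"
    if x: "x \<in> \<Omega>" for x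
  proof -
    obtain r where r: "r > 0" "cball x r \<subseteq> \<Omega>" using open\<Omega> x open_contains_cball by blast
    obtain B where B: "\<forall>\<^sub>F n in sequentially. \<forall>y\<in>cball x r. norm (G n y) \<le> B"
      using G_locally_bounded[OF compact_cball r(2)] by blast
    have "\<forall>\<^sub>F n in sequentially. holomorphic_map_on (G n) (ball x r) \<and> (\<forall>y\<in>ball x r. norm (G n y) \<le> B)"
      using B domG_exhausts[OF compact_cball r(2)]
    proof eventually_elim
      case (elim n)
      have "holomorphic_map_on (G n) (ball x r)"
        by (rule holomorphic_map_on_subset[OF holG]) (use elim(2) ball_subset_cball in blast)
      then show ?case using elim(1) by simp
    qed
    then show ?thesis using r ball_subset_cball by blast
  qed
  from montel[of \<Omega> G, OF this] obtain k g where k: "strict_mono (k :: nat \<Rightarrow> nat)" and g: "holomorphic_map_on g \<Omega>"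
    and u: "\<And>x. x \<in> \<Omega> \<Longrightarrow> \<exists>r>0. ball x r \<subseteq> \<Omega> \<and> uniform_limit (ball x r) (\<lambda>n. G (k n)) g sequentially"
    by blast
  have lim: "(\<lambda>n. G (k n) x) \<longlonglongrightarrow> g x" if x: "x \<in> \<Omega>" for x
  proof -
    obtain r where r: "r > 0" "uniform_limit (ball x r) (\<lambda>n. G (k n)) g sequentially" using u[OF x] by blast
    show ?thesis by (rule tendsto_uniform_limitI[OF r(2)]) (use r(1) in simp)
  qed
  have le: "\<rho> (g x) \<le> 0" if x: "x \<in> \<Omega>" for x
  proof (rule tendsto_upperbound)
    show "(\<lambda>n. \<rho> (G (k n) x)) \<longlonglongrightarrow> \<rho> (g x)"
      by (rule continuous_on_tendsto_compose[OF continuous_on_\<rho>[of UNIV] lim[OF x]]) auto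
    have "\<forall>\<^sub>F n in sequentially. {x} \<subseteq> domG n" by (rule domG_exhausts) (use x in auto)
    from eventually_subseq[OF k this] show "\<forall>\<^sub>F n in sequentially. \<rho> (G (k n) x) \<le> 0"
      by eventually_elim (use G_model in \<open>force simp: model_iff\<close>)
  qed simp
  have "g q = w0" using LIMSEQ_unique[OF lim[OF q]] LIMSEQ_subseq_LIMSEQ[OF G_q k] by (simp add: o_def)
  then have "\<rho> (g q) < 0" using w0(2) by (simp add: model_iff)
  then have "g ` \<Omega> \<subseteq> model H"
    using strong_maximum_principle[OF open\<Omega> conn\<Omega> g le q] by (auto simp: model_iff)
  then show thesis using that[OF k g] u by blast
qed

end

context scaling_sequence begin

lemma F_base: "F n (G n q) = q"
  by (rule F_G[OF q_domG])

section \<open>Scaled maps into the domain\<close>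

text \<open>
  Attraction applies to \<open>f N \<circ> F (s N)\<close> for every choice of indices \<open>s N\<close>, because this map sends
  \<open>G (s N) q\<close>, which stays in a compact set, to \<open>f N q\<close>, which tends to \<open>p\<close>. Hence one \<open>N\<close> serves
  all large \<open>n\<close>.
\<close>

lemma f_F_near_p:
  assumes K: "compact K" "K \<subseteq> model H" and r: "r > 0"
  shows "\<exists>N. \<forall>\<^sub>F n in sequentially. \<forall>y\<in>K. dist (f N (F n y)) p < r"
proof (rule ccontr)
  assume "\<not> ?thesis"
  then have "\<exists>\<^sub>F n in sequentially. \<not> (\<forall>y\<in>K. dist (f N (F n y)) p < r)" for N
    by (auto simp: frequently_def)
  from frequently_subsequence[of "\<lambda>N n. \<not> (\<forall>y\<in>K. dist (f N (F n y)) p < r)", OF this]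
  obtain s where s: "strict_mono s" "\<And>N. \<not> (\<forall>y\<in>K. dist (f N (F (s N) y)) p < r)" by blast
  define h where "h = (\<lambda>N. f N \<circ> F (s N))"
  have hb: "(\<lambda>N. h N (G (s N) q)) \<longlonglongrightarrow> p" using fq(2) by (simp add: h_def F_base)
  have wb: "(\<lambda>N. G (s N) q) \<longlonglongrightarrow> w0" using LIMSEQ_subseq_LIMSEQ[OF G_q s(1)] by (simp add: o_def)
  have "\<forall>\<^sub>F N in sequentially. \<forall>y\<in>K. dist (h N y) p < r"
  proof (rule attraction_locally_uniform[where h = h and D = "\<lambda>N. domF (s N)",
      OF \<Omega>_attracts_discs open_model connected_model _ _ _ wb w0(2) hb K r])
    show "holomorphic_map_on (h N) (domF (s N))" for N
      unfolding h_def by (rule holomorphic_map_on_compose[OF holF f(1)]) (use F_\<Omega> in auto)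
    show "h N ` domF (s N) \<subseteq> \<Omega>" for N using F_\<Omega> f(2) by (auto simp: h_def)
    show "\<forall>\<^sub>F N in sequentially. K \<subseteq> domF (s N)" if "compact K" "K \<subseteq> model H" for K
      using eventually_subseq[OF s(1) domF_exhausts[OF that]] .
  qed
  then obtain N where "\<forall>y\<in>K. dist (h N y) p < r" by (auto simp: eventually_sequentially)
  then show False using s(2)[of N] by (simp add: h_def)
qed

text \<open>
  With \<open>N\<close> from the lemma \<open>f_F_near_p\<close> the maps \<open>E n = \<Phi> \<circ> f N \<circ> F n\<close> are bounded with values in the
  model. If some of their values on the ball approached the boundary of the model, a limit \<open>Es\<close>
  would touch the boundary; by the strong maximum principle it would then lie in the boundary
  altogether, contrary to the assumption at \<open>a\<close>. Pulling back by \<open>\<Phi>\<close> and \<open>f N\<close> gives the compact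
  set in \<open>\<Omega>\<close>.
\<close>

lemma F_compactly_valued_near:
  assumes R: "R > 0" "cball w R \<subseteq> model H" and b: "b \<longlonglongrightarrow> a" "a \<in> ball w R"
    and L: "compact L" "L \<subseteq> \<Omega>" "\<forall>\<^sub>F n in sequentially. F n (b n) \<in> L"
  shows "\<exists>L'. compact L' \<and> L' \<subseteq> \<Omega> \<and> (\<forall>\<^sub>F n in sequentially. \<forall>y\<in>cball w (R/2). F n y \<in> L')"
proof -
  obtain R2 where R2: "R2 > 0" "cball 0 R2 \<subseteq> V" using V open_contains_cball by blast
  obtain r1 where r1: "r1 > 0" "cball p r1 \<subseteq> U" using U open_contains_cball by blast
  have "p \<in> U \<inter> closure \<Omega>" using U pcl by blast
  then obtain r2 where r2: "r2 > 0" "\<And>z. z \<in> U \<inter> closure \<Omega> \<Longrightarrow> dist z p < r2 \<Longrightarrow> dist (\<Phi> z) (\<Phi> p) < R2"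
    using cont\<Phi> R2(1) unfolding continuous_on_iff by metis
  define r where "r = min r1 r2"
  have r: "r > 0" using r1 r2 by (simp add: r_def)
  have near: "z \<in> U" "norm (\<Phi> z) < R2" if "z \<in> \<Omega>" "dist z p < r" for z
  proof -
    show "z \<in> U" using that r1(2) by (auto simp: r_def dist_commute subset_iff)
    then show "norm (\<Phi> z) < R2" using r2(2)[of z] that closure_subset[of \<Omega>] \<Phi>p by (auto simp: r_def)
  qed
  obtain N where N: "\<forall>\<^sub>F n in sequentially. \<forall>y\<in>cball w R. dist (f N (F n y)) p < r"
    using f_F_near_p[OF compact_cball R(2) r] by blast
  have dom: "\<forall>\<^sub>F n in sequentially. cball w R \<subseteq> domF n" by (rule domF_exhausts[OF compact_cball R(2)])
  have bR: "\<forall>\<^sub>F n in sequentially. b n \<in> ball w R"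
    using topological_tendstoD[OF b(1) open_ball b(2)] .
  define E where "E = (\<lambda>n. \<Phi> \<circ> (f N \<circ> F n))"
  define good where "good = (\<lambda>n. (\<forall>y\<in>cball w R. dist (f N (F n y)) p < r) \<and> cball w R \<subseteq> domF n \<and> b n \<in> ball w R \<and> F n (b n) \<in> L)"
  have ev_good: "\<forall>\<^sub>F n in sequentially. good n"
    using N dom bR L(3) unfolding good_def by eventually_elim blast
  have E: "f N (F n y) \<in> U \<inter> \<Omega>" "E n y \<in> V \<inter> model H" "norm (E n y) < R2" "F n y = fi N (\<Phi>i (E n y))"
    if g: "good n" and y: "y \<in> cball w R" for n y
  proof -
    have m: "F n y \<in> \<Omega>" using g y F_\<Omega> by (auto simp: good_def)
    have d: "f N (F n y) \<in> \<Omega>" "dist (f N (F n y)) p < r" using f(2)[OF m] g y by (auto simp: good_def)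
    show 1: "f N (F n y) \<in> U \<inter> \<Omega>" using near(1)[OF d] d(1) by blast
    show "E n y \<in> V \<inter> model H" using \<Phi>(2)[OF 1] by (simp add: E_def)
    show "norm (E n y) < R2" using near(2)[OF d] by (simp add: E_def)
    show "F n y = fi N (\<Phi>i (E n y))" using \<Phi>i(3)[OF 1] fi(3)[OF m] by (simp add: E_def)
  qed
  have holE: "holomorphic_map_on (E n) (ball w R)" if g: "good n" for n
  proof -
    have sub: "ball w R \<subseteq> domF n" using g ball_subset_cball by (auto simp: good_def)
    have 1: "holomorphic_map_on (f N \<circ> F n) (ball w R)"
      by (rule holomorphic_map_on_compose[OF holomorphic_map_on_subset[OF holF sub] f(1)]) (use sub F_\<Omega> in auto)
    show ?thesis unfolding E_def
      by (rule holomorphic_map_on_compose[OF 1 \<Phi>(1)]) (use E(1)[OF g] ball_subset_cball in fastforce)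
  qed
  have "\<exists>\<tau>>0. \<forall>\<^sub>F n in sequentially. \<forall>y\<in>cball w (R/2). \<rho> (E n y) \<le> - \<tau>"
  proof (rule ccontr)
    assume "\<not> ?thesis"
    then have "\<exists>\<^sub>F n in sequentially. \<not> (\<forall>y\<in>cball w (R/2). \<rho> (E n y) \<le> - (1 / real (Suc j)))" for j
      by (auto simp: frequently_def)
    then have "\<exists>\<^sub>F n in sequentially. \<not> (\<forall>y\<in>cball w (R/2). \<rho> (E n y) \<le> - (1 / real (Suc j))) \<and> good n" for j
      using frequently_eventually_frequently[OF _ ev_good] by blast
    from frequently_subsequence[of "\<lambda>j n. \<not> (\<forall>y\<in>cball w (R/2). \<rho> (E n y) \<le> - (1 / real (Suc j))) \<and> good n", OF this]
    obtain s where s: "strict_mono s" "\<And>j. \<exists>y\<in>cball w (R/2). \<rho> (E (s j) y) > - (1 / real (Suc j))" "\<And>j. good (s j)"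
      by (auto simp: not_le)
    \<comment> \<open>three nested subsequences: \<open>s\<close> approaches the boundary, \<open>k1\<close> makes the points converge,
        \<open>k2\<close> makes the maps converge\<close>
    obtain y where y: "\<And>j. y j \<in> cball w (R/2)" "\<And>j. \<rho> (E (s j) (y j)) > - (1 / real (Suc j))" using s(2) by metis
    let ?x = "\<lambda>j. (y j, F (s j) (b (s j)))"
    have "compact (cball w (R/2) \<times> L)" by (intro compact_Times compact_cball L)
    moreover have "\<forall>j. ?x j \<in> cball w (R/2) \<times> L" using y(1) s(3) by (simp add: good_def)
    ultimately obtain lim k1 where k1: "lim \<in> cball w (R/2) \<times> L" "strict_mono (k1 :: nat \<Rightarrow> nat)" "(?x \<circ> k1) \<longlonglongrightarrow> lim"
      unfolding compact_def by meson
    obtain ys xs where lim: "lim = (ys, xs)" by (cases lim)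
    have y1: "(\<lambda>j. y (k1 j)) \<longlonglongrightarrow> ys" and x1: "(\<lambda>j. F (s (k1 j)) (b (s (k1 j)))) \<longlonglongrightarrow> xs"
      using tendsto_fst[OF k1(3)] tendsto_snd[OF k1(3)] by (simp_all add: lim o_def)
    have ys: "ys \<in> ball w R" and xs: "xs \<in> L" using k1(1) lim R(1) by auto
    have loc: "\<exists>r>0. \<exists>B. ball x r \<subseteq> ball w R \<and>
      (\<forall>\<^sub>F j in sequentially. holomorphic_map_on (E (s (k1 j))) (ball x r) \<and> (\<forall>y\<in>ball x r. norm (E (s (k1 j)) y) \<le> B))"
      if x: "x \<in> ball w R" for x
    proof -
      obtain d where d: "d > 0" "ball x d \<subseteq> ball w R" using x open_contains_ball open_ball by blast
      have "holomorphic_map_on (E (s (k1 j))) (ball x d) \<and> (\<forall>y\<in>ball x d. norm (E (s (k1 j)) y) \<le> R2)" for j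
        using holomorphic_map_on_subset[OF holE[OF s(3)] d(2)] E(3)[OF s(3)] d(2) ball_subset_cball by (meson less_imp_le subsetD)
      then show ?thesis using d by (intro exI[of _ d] conjI exI[of _ R2]) auto
    qed
    from montel[of "ball w R" "\<lambda>j. E (s (k1 j))", OF loc]
    obtain k2 Es where k2: "strict_mono (k2 :: nat \<Rightarrow> nat)" and Es: "holomorphic_map_on Es (ball w R)"
      and u: "\<And>x. x \<in> ball w R \<Longrightarrow> \<exists>r>0. ball x r \<subseteq> ball w R \<and> uniform_limit (ball x r) (\<lambda>n. E (s (k1 (k2 n)))) Es sequentially"
      by blast
    define \<sigma> where "\<sigma> = (\<lambda>n. s (k1 (k2 n)))"
    have \<sigma>: "strict_mono \<sigma>" using s(1) k1(2) k2 by (simp add: \<sigma>_def strict_mono_def)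
    have gs: "good (\<sigma> n)" for n using s(3) by (simp add: \<sigma>_def)
    have conv: "(\<lambda>n. E (\<sigma> n) (z n)) \<longlonglongrightarrow> Es x" if z: "z \<longlonglongrightarrow> x" and x: "x \<in> ball w R" for z x
    proof -
      obtain r where r: "r > 0" "uniform_limit (ball x r) (\<lambda>n. E (\<sigma> n)) Es sequentially"
        using u[OF x] unfolding \<sigma>_def by blast
      show ?thesis
        by (rule locally_uniform_limit_tendsto[OF r(2,1) holomorphic_map_on_imp_isCont[OF Es x] z])
    qed
    have \<rho>conv: "(\<lambda>n. \<rho> (E (\<sigma> n) (z n))) \<longlonglongrightarrow> \<rho> (Es x)" if "z \<longlonglongrightarrow> x" "x \<in> ball w R" for z x
      by (rule continuous_on_tendsto_compose[OF continuous_on_\<rho>[of UNIV] conv[OF that]]) auto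
    have le: "\<rho> (Es x) \<le> 0" if x: "x \<in> ball w R" for x
    proof (rule tendsto_upperbound[OF \<rho>conv[OF tendsto_const x]])
      have "\<rho> (E (\<sigma> n) x) \<le> 0" for n
        using E(2)[OF gs, of x n] x by (simp add: model_iff less_imp_le)
      then show "\<forall>\<^sub>F n in sequentially. \<rho> (E (\<sigma> n) x) \<le> 0" by simp
    qed simp
    have "\<rho> (Es a) < 0"
    proof -
      have xs\<Omega>: "xs \<in> \<Omega>" using xs L(2) by blast
      have Fb: "(\<lambda>n. F (\<sigma> n) (b (\<sigma> n))) \<longlonglongrightarrow> xs"
        using LIMSEQ_subseq_LIMSEQ[OF x1 k2] by (simp add: o_def \<sigma>_def)
      have fb: "(\<lambda>n. f N (F (\<sigma> n) (b (\<sigma> n)))) \<longlonglongrightarrow> f N xs"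
        by (rule isCont_tendsto_compose[OF holomorphic_map_on_imp_isCont[OF f(1) xs\<Omega>] Fb])
      have "f N xs \<in> cball p r1"
      proof (rule closed_sequentially[OF closed_cball _ fb])
        have "dist (f N (F (\<sigma> n) (b (\<sigma> n)))) p < r" for n using gs[of n] by (auto simp: good_def)
        then show "f N (F (\<sigma> n) (b (\<sigma> n))) \<in> cball p r1" for n by (simp add: r_def dist_commute less_imp_le)
      qed
      then have fU: "f N xs \<in> U \<inter> \<Omega>" using r1(2) f(2)[OF xs\<Omega>] by blast
      have "(\<lambda>n. E (\<sigma> n) (b (\<sigma> n))) \<longlonglongrightarrow> \<Phi> (f N xs)"
        unfolding E_def o_def
        by (rule isCont_tendsto_compose[OF holomorphic_map_on_imp_isCont[OF \<Phi>(1) fU] fb])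
      moreover have "(\<lambda>n. E (\<sigma> n) (b (\<sigma> n))) \<longlonglongrightarrow> Es a"
        by (rule conv[OF _ b(2)]) (use LIMSEQ_subseq_LIMSEQ[OF b(1) \<sigma>] in \<open>simp add: o_def\<close>)
      ultimately have "Es a = \<Phi> (f N xs)" using LIMSEQ_unique by blast
      then show ?thesis using \<Phi>(2)[OF fU] by (simp add: model_iff)
    qed
    then have neg: "\<rho> (Es ys) < 0"
      using strong_maximum_principle[OF open_ball connected_ball Es le b(2) _ ys] by blast
    have "(\<lambda>n. \<rho> (E (\<sigma> n) (y (k1 (k2 n))))) \<longlonglongrightarrow> \<rho> (Es ys)"
      by (rule \<rho>conv[OF _ ys]) (use LIMSEQ_subseq_LIMSEQ[OF y1 k2] in \<open>simp add: o_def\<close>)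
    moreover have "(\<lambda>n. - (1 / real (Suc (k1 (k2 n))))) \<longlonglongrightarrow> - 0"
    proof -
      have "strict_mono (\<lambda>n. k1 (k2 n))" using k1(2) k2 by (simp add: strict_mono_def)
      from LIMSEQ_subseq_LIMSEQ[OF LIMSEQ_inverse_real_of_nat this]
      show ?thesis by (intro tendsto_minus) (simp add: o_def inverse_eq_divide)
    qed
    ultimately have "- 0 \<le> \<rho> (Es ys)"
    proof (rule tendsto_le[OF sequentially_bot])
      show "\<forall>\<^sub>F n in sequentially. - (1 / real (Suc (k1 (k2 n)))) \<le> \<rho> (E (\<sigma> n) (y (k1 (k2 n))))"
        using y(2) by (auto simp: \<sigma>_def intro!: always_eventually less_imp_le)
    qed
    then show False using neg by simp
  qed
  then obtain \<tau> where \<tau>: "\<tau> > 0" "\<forall>\<^sub>F n in sequentially. \<forall>y\<in>cball w (R/2). \<rho> (E n y) \<le> - \<tau>" by blast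
  let ?C = "cball 0 R2 \<inter> {y. \<rho> y \<le> - \<tau>}"
  have C: "compact ?C"
    by (intro compact_Int_closed compact_cball closed_Collect_le continuous_on_\<rho> continuous_on_const)
  have CV: "?C \<subseteq> V \<inter> model H" using R2(2) \<tau>(1) by (auto simp: model_iff)
  let ?L' = "(\<lambda>y. fi N (\<Phi>i y)) ` ?C"
  have c1: "continuous_on ?C \<Phi>i"
    by (rule continuous_on_subset[OF holomorphic_map_on_imp_continuous_on[OF \<Phi>i(1)] CV])
  have im: "\<Phi>i ` ?C \<subseteq> \<Omega>" using CV \<Phi>i(2) by blast
  have "continuous_on ?C (\<lambda>y. fi N (\<Phi>i y))"
    by (rule continuous_on_compose2[OF holomorphic_map_on_imp_continuous_on[OF fi(1)] c1 im])
  then have "compact ?L'" using C compact_continuous_image by blast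
  moreover have "?L' \<subseteq> \<Omega>" using im fi(2) by blast
  moreover have "\<forall>\<^sub>F n in sequentially. \<forall>y\<in>cball w (R/2). F n y \<in> ?L'"
    using \<tau>(2) ev_good
  proof eventually_elim
    case (elim n)
    show ?case
    proof
      fix y assume y: "y \<in> cball w (R/2)"
      then have yR: "y \<in> cball w R" using R(1) by auto
      have "E n y \<in> ?C" using E(3)[OF elim(2) yR] elim(1) y by auto
      then show "F n y \<in> ?L'" using E(4)[OF elim(2) yR] by blast
    qed
  qed
  ultimately show ?thesis by blast
qed

text \<open>
  The previous lemma propagates the property through the connected model, starting at \<open>w0\<close>,
  where \<open>F n (G n q) = q\<close>.
\<close>

lemma F_compactly_valued:
  assumes w: "w \<in> model H"
  shows "\<exists>r>0. cball w r \<subseteq> model H \<and> (\<exists>L. compact L \<and> L \<subseteq> \<Omega> \<and> (\<forall>\<^sub>F n in sequentially. \<forall>y\<in>cball w r. F n y \<in> L))"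
proof -
  let ?P = "\<lambda>b L. compact L \<and> L \<subseteq> \<Omega> \<and> (\<forall>\<^sub>F n in sequentially. F n (b n) \<in> L)"
  let ?A = "{w\<in>model H. \<exists>L. ?P (\<lambda>_. w) L}"
  have step: "\<exists>L. compact L \<and> L \<subseteq> \<Omega> \<and> (\<forall>\<^sub>F n in sequentially. \<forall>y\<in>cball w (R/2). F n y \<in> L)"
    if "a \<in> ?A" "R > 0" "cball w R \<subseteq> model H" "a \<in> ball w R" for a w R
    using that(1) F_compactly_valued_near[OF that(2,3) tendsto_const that(4)] by blast
  have stepA: "cball w (R/2) \<subseteq> ?A" if a: "a \<in> ?A" "R > 0" "cball w R \<subseteq> model H" "a \<in> ball w R" for a w R
  proof
    fix y assume y: "y \<in> cball w (R/2)"
    obtain L where L: "compact L" "L \<subseteq> \<Omega>" "\<forall>\<^sub>F n in sequentially. \<forall>y\<in>cball w (R/2). F n y \<in> L"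
      using step[OF a] by blast
    have "\<forall>\<^sub>F n in sequentially. F n y \<in> L" using L(3) by eventually_elim (use y in blast)
    moreover have "y \<in> model H" using y a(2,3) by (auto simp: subset_iff)
    ultimately show "y \<in> ?A" using L(1,2) by blast
  qed
  have "open ?A"
    unfolding open_contains_ball
  proof
    fix a assume a: "a \<in> ?A"
    then obtain R where R: "R > 0" "cball a R \<subseteq> model H" using open_model open_contains_cball by blast
    then have "cball a (R/2) \<subseteq> ?A" by (intro stepA[OF a]) auto
    then have "ball a (R/2) \<subseteq> ?A" using ball_subset_cball by blast
    then show "\<exists>e>0. ball a e \<subseteq> ?A" using half_gt_zero[OF R(1)] by blast
  qed
  moreover have "model H \<inter> closure ?A \<subseteq> ?A"
  proof
    fix x assume x: "x \<in> model H \<inter> closure ?A"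
    then obtain R where R: "R > 0" "cball x R \<subseteq> model H" using open_model open_contains_cball by blast
    obtain a where a: "a \<in> ?A" "dist a x < R" using x R(1) closure_approachable[of x ?A] by blast
    have "cball x (R/2) \<subseteq> ?A" by (rule stepA[OF a(1) R]) (use a(2) in \<open>simp add: dist_commute\<close>)
    moreover have "x \<in> cball x (R/2)" using R(1) by simp
    ultimately show "x \<in> ?A" by blast
  qed
  then have "closedin (top_of_set (model H)) ?A"
    unfolding closedin_closed by (intro exI[of _ "closure ?A"]) (use closure_subset[of ?A] in auto)
  moreover have "w0 \<in> ?A"
  proof -
    obtain R where R: "R > 0" "cball w0 R \<subseteq> model H" using open_model w0(2) open_contains_cball by blast
    have "\<forall>\<^sub>F n in sequentially. F n (G n q) \<in> {q}" by (simp add: F_base)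
    then obtain L where L: "compact L" "L \<subseteq> \<Omega>" "\<forall>\<^sub>F n in sequentially. \<forall>y\<in>cball w0 (R/2). F n y \<in> L"
      using F_compactly_valued_near[OF R G_q, of "{q}"] R(1) q by auto
    have "\<forall>\<^sub>F n in sequentially. F n w0 \<in> L" using L(3) by eventually_elim (use R(1) in auto)
    then show ?thesis using w0(2) L(1,2) by blast
  qed
  ultimately have "?A = model H"
    using connected_model open_subset[of ?A "model H"] connected_clopen[of "model H"] by blast
  then have wA: "w \<in> ?A" using w by blast
  obtain R where R: "R > 0" "cball w R \<subseteq> model H" using open_model w open_contains_cball by blast
  have "cball w (R/2) \<subseteq> cball w R" using R(1) by auto
  then show ?thesis using step[OF wA R] R by (intro exI[of _ "R/2"]) auto
qed

lemma F_limit: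
  obtains k g where "strict_mono (k :: nat \<Rightarrow> nat)" "holomorphic_map_on g (model H)" "g ` model H \<subseteq> \<Omega>"
    "\<And>y. y \<in> model H \<Longrightarrow> \<exists>r>0. uniform_limit (ball y r) (\<lambda>n. F (k n)) g sequentially"
proof -
  have "\<exists>r>0. \<exists>B. ball w r \<subseteq> model H \<and>
      (\<forall>\<^sub>F n in sequentially. holomorphic_map_on (F n) (ball w r) \<and> (\<forall>y\<in>ball w r. norm (F n y) \<le> B))"
    if w: "w \<in> model H" for w
  proof -
    obtain r L where r: "r > 0" "cball w r \<subseteq> model H" and L: "compact L" "\<forall>\<^sub>F n in sequentially. \<forall>y\<in>cball w r. F n y \<in> L"
      using F_compactly_valued[OF w] by blast
    obtain B where B: "\<And>x. x \<in> L \<Longrightarrow> norm x \<le> B" using compact_imp_bounded[OF L(1)] bounded_iff by blast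
    have "\<forall>\<^sub>F n in sequentially. holomorphic_map_on (F n) (ball w r) \<and> (\<forall>y\<in>ball w r. norm (F n y) \<le> B)"
      using L(2) domF_exhausts[OF compact_cball r(2)]
    proof eventually_elim
      case (elim n)
      have "holomorphic_map_on (F n) (ball w r)"
        by (rule holomorphic_map_on_subset[OF holF]) (use elim(2) ball_subset_cball in blast)
      then show ?case using elim(1) B by simp
    qed
    then show ?thesis using r ball_subset_cball by blast
  qed
  from montel[of "model H" F, OF this] obtain k g where k: "strict_mono (k :: nat \<Rightarrow> nat)" and g: "holomorphic_map_on g (model H)"
    and u: "\<And>y. y \<in> model H \<Longrightarrow> \<exists>r>0. ball y r \<subseteq> model H \<and> uniform_limit (ball y r) (\<lambda>n. F (k n)) g sequentially"
    by blast
  have "g w \<in> \<Omega>" if w: "w \<in> model H" for w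
  proof -
    obtain r where r: "r > 0" "uniform_limit (ball w r) (\<lambda>n. F (k n)) g sequentially" using u[OF w] by blast
    have lim: "(\<lambda>n. F (k n) w) \<longlonglongrightarrow> g w" by (rule tendsto_uniform_limitI[OF r(2)]) (use r(1) in simp)
    obtain s L where L: "s > 0" "compact L" "L \<subseteq> \<Omega>" "\<forall>\<^sub>F n in sequentially. \<forall>y\<in>cball w s. F n y \<in> L"
      using F_compactly_valued[OF w] by blast
    have "\<forall>\<^sub>F n in sequentially. F (k n) w \<in> L"
      using eventually_subseq[OF k L(4)] by eventually_elim (use L(1) in simp)
    then have "g w \<in> L" by (rule Lim_in_closed_set[OF compact_imp_closed[OF L(2)] _ sequentially_bot lim])
    then show ?thesis using L(3) by blast
  qed
  then show thesis using that[OF k g] u by blast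
qed

lemma biholomorphic_to_model: "biholomorphically_equivalent \<Omega> (model H)"
proof -
  obtain k1 g where k1: "strict_mono (k1 :: nat \<Rightarrow> nat)" and g: "holomorphic_map_on g \<Omega>" "g ` \<Omega> \<subseteq> model H"
    and ug: "\<And>x. x \<in> \<Omega> \<Longrightarrow> \<exists>r>0. uniform_limit (ball x r) (\<lambda>n. G (k1 n)) g sequentially"
    using G_limit by blast
  interpret sub: scaling_sequence H m Ht \<delta> \<Omega> U V p q \<Phi> \<Phi>i "\<lambda>n. f (k1 n)" "\<lambda>n. fi (k1 n)" "\<lambda>n. l (k1 n)" "\<lambda>n. t (k1 n)" w0
    by (rule subsequence[OF k1])
  have sub_eq: "sub.F n = F (k1 n)" "sub.G n = G (k1 n)" for n
    by (auto simp: sub.F_def F_def sub.G_def G_def)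
  obtain k2 h where k2: "strict_mono (k2 :: nat \<Rightarrow> nat)" and h: "holomorphic_map_on h (model H)" "h ` model H \<subseteq> \<Omega>"
    and uh: "\<And>y. y \<in> model H \<Longrightarrow> \<exists>r>0. uniform_limit (ball y r) (\<lambda>n. F (k1 (k2 n))) h sequentially"
    using sub.F_limit unfolding sub_eq by blast
  define k where "k = (\<lambda>n. k1 (k2 n))"
  have k: "strict_mono k" using k1 k2 by (simp add: k_def strict_mono_def)
  have convG: "(\<lambda>n. G (k n) (z n)) \<longlonglongrightarrow> g x" if z: "z \<longlonglongrightarrow> x" and x: "x \<in> \<Omega>" for z x
  proof -
    obtain r where r: "r > 0" "uniform_limit (ball x r) (\<lambda>n. G (k1 n)) g sequentially" using ug[OF x] by blast
    have "uniform_limit (ball x r) (\<lambda>n. G (k n)) g sequentially"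
      using filterlim_compose[OF r(2) filterlim_subseq[OF k2]] by (simp add: k_def)
    then show ?thesis
      by (rule locally_uniform_limit_tendsto[OF _ r(1) holomorphic_map_on_imp_isCont[OF g(1) x] z])
  qed
  have convF: "(\<lambda>n. F (k n) (z n)) \<longlonglongrightarrow> h y" if z: "z \<longlonglongrightarrow> y" and y: "y \<in> model H" for z y
  proof -
    obtain r where r: "r > 0" "uniform_limit (ball y r) (\<lambda>n. F (k n)) h sequentially"
      using uh[OF y] unfolding k_def by blast
    show ?thesis
      by (rule locally_uniform_limit_tendsto[OF r(2,1) holomorphic_map_on_imp_isCont[OF h(1) y] z])
  qed
  have hg: "h (g x) = x" if x: "x \<in> \<Omega>" for x
  proof -
    have gx: "g x \<in> model H" using g(2) x by blast
    have "(\<lambda>n. F (k n) (G (k n) x)) \<longlonglongrightarrow> h (g x)" by (rule convF[OF convG[OF tendsto_const x] gx])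
    moreover have "\<forall>\<^sub>F n in sequentially. {x} \<subseteq> domG n" by (rule domG_exhausts) (use x in auto)
    from eventually_subseq[OF k this] have "\<forall>\<^sub>F n in sequentially. F (k n) (G (k n) x) = x"
      by eventually_elim (use F_G in blast)
    then have "(\<lambda>n. F (k n) (G (k n) x)) \<longlonglongrightarrow> x" by (rule tendsto_eventually)
    ultimately show ?thesis using LIMSEQ_unique by blast
  qed
  have gh: "g (h y) = y" if y: "y \<in> model H" for y
  proof -
    have hy: "h y \<in> \<Omega>" using h(2) y by blast
    have "(\<lambda>n. G (k n) (F (k n) y)) \<longlonglongrightarrow> g (h y)" by (rule convG[OF convF[OF tendsto_const y] hy])
    moreover have "\<forall>\<^sub>F n in sequentially. {y} \<subseteq> domF n" by (rule domF_exhausts) (use y in auto)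
    from eventually_subseq[OF k this] have "\<forall>\<^sub>F n in sequentially. G (k n) (F (k n) y) = y"
      by eventually_elim (use G_F in blast)
    then have "(\<lambda>n. G (k n) (F (k n) y)) \<longlonglongrightarrow> y" by (rule tendsto_eventually)
    ultimately show ?thesis using LIMSEQ_unique by blast
  qed
  have "bij_betw g \<Omega> (model H)"
    by (rule bij_betw_byWitness[where f' = h]) (use hg gh g(2) h(2) in auto)
  then have "biholomorphic_map \<Omega> (model H) g"
    unfolding biholomorphic_map_def using g(1) h(1) hg by blast
  then show ?thesis unfolding biholomorphically_equivalent_def by blast
qed

end

section \<open>Tangential orbits\<close>

lemma (in peaked_model) infdist_frontier_model_le:
  assumes y: "y \<in> model H"
  shows "infdist y (frontier (model H)) \<le> - \<rho> y"
proof -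
  define e where "e = - \<rho> y"
  have e: "e > 0" using y by (simp add: e_def model_iff)
  define sh where "sh = (\<lambda>s. diagonal_affine 1 1 (complex_of_real s) y)"
  have \<rho>sh: "\<rho> (sh s) = s - e" for s by (simp add: sh_def \<rho>_def e_def)
  have dsh: "dist (sh s) (sh s') \<le> \<bar>s - s'\<bar>" for s s'
  proof -
    have "sh s - sh s' = diagonal_affine 0 0 (of_real (s - s')) 0" by (rule vec2_eqI) (auto simp: sh_def)
    then show ?thesis using norm_diagonal_affine_le[of 0 0 "of_real (s - s')" 0] by (simp add: dist_norm del: of_real_diff)
  qed
  have "sh e \<in> closure (model H)"
    unfolding closure_approachable
  proof (intro allI impI)
    fix d :: real assume d: "d > 0"
    have "sh (e - d/2) \<in> model H" using d by (simp add: model_iff \<rho>sh)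
    moreover have "dist (sh (e - d/2)) (sh e) < d" using dsh[of "e - d/2" e] d by simp
    ultimately show "\<exists>y\<in>model H. dist y (sh e) < d" by blast
  qed
  moreover have "sh e \<notin> model H" by (simp add: model_iff \<rho>sh)
  ultimately have "sh e \<in> frontier (model H)" by (simp add: frontier_def interior_open[OF open_model])
  then have "infdist y (frontier (model H)) \<le> dist y (sh e)" by (rule infdist_le)
  also have "\<dots> \<le> e"
  proof -
    have "sh 0 = y" by (rule vec2_eqI) (auto simp: sh_def)
    then show ?thesis using dsh[of 0 e] e by simp
  qed
  finally show ?thesis by (simp add: e_def)
qed

text \<open>
  The second coordinate of the rescaled point is real and equals \<open>- 1\<close> minus \<open>H\<close> of the first
  coordinate, so the tangency bound on the first coordinate controls both.
\<close>

lemma (in peaked_model) tangential_rescaling_bounded: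
  assumes y: "y \<in> model H" and C: "C \<ge> 1" "norm (y $ 1) ^ (2*m) \<le> C * (- \<rho> y)"
    and B: "B > 0" "\<And>z. \<bar>H z\<bar> \<le> B * norm z ^ (2*m)"
  shows "norm (rescale (root (2*m) (- \<rho> y)) (Im (y $ 2)) y) \<le> C + (1 + B * C)"
    "\<rho> (rescale (root (2*m) (- \<rho> y)) (Im (y $ 2)) y) = - 1"
proof -
  define e where "e = - \<rho> y"
  have e: "e > 0" using y by (simp add: e_def model_iff)
  define l where "l = root (2*m) e"
  have l: "l > 0" "l ^ (2*m) = e" using e m by (auto simp: l_def)
  let ?w = "rescale l (Im (y $ 2)) y"
  have "\<rho> ?w = - 1" using \<rho>_rescale[OF l(1)] l(2) e by (simp add: e_def)
  then show "\<rho> (rescale (root (2*m) (- \<rho> y)) (Im (y $ 2)) y) = - 1" by (simp add: l_def e_def)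
  have "norm (?w $ 1) ^ (2*m) = norm (y $ 1) ^ (2*m) / e"
    using l by (simp add: rescale_def norm_divide norm_mult power_divide)
  also have "\<dots> \<le> C" using C(2) e by (simp add: e_def field_simps)
  finally have w1N: "norm (?w $ 1) ^ (2*m) \<le> C" .
  have w1: "norm (?w $ 1) \<le> C"
  proof (cases "norm (?w $ 1) \<le> 1")
    case False
    then have "norm (?w $ 1) \<le> norm (?w $ 1) ^ (2*m)" using m by (intro self_le_power) auto
    then show ?thesis using w1N by linarith
  qed (use C(1) in simp)
  have w2: "?w $ 2 = of_real (Re (y $ 2) / e)"
    by (simp add: rescale_def l complex_eq_iff)
  have "Re (y $ 2) = - e - H (y $ 1)" by (simp add: e_def \<rho>_def)
  then have "\<bar>Re (y $ 2)\<bar> \<le> e + \<bar>H (y $ 1)\<bar>" using e by linarith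
  also have "\<dots> \<le> e + B * (C * e)"
    using order_trans[OF B(2) mult_left_mono[OF C(2)]] B(1) by (simp add: e_def)
  finally have "\<bar>Re (y $ 2)\<bar> / e \<le> 1 + B * C" using e by (simp add: field_simps)
  then have w2': "norm (?w $ 2) \<le> 1 + B * C" unfolding w2 norm_of_real using e by simp
  have "norm ?w \<le> norm (?w $ 1) + norm (?w $ 2)"
    using norm_le_sum_component[of ?w] by (simp add: UNIV_2)
  then show "norm (rescale (root (2*m) (- \<rho> y)) (Im (y $ 2)) y) \<le> C + (1 + B * C)"
    using w1 w2' by (simp add: l_def e_def)
qed

text \<open>
  Close to \<open>p\<close> the first coordinates have norm at most \<open>1\<close>, so an order \<open>s \<le> 2m\<close> of tangency
  implies the estimate with the exponent \<open>2m\<close>. A convergent subsequence of the rescaled points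
  yields a scaling sequence.
\<close>

lemma (in peaked_model) tangential_orbit_imp_biholomorphic:
  fixes \<Omega> U V :: "(complex ^ 2) set" and p q :: "complex ^ 2"
  assumes \<Omega>: "open \<Omega>" "connected \<Omega>" "p \<in> frontier \<Omega>"
    and cond: "condition_M H \<Omega> p U V \<Phi>" and Aut: "range f \<subseteq> Aut \<Omega>" and q: "q \<in> \<Omega>"
    and s: "0 < s" "s \<le> 2 * real m" and tang: "converges_tangentially H \<Omega> U \<Phi> s (\<lambda>n. f n q) p"
  shows "biholomorphically_equivalent \<Omega> (model H)"
proof -
  have bih: "biholomorphic_map (U \<inter> \<Omega>) (V \<inter> model H) \<Phi>" and \<Phi>p: "\<Phi> p = 0" and U: "p \<in> U"
    and c\<Phi>: "continuous_on (U \<inter> closure \<Omega>) \<Phi>"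
    using cond by (auto simp: condition_M_def homeomorphism_def)
  have pcl: "p \<in> closure \<Omega>" using \<Omega>(3) by (simp add: frontier_def)
  have inv: "\<exists>g. holomorphic_map_on g T \<and> (\<forall>y\<in>T. g y \<in> S \<and> F (g y) = y) \<and> (\<forall>x\<in>S. g (F x) = x)"
    if b: "biholomorphic_map S T F" for S T :: "(complex ^ 2) set" and F
  proof -
    obtain g where "holomorphic_map_on g T" "\<forall>x\<in>S. g (F x) = x" "F ` S = T"
      using b unfolding biholomorphic_map_def bij_betw_def by blast
    then show ?thesis by (intro exI[of _ g]) auto
  qed
  obtain \<Phi>i where \<Phi>i: "holomorphic_map_on \<Phi>i (V \<inter> model H)" "\<And>y. y \<in> V \<inter> model H \<Longrightarrow> \<Phi>i y \<in> U \<inter> \<Omega> \<and> \<Phi> (\<Phi>i y) = y"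
    "\<And>z. z \<in> U \<inter> \<Omega> \<Longrightarrow> \<Phi>i (\<Phi> z) = z"
    using inv[OF bih] by blast
  have fb: "biholomorphic_map \<Omega> \<Omega> (f n)" for n using Aut by (auto simp: Aut_def)
  have f: "holomorphic_map_on (f n) \<Omega>" "\<And>x. x \<in> \<Omega> \<Longrightarrow> f n x \<in> \<Omega>" for n
    using fb[of n] by (auto simp: biholomorphic_map_def bij_betw_def)
  have "\<forall>n. \<exists>g. holomorphic_map_on g \<Omega> \<and> (\<forall>y\<in>\<Omega>. g y \<in> \<Omega> \<and> f n (g y) = y) \<and> (\<forall>x\<in>\<Omega>. g (f n x) = x)"
    using inv[OF fb] by blast
  then obtain fi where fi: "\<And>n. holomorphic_map_on (fi n) \<Omega>" "\<And>n y. y \<in> \<Omega> \<Longrightarrow> fi n y \<in> \<Omega> \<and> f n (fi n y) = y"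
    "\<And>n x. x \<in> \<Omega> \<Longrightarrow> fi n (f n x) = x" by metis
  define y where "y = (\<lambda>n. \<Phi> (f n q))"
  have fq: "f n q \<in> U \<inter> \<Omega>" for n using tang by (auto simp: converges_tangentially_def)
  have fqp: "(\<lambda>n. f n q) \<longlonglongrightarrow> p" using tang by (simp add: converges_tangentially_def)
  have ym: "y n \<in> model H" for n
    using bih fq[of n] by (auto simp: biholomorphic_map_def bij_betw_def y_def)
  have y0: "y \<longlonglongrightarrow> 0"
  proof -
    have "(\<lambda>n. \<Phi> (f n q)) \<longlonglongrightarrow> \<Phi> p"
      by (rule continuous_on_tendsto_compose[OF c\<Phi> fqp])
         (use U pcl fq closure_subset[of \<Omega>] in \<open>auto intro!: always_eventually\<close>)
    then show ?thesis by (simp add: y_def[abs_def] \<Phi>p)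
  qed
  define e where "e = (\<lambda>n. - \<rho> (y n))"
  have e: "e n > 0" for n using ym[of n] by (simp add: e_def model_iff)
  have e0: "e \<longlonglongrightarrow> 0"
  proof -
    have "(\<lambda>n. - \<rho> (y n)) \<longlonglongrightarrow> - \<rho> 0"
      by (intro tendsto_minus continuous_on_tendsto_compose[OF continuous_on_\<rho>[of UNIV] y0]) auto
    then show ?thesis by (simp add: e_def[abs_def] \<rho>_def H0)
  qed
  obtain C where C: "C \<ge> 1" "\<And>n. inverse C * norm (y n $ 1) powr s \<le> infdist (y n) (frontier (model H))"
    using tang by (auto simp: converges_tangentially_def comparable_def y_def)
  have tan1: "norm (y n $ 1) ^ (2*m) \<le> C * e n" if le1: "norm (y n $ 1) \<le> 1" for n
  proof -
    have "norm (y n $ 1) ^ (2*m) \<le> norm (y n $ 1) powr s"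
    proof (cases "y n $ 1 = 0")
      case True
      then show ?thesis using m by (simp add: power_0_left)
    next
      case False
      then have "norm (y n $ 1) ^ (2*m) = norm (y n $ 1) powr real (2*m)"
        using powr_realpow[of "norm (y n $ 1)" "2*m"] by simp
      also have "\<dots> \<le> norm (y n $ 1) powr s" using s le1 by (intro powr_mono') auto
      finally show ?thesis .
    qed
    also have "\<dots> \<le> C * infdist (y n) (frontier (model H))" using C(1) C(2)[of n] by (simp add: field_simps)
    also have "\<dots> \<le> C * e n" using infdist_frontier_model_le[OF ym] C(1) by (intro mult_left_mono) (auto simp: e_def)
    finally show ?thesis .
  qed
  obtain n0 where n0: "\<And>n. n \<ge> n0 \<Longrightarrow> norm (y n) \<le> 1"
  proof -
    have "\<forall>\<^sub>F n in sequentially. dist (y n) 0 < 1" using y0 by (rule tendstoD) simp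
    then show thesis using that by (auto simp: eventually_sequentially intro: less_imp_le)
  qed
  obtain B where B: "B > 0" "\<And>z. \<bar>H z\<bar> \<le> B * norm z ^ (2*m)" using H_bound by blast
  define l where "l = (\<lambda>n. root (2*m) (e n))"
  define w where "w = (\<lambda>n. rescale (l n) (Im (y n $ 2)) (y n))"
  have wb: "norm (w n) \<le> C + (1 + B * C)" "\<rho> (w n) = - 1" if "n \<ge> n0" for n
  proof -
    have "norm (y n $ 1) \<le> 1" using n0[OF that] Finite_Cartesian_Product.norm_nth_le order_trans by blast
    from tangential_rescaling_bounded[OF ym C(1) tan1[OF this, unfolded e_def] B]
    show "norm (w n) \<le> C + (1 + B * C)" "\<rho> (w n) = - 1" by (simp_all add: w_def l_def e_def)
  qed
  have "\<forall>n. w (n + n0) \<in> cball 0 (C + (1 + B * C))" using wb(1) by simp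
  then obtain w0 k where k: "strict_mono (k :: nat \<Rightarrow> nat)" and w0: "((\<lambda>n. w (n + n0)) \<circ> k) \<longlonglongrightarrow> w0"
    using compact_cball[of "0 :: complex ^ 2" "C + (1 + B * C)"] unfolding compact_def by meson
  have "(\<lambda>n. \<rho> (w (k n + n0))) \<longlonglongrightarrow> \<rho> w0"
    by (rule continuous_on_tendsto_compose[OF continuous_on_\<rho>[of UNIV]]) (use w0 in \<open>auto simp: o_def\<close>)
  then have \<rho>w0: "\<rho> w0 = - 1" using wb(2) LIMSEQ_unique[OF _ tendsto_const] by simp
  define \<sigma> where "\<sigma> = (\<lambda>n. k n + n0)"
  have \<sigma>: "strict_mono \<sigma>" using k by (simp add: \<sigma>_def strict_mono_def)
  note sq = LIMSEQ_subseq_LIMSEQ[OF _ \<sigma>, unfolded o_def]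
  have "scaling_sequence H m Ht \<delta> \<Omega> U V p q \<Phi> \<Phi>i (\<lambda>n. f (\<sigma> n)) (\<lambda>n. fi (\<sigma> n)) (\<lambda>n. l (\<sigma> n)) (\<lambda>n. Im (y (\<sigma> n) $ 2)) w0"
  proof unfold_locales
    show "(\<lambda>n. l (\<sigma> n)) \<longlonglongrightarrow> 0"
    proof (rule sq)
      have "(\<lambda>n. root (2*m) (e n)) \<longlonglongrightarrow> root (2*m) 0" by (intro tendsto_real_root e0)
      then show "l \<longlonglongrightarrow> 0" by (simp add: l_def)
    qed
    show "l (\<sigma> n) > 0" for n using e m by (simp add: l_def)
    show "(\<lambda>n. Im (y (\<sigma> n) $ 2)) \<longlonglongrightarrow> 0"
      using tendsto_Im[OF tendsto_vec_nth[OF y0, of 2]] by (intro sq) simp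
    show "(\<lambda>n. rescale (l (\<sigma> n)) (Im (y (\<sigma> n) $ 2)) (\<Phi> (f (\<sigma> n) q))) \<longlonglongrightarrow> w0"
      using w0 by (simp add: w_def \<sigma>_def y_def o_def)
    show "w0 \<in> model H" by (simp add: model_iff \<rho>w0)
    show "(\<lambda>n. f (\<sigma> n) q) \<longlonglongrightarrow> p" by (rule sq[OF fqp])
  qed (use \<Omega> q pcl cond f fi \<Phi>i fq in auto)
  then show ?thesis by (rule scaling_sequence.biholomorphic_to_model)
qed

theorem theorem1:
  fixes m :: nat and P :: "complex poly poly" and H :: "complex \<Rightarrow> real"
    and \<Omega> U V :: "(complex ^ 2) set" and p q :: "complex ^ 2"
    and \<Phi> :: "complex ^ 2 \<Rightarrow> complex ^ 2"
    and f :: "nat \<Rightarrow> complex ^ 2 \<Rightarrow> complex ^ 2" and s :: real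
  assumes "m \<ge> 1"
    and "\<And>z. complex_of_real (H z) = eval_zzbar P z"
    and "homogeneous_zzbar (2 * m) P"
    and "no_harmonic_terms P"
    and "continuous_subharmonic H"
    and "open \<Omega>" and "connected \<Omega>" and "p \<in> frontier \<Omega>"
    and "condition_M H \<Omega> p U V \<Phi>"
    and "range f \<subseteq> Aut \<Omega>" and "q \<in> \<Omega>"
    and "0 < s" and "s \<le> 2 * real m"
    and "converges_tangentially H \<Omega> U \<Phi> s (\<lambda>n. f n q) p"
  shows "biholomorphically_equivalent \<Omega> (model H)"
proof (rule bumped_subharmonic[OF assms(1-5)])
  fix Ht :: "complex \<Rightarrow> real" and \<delta> :: real
  assume "\<And>r z. H (of_real r * z) = r ^ (2 * m) * H z"
    "\<And>z. z \<noteq> 0 \<Longrightarrow> supported_at H z"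
    "\<delta> > 0" "continuous_on UNIV Ht" "Ht 0 = 0"
    "\<And>z. Ht z \<le> H z - \<delta> * norm z ^ (2 * m)"
    "\<And>z. z \<noteq> 0 \<Longrightarrow> supported_at Ht z"
  moreover have "continuous_on UNIV H" using assms(5) by (simp add: continuous_subharmonic_def)
  ultimately interpret peaked_model H m Ht \<delta>
    by unfold_locales (use assms(1) in auto)
  show ?thesis by (rule tangential_orbit_imp_biholomorphic[OF assms(6-14)])
qed

end
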